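(* The group $\mathrm{Osc}_{1,0}$ admits a lattice. For $q>0$ and $\mu\in(\mathbb R\setminus\{0\})^q$, the group $\mathrm{Osc}_{1,q}(1,\mu)$ admits a lattice (a discrete cocompact subgroup) if and only if there exist an integer $0\le\bar q\le q$ and a polynomial $f\in F^+_{2\bar q+2}$ such that $\mu\in M_{f,q}$.
   Context: Definition of $\mathfrak{osc}_{1,q}(1,\mu)$: for $q\ge0$ and $\mu=(\mu_1,\dots,\mu_q)\in(\mathbb R\setminus\{0\})^q$ (with $\mu$ empty if $q=0$), let $\mathfrak a=\mathbb C^{1+q}$ as a real vector space with inner product $\langle z,w\rangle_{\mathfrak a}=\mathrm{Re}z_0\mathrm{Re}w_0-\mathrm{Im}z_0\mathrm{Im}w_0+\sum_{j=1}^q\mathrm{Re}(z_j\bar w_j)$, and let $L(z_0,\dots,z_q)=i(\bar z_0,\mu_1z_1,\dots,\mu_qz_q)$. The Lie algebra $\mathfrak{osc}_{1,q}(1,\mu)=\mathbb R\oplus\mathfrak a\oplus\mathbb R$, with elements $(z,a,t)$, has central first summand and brackets $[t,a]=tL(a)$, $[a,a']=\langle La,a'\rangle_{\mathfrak a}\in\mathbb R$ (first summand), and $[t,t']=0$. Equivalently, with $\omega(a,a')=\langle La,a'\rangle_{\mathfrak a}$, it is the semidirect product of the Heisenberg algebra $\mathbb R\oplus\mathfrak a$ with $\mathbb R$ acting by $L$ on $\mathfrak a$ and trivially on the centre. $\mathrm{Osc}_{1,q}(1,\mu)$ denotes the simply-connected Lie group with this Lie algebra, and $\mathrm{Osc}_{1,0}$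 denotes the case $q=0$. $F^+_2=\{x^2-ax+1: a\in\mathbb Z,\ a\ge3\}$. For $k\ge2$, $F^+_{2k}$ is the set of monic polynomials $f\in\mathbb Z[x]$ of degree $2k$ that are irreducible over $\mathbb Z$, have exactly $2k-2$ roots on the unit circle, and whose two remaining roots are real and positive. Then these two roots are $r>1$ and $1/r$, and $F^+_{2k}$ is the set of minimal polynomials of Salem numbers of degree $2k$. For $q>0$, $0\le\bar q\le q$ and $f\in F^+_{2\bar q+2}$ with roots $r>1$, $1/r$ and $\nu_1^{\pm1},\dots,\nu_{\bar q}^{\pm1}$ on the unit circle, define $$M_{f,q}=\{(\mu_1,\dots,\mu_q)\in(\mathbb R\setminus\{0\})^q : \{r^{\pm i\mu_1},\dots,r^{\pm i\mu_q}\}_!=\{\nu_1^{\pm1},\dots,\nu_{\bar q}^{\pm1},1,\dots,1\}_!\},$$ where $\{\cdot\}_!$ denotes multisets (elements counted with multiplicity), $r^{\pm i\mu}=e^{\pm i\mu\ln r}$, and $1$ appears $2(q-\bar q)$ times on the right. *)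

theory Defs
  imports "HOL-Analysis.Analysis" "HOL-Computational_Algebra.Polynomial"
begin

text \<open>The vector space a = C^(1+q) is represented by functions nat => complex that vanish
  outside {0..q}; elements of Osc_{1,q}(1,mu) are triples (z, a, t).
  The parameter mu is a function nat => real, of which only mu 1, ..., mu q matter.\<close>

definition osc_L :: "nat \<Rightarrow> (nat \<Rightarrow> real) \<Rightarrow> (nat \<Rightarrow> complex) \<Rightarrow> (nat \<Rightarrow> complex)" where
  "osc_L q \<mu> a = (\<lambda>j. if j = 0 then \<i> * cnj (a 0)
                       else if j \<le> q then \<i> * complex_of_real (\<mu> j) * a j else 0)"

definition osc_inner :: "nat \<Rightarrow> (nat \<Rightarrow> complex) \<Rightarrow> (nat \<Rightarrow> complex) \<Rightarrow> real" where
  "osc_inner q a b = Re (a 0) * Re (b 0) - Im (a 0) * Im (b 0)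
                     + (\<Sum>j\<in>{1..q}. Re (a j * cnj (b j)))"

definition osc_omega :: "nat \<Rightarrow> (nat \<Rightarrow> real) \<Rightarrow> (nat \<Rightarrow> complex) \<Rightarrow> (nat \<Rightarrow> complex) \<Rightarrow> real" where
  "osc_omega q \<mu> a b = osc_inner q (osc_L q \<mu> a) b"

definition osc_expL :: "nat \<Rightarrow> (nat \<Rightarrow> real) \<Rightarrow> real \<Rightarrow> (nat \<Rightarrow> complex) \<Rightarrow> (nat \<Rightarrow> complex)" where
  "osc_expL q \<mu> t a = (\<lambda>j. \<Sum>n. complex_of_real (t ^ n / fact n) * ((osc_L q \<mu> ^^ n) a) j)"

definition osc_carrier :: "nat \<Rightarrow> (real \<times> (nat \<Rightarrow> complex) \<times> real) set" where
  "osc_carrier q = {(z, a, t). \<forall>j>q. a j = 0}"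

text \<open>Group law of the simply connected group Osc_{1,q}(1,mu): the semidirect product of the
  Heisenberg group R x a (law (z,a)(z',a') = (z+z'+omega(a,a')/2, a+a')) with R acting by exp(tL).\<close>
definition osc_mult :: "nat \<Rightarrow> (nat \<Rightarrow> real) \<Rightarrow> real \<times> (nat \<Rightarrow> complex) \<times> real
      \<Rightarrow> real \<times> (nat \<Rightarrow> complex) \<times> real \<Rightarrow> real \<times> (nat \<Rightarrow> complex) \<times> real" where
  "osc_mult q \<mu> x y = (case x of (z, a, t) \<Rightarrow> case y of (z', a', t') \<Rightarrow>
      (z + z' + osc_omega q \<mu> a (osc_expL q \<mu> t a') / 2,
       (\<lambda>j. a j + osc_expL q \<mu> t a' j),
       t + t'))"

definition osc_one :: "real \<times> (nat \<Rightarrow> complex) \<times> real" where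
  "osc_one = (0, (\<lambda>j. 0), 0)"

text \<open>A lattice: a discrete cocompact subgroup (topology: product topology, which on the
  carrier is the Euclidean topology of R x C^(1+q) x R).\<close>
definition osc_lattice :: "nat \<Rightarrow> (nat \<Rightarrow> real) \<Rightarrow> (real \<times> (nat \<Rightarrow> complex) \<times> real) set \<Rightarrow> bool" where
  "osc_lattice q \<mu> \<Gamma> \<longleftrightarrow>
     \<Gamma> \<subseteq> osc_carrier q \<and> osc_one \<in> \<Gamma> \<and>
     (\<forall>x\<in>\<Gamma>. \<forall>y\<in>\<Gamma>. osc_mult q \<mu> x y \<in> \<Gamma>) \<and>
     (\<forall>x\<in>\<Gamma>. \<exists>y\<in>\<Gamma>. osc_mult q \<mu> x y = osc_one \<and> osc_mult q \<mu> y x = osc_one) \<and>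
     (\<forall>\<gamma>\<in>\<Gamma>. \<exists>U. open U \<and> U \<inter> \<Gamma> = {\<gamma>}) \<and>
     (\<exists>K. compact K \<and> K \<subseteq> osc_carrier q \<and>
          osc_carrier q \<subseteq> {osc_mult q \<mu> k \<gamma> | k \<gamma>. k \<in> K \<and> \<gamma> \<in> \<Gamma>})"

definition osc_admits_lattice :: "nat \<Rightarrow> (nat \<Rightarrow> real) \<Rightarrow> bool" where
  "osc_admits_lattice q \<mu> \<longleftrightarrow> (\<exists>\<Gamma>. osc_lattice q \<mu> \<Gamma>)"

definition Fplus :: "nat \<Rightarrow> int poly set" where
  "Fplus n =
    (if n = 2 then {[:1, - a, 1:] | a. a \<ge> 3}
     else if even n \<and> n \<ge> 4 then
       {f. lead_coeff f = 1 \<and> degree f = n \<and> irreducible f \<and>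
           size (filter_mset (\<lambda>z. cmod z = 1) (proots (map_poly of_int f :: complex poly))) = n - 2 \<and>
           (\<forall>z. poly (map_poly of_int f :: complex poly) z = 0 \<and> cmod z \<noteq> 1 \<longrightarrow>
                 z \<in> \<real> \<and> Re z > 0)}
     else {})"

definition in_M :: "int poly \<Rightarrow> nat \<Rightarrow> nat \<Rightarrow> (nat \<Rightarrow> real) \<Rightarrow> bool" where
  "in_M f q qb \<mu> \<longleftrightarrow>
     (\<forall>j\<in>{1..q}. \<mu> j \<noteq> 0) \<and>
     (\<exists>r::real. r > 1 \<and> poly (map_poly of_int f) r = 0 \<and>
        image_mset (\<lambda>j. exp (\<i> * complex_of_real (\<mu> j * ln r))) (mset_set {1..q})
        + image_mset (\<lambda>j. exp (- \<i> * complex_of_real (\<mu> j * ln r))) (mset_set {1..q})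
        = filter_mset (\<lambda>z. cmod z = 1) (proots (map_poly of_int f :: complex poly))
          + replicate_mset (2 * (q - qb)) 1)"

end

theory Submission
  imports Defs "HOL-Library.Function_Algebras" "Jordan_Normal_Form.Char_Poly"
begin

text \<open>
  Let $u, v$ be the coordinates of $z_0$ in which $e^{tL}$ acts by $e^{t}, e^{-t}$; on $z_j$ it is the
  rotation by $\mu_j t$.

  Let $\Gamma$ be a lattice, $\Lambda$ the projection of $\Gamma \cap (\mathbb R \oplus \mathfrak a)$ to
  $\mathfrak a$ and $D$ the projection of $\Gamma$ to the last factor. If $D$ were dense, then for small
  $\lambda \in \Lambda$ the central elements $\omega(\lambda, e^{tL}\lambda)$ of $\Gamma$ with small $t \in D$
  would vanish, which puts $\lambda$ on an axis $u$ or $v$, where conjugation contracts it; so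
  $\lambda = 0$, hence $u = 0$ on $\Lambda$, hence $u$ is a function of $t$ on $\Gamma$, against
  cocompactness. So $D$ is discrete, $\Lambda$ is a lattice in $\mathfrak a$ invariant under $e^{tL}$ for
  some $t > 0$, and the characteristic polynomial $P$ of $e^{tL}$ is integral. Let $f$ be the irreducible
  factor of $P$ with root $e^t$. An eigenvalue that is not a root of $f$ is a root of unity, because
  $f(e^{tL})\Lambda$ has bounded, hence finite, orbits. Replacing $t$ by a multiple, all of these become $1$.

  Conversely, given $f$ with root $r = e^{t}$, the group $\mathbb Z[x, x^{-1}]$ is embedded in $\mathfrak a$ by
  evaluation at the roots of $f$. The form $\omega$ pulls back to the trace form
  $\sum_\rho \delta(\rho)\, p(\rho)\, p'(\rho^{-1})$, where $\delta(\rho) = s(\rho + \rho^{-1})(\rho - \rho^{-1})$ and the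
  signs of $s \in \mathbb Z[y]$ at the numbers $\rho + \rho^{-1}$ are adapted to those of the $\mu_j$.
\<close>

section \<open>Coordinates\<close>

text \<open>Commutators make the discreteness of \<Gamma> usable: elements of \<Gamma> over
  \<open>a\<close> and \<open>b\<close> in \<Lambda> have unknown central parts, but their
  commutator is exactly \<open>(osc_form q \<mu> a b, 0, 0)\<close>. So the nonzero values of the
  form on \<Lambda> stay away from 0. As all \<open>\<mu> j\<close> are nonzero, the form is
  nondegenerate, and a relatively dense \<Lambda> is therefore discrete. Density of \<Lambda> in
  turn needs discrete periods, which is why these are settled before. On the arithmetic side,
  \<open>exp t\<close> is a simple root of \<open>P\<close>. Hence \<open>f\<close> does not divide
  its cofactor in \<open>P\<close>, and once the eigenvalues outside \<open>f\<close> are 1, all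
  multiplicities are determined. In the converse the trace form is integral for every integer
  polynomial \<open>s\<close>, and alternating because \<delta> changes sign under inversion.
  Rescaling coordinate \<open>j\<close> by a real factor adapts the size of its coefficient to
  \<open>\<mu> j\<close>, but never the sign; only \<open>s\<close> can do that. The signs can be
  chosen independently since the numbers \<rho> + 1/\<rho> are real and distinct for different
  inverse pairs of roots.\<close>

definition osc_space :: "nat \<Rightarrow> (nat \<Rightarrow> complex) set" where
  "osc_space q = {a. \<forall>j>q. a j = 0}"

text \<open>\<open>L\<close> interchanges the real and imaginary parts of \<open>a 0\<close>; this
  coordinate and \<open>cneg\<close> belong to its eigenvalues 1 and -1.\<close>

definition cpos :: "(nat \<Rightarrow> complex) \<Rightarrow> real" where
  "cpos a = Re (a 0) + Im (a 0)"

definition cneg :: "(nat \<Rightarrow> complex) \<Rightarrow> real" where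
  "cneg a = Re (a 0) - Im (a 0)"

text \<open>The exponential of \<open>t L\<close> in closed form; \<open>osc_expL_eq\<close>
  identifies it with the series on \<open>osc_space q\<close>. Being independent of
  \<open>q\<close>, it obeys the flow laws on all functions.\<close>

definition flow :: "(nat \<Rightarrow> real) \<Rightarrow> real \<Rightarrow> (nat \<Rightarrow> complex) \<Rightarrow> (nat \<Rightarrow> complex)" where
  "flow \<mu> t a = (\<lambda>j. if j = 0
     then Complex ((exp t * cpos a + exp (- t) * cneg a) / 2) ((exp t * cpos a - exp (- t) * cneg a) / 2)
     else cis (\<mu> j * t) * a j)"

definition anorm :: "nat \<Rightarrow> (nat \<Rightarrow> complex) \<Rightarrow> real" where
  "anorm q a = (\<Sum>j\<le>q. cmod (a j))"

lemma osc_space_add [simp]: "a \<in> osc_space q \<Longrightarrow> b \<in> osc_space q \<Longrightarrow> a + b \<in> osc_space q"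
  and osc_space_diff [simp]: "a \<in> osc_space q \<Longrightarrow> b \<in> osc_space q \<Longrightarrow> a - b \<in> osc_space q"
  and osc_space_uminus [simp]: "a \<in> osc_space q \<Longrightarrow> - a \<in> osc_space q"
  and osc_space_zero [simp]: "0 \<in> osc_space q"
  and osc_space_flow [simp]: "a \<in> osc_space q \<Longrightarrow> flow \<mu> t a \<in> osc_space q"
  by (auto simp: osc_space_def flow_def)

lemma cpos_add [simp]: "cpos (a + b) = cpos a + cpos b"
  and cpos_diff [simp]: "cpos (a - b) = cpos a - cpos b"
  and cpos_uminus [simp]: "cpos (- a) = - cpos a"
  and cpos_zero [simp]: "cpos 0 = 0"
  and cneg_add [simp]: "cneg (a + b) = cneg a + cneg b"
  and cneg_diff [simp]: "cneg (a - b) = cneg a - cneg b"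
  and cneg_uminus [simp]: "cneg (- a) = - cneg a"
  and cneg_zero [simp]: "cneg 0 = 0"
  by (auto simp: cpos_def cneg_def)

lemma osc_space_eqI:
  assumes "a \<in> osc_space q" "b \<in> osc_space q" "cpos a = cpos b" "cneg a = cneg b"
    and "\<And>j. j \<in> {1..q} \<Longrightarrow> a j = b j"
  shows "a = b"
proof
  fix j
  have "a 0 = b 0" using assms(3,4) by (simp add: cpos_def cneg_def complex_eq_iff)
  thus "a j = b j" using assms(1,2) assms(5)[of j] 
    by (cases "j = 0"; cases "j \<le> q") (auto simp: osc_space_def)
qed

lemma cpos_flow [simp]: "cpos (flow \<mu> t a) = exp t * cpos a"
  and cneg_flow [simp]: "cneg (flow \<mu> t a) = exp (- t) * cneg a"
  by (simp_all add: cpos_def cneg_def flow_def field_simps)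

lemma flow_coord [simp]: "j \<noteq> 0 \<Longrightarrow> flow \<mu> t a j = cis (\<mu> j * t) * a j"
  by (simp add: flow_def)

lemma eq_if_coords:
  assumes "cpos a = cpos b" "cneg a = cneg b" "\<And>j. j \<noteq> 0 \<Longrightarrow> a j = b j"
  shows "a = b"
proof
  fix j
  have "a 0 = b 0" using assms by (simp add: cpos_def cneg_def complex_eq_iff)
  thus "a j = b j" using assms(3)[of j] by (cases "j = 0") auto
qed

lemma flow_add [simp]: "flow \<mu> t (a + b) = flow \<mu> t a + flow \<mu> t b"
  and flow_diff [simp]: "flow \<mu> t (a - b) = flow \<mu> t a - flow \<mu> t b"
  and flow_uminus [simp]: "flow \<mu> t (- a) = - flow \<mu> t a"
  and flow_zero [simp]: "flow \<mu> t 0 = 0"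
  by (rule eq_if_coords; simp add: algebra_simps)+

lemma flow_flow: "flow \<mu> s (flow \<mu> t a) = flow \<mu> (s + t) a"
  by (rule eq_if_coords)
    (simp_all add: cis_mult distrib_left flip: mult.assoc exp_add)

lemma flow_0 [simp]: "flow \<mu> 0 a = a"
  by (rule eq_if_coords) simp_all

text \<open>On coordinate 0 the square of \<open>L\<close> is the identity, and the two summands are
  the eigenvectors for 1 and -1. Membership in \<open>osc_space q\<close> reconciles the power of
  \<open>\<mu> j\<close> with the value 0 of \<open>osc_L\<close> beyond \<open>q\<close>.\<close>

lemma osc_L_iterate:
  assumes "a \<in> osc_space q"
  shows "(osc_L q \<mu> ^^ n) a j =
    (if j = 0 then (a 0 + \<i> * cnj (a 0)) / 2 + (- 1) ^ n * ((a 0 - \<i> * cnj (a 0)) / 2)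
     else (\<i> * complex_of_real (\<mu> j)) ^ n * a j)"
proof (induction n arbitrary: j)
  case 0
  show ?case by (simp add: field_simps)
next
  case (Suc n)
  show ?case
  proof (cases "j = 0")
    case True
    thus ?thesis using Suc.IH[of 0] by (simp add: osc_L_def complex_eq_iff field_simps)
  next
    case False
    thus ?thesis using Suc.IH[of j] assms by (auto simp: osc_L_def osc_space_def)
  qed
qed

lemma osc_expL_eq:
  assumes "a \<in> osc_space q"
  shows "osc_expL q \<mu> t a = flow \<mu> t a"
proof
  fix j
  have e: "(\<lambda>n. complex_of_real (t ^ n / fact n) * z ^ n) sums exp (of_real t * z)" for z :: complex
    using exp_converges[of "of_real t * z"]
    by (simp add: scaleR_conv_of_real power_mult_distrib field_simps)
  have "(\<lambda>n. complex_of_real (t ^ n / fact n) * (osc_L q \<mu> ^^ n) a j) sums flow \<mu> t a j"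
  proof (cases "j = 0")
    case True
    let ?\<alpha> = "(a 0 + \<i> * cnj (a 0)) / 2" and ?\<beta> = "(a 0 - \<i> * cnj (a 0)) / 2"
    have "(\<lambda>n. complex_of_real (t ^ n / fact n) * 1 ^ n * ?\<alpha> + complex_of_real (t ^ n / fact n) * (-1) ^ n * ?\<beta>)
        sums (exp (of_real t * 1) * ?\<alpha> + exp (of_real t * (-1)) * ?\<beta>)"
      by (intro sums_add sums_mult2 e)
    also have "exp (of_real t * 1) * ?\<alpha> + exp (of_real t * (-1)) * ?\<beta> = flow \<mu> t a j"
      using True by (simp add: flow_def cpos_def cneg_def complex_eq_iff exp_of_real flip: of_real_minus)
        (simp add: field_simps)
    finally show ?thesis using True
      by (simp add: osc_L_iterate[OF assms] algebra_simps del: of_real_divide of_real_power)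
  next
    case False
    have "(\<lambda>n. complex_of_real (t ^ n / fact n) * (\<i> * complex_of_real (\<mu> j)) ^ n * a j)
        sums (exp (of_real t * (\<i> * complex_of_real (\<mu> j))) * a j)"
      by (intro sums_mult2 e)
    also have "exp (of_real t * (\<i> * complex_of_real (\<mu> j))) = cis (\<mu> j * t)"
      by (simp add: cis_conv_exp mult_ac)
    finally show ?thesis using False
      by (simp add: osc_L_iterate[OF assms] mult.assoc del: of_real_divide of_real_power)
  qed
  thus "osc_expL q \<mu> t a j = flow \<mu> t a j"
    by (simp add: osc_expL_def sums_iff)
qed

text \<open>The form of \<open>osc_omega_eq\<close> in eigen-coordinates: in the plane of
  \<open>a 0\<close> both axes are isotropic and paired with each other, and coordinate
  \<open>j\<close> carries the area form weighted by \<open>\<mu> j\<close>.\<close>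

definition osc_form :: "nat \<Rightarrow> (nat \<Rightarrow> real) \<Rightarrow> (nat \<Rightarrow> complex) \<Rightarrow> (nat \<Rightarrow> complex) \<Rightarrow> real" where
  "osc_form q \<mu> a b = (cpos a * cneg b - cneg a * cpos b) / 2 + (\<Sum>j\<in>{1..q}. \<mu> j * Im (cnj (a j) * b j))"

lemma osc_omega_eq: "osc_omega q \<mu> a b = osc_form q \<mu> a b"
proof -
  have "(\<Sum>j\<in>{1..q}. Re (osc_L q \<mu> a j * cnj (b j))) = (\<Sum>j\<in>{1..q}. \<mu> j * Im (cnj (a j) * b j))"
    by (rule sum.cong) (auto simp: osc_L_def algebra_simps)
  thus ?thesis
    by (simp add: osc_omega_def osc_inner_def osc_form_def osc_L_def cpos_def cneg_def field_simps)
qed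

lemma osc_form_add_left: "osc_form q \<mu> (a + b) c = osc_form q \<mu> a c + osc_form q \<mu> b c"
  and osc_form_add_right: "osc_form q \<mu> c (a + b) = osc_form q \<mu> c a + osc_form q \<mu> c b"
  and osc_form_diff_left: "osc_form q \<mu> (a - b) c = osc_form q \<mu> a c - osc_form q \<mu> b c"
  and osc_form_diff_right: "osc_form q \<mu> c (a - b) = osc_form q \<mu> c a - osc_form q \<mu> c b"
  and osc_form_minus_left: "osc_form q \<mu> (- a) c = - osc_form q \<mu> a c"
  and osc_form_minus_right: "osc_form q \<mu> c (- a) = - osc_form q \<mu> c a"
  and osc_form_zero_left [simp]: "osc_form q \<mu> 0 c = 0"
  and osc_form_zero_right [simp]: "osc_form q \<mu> c 0 = 0"
  by (simp_all add: osc_form_def algebra_simps sum.distrib sum_subtractf sum_negf diff_divide_distrib add_divide_distrib)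

lemmas osc_form_bilin = osc_form_add_left osc_form_add_right osc_form_diff_left osc_form_diff_right
  osc_form_minus_left osc_form_minus_right

lemma osc_form_anti: "osc_form q \<mu> a b = - osc_form q \<mu> b a"
  by (simp add: osc_form_def algebra_simps diff_divide_distrib sum_subtractf sum_negf)

lemma osc_form_self [simp]: "osc_form q \<mu> a a = 0"
  using osc_form_anti[of q \<mu> a a] by simp

lemma anorm_ge0 [simp]: "0 \<le> anorm q a"
  by (simp add: anorm_def sum_nonneg)

lemma anorm_zero [simp]: "anorm q 0 = 0" by (simp add: anorm_def)

lemma anorm_minus [simp]: "anorm q (- a) = anorm q a" by (simp add: anorm_def)

lemma anorm_triangle: "anorm q (a + b) \<le> anorm q a + anorm q b"
  by (simp add: anorm_def norm_triangle_ineq sum_mono flip: sum.distrib)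

lemma anorm_triangle_diff: "anorm q (a - b) \<le> anorm q a + anorm q b"
  using anorm_triangle[of q a "-b"] by simp

lemma anorm_eq_0: "a \<in> osc_space q \<Longrightarrow> anorm q a = 0 \<Longrightarrow> a = 0"
proof
  fix j assume "a \<in> osc_space q" "anorm q a = 0"
  thus "a j = 0 j" unfolding osc_space_def anorm_def
    by (subst (asm) sum_nonneg_eq_0_iff) (cases "j \<le> q"; auto)+
qed

lemma cmod_le_anorm: "j \<le> q \<Longrightarrow> cmod (a j) \<le> anorm q a"
  unfolding anorm_def by (rule member_le_sum) auto

lemma anorm_leI: "(\<And>j. j \<le> q \<Longrightarrow> cmod (a j) \<le> M) \<Longrightarrow> anorm q a \<le> real (Suc q) * M"
  unfolding anorm_def using sum_bounded_above[of "{..q}" "\<lambda>j. cmod (a j)" M] by simp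

lemma cpos_le_anorm: "\<bar>cpos a\<bar> \<le> 2 * anorm q a"
  and cneg_le_anorm: "\<bar>cneg a\<bar> \<le> 2 * anorm q a"
  using cmod_le_anorm[of 0 q a] abs_Re_le_cmod[of "a 0"] abs_Im_le_cmod[of "a 0"]
  by (auto simp: cpos_def cneg_def abs_le_iff)

lemma osc_form_bound: "\<exists>C>0. \<forall>a b. \<bar>osc_form q \<mu> a b\<bar> \<le> C * anorm q a * anorm q b"
proof (intro exI conjI allI)
  let ?C = "4 + (\<Sum>j\<in>{1..q}. \<bar>\<mu> j\<bar>)"
  show "?C > 0" by (simp add: add_pos_nonneg sum_nonneg)
  fix a b
  have h: "\<bar>cpos a * cneg b\<bar> \<le> (2 * anorm q a) * (2 * anorm q b)" 
          "\<bar>cneg a * cpos b\<bar> \<le> (2 * anorm q a) * (2 * anorm q b)"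
    unfolding abs_mult by (intro mult_mono cpos_le_anorm cneg_le_anorm; simp)+
  have 1: "\<bar>(cpos a * cneg b - cneg a * cpos b) / 2\<bar> \<le> 4 * anorm q a * anorm q b"
    using h abs_triangle_ineq4[of "cpos a * cneg b" "cneg a * cpos b"] by simp
  have "\<bar>\<Sum>j\<in>{1..q}. \<mu> j * Im (cnj (a j) * b j)\<bar> \<le> (\<Sum>j\<in>{1..q}. \<bar>\<mu> j\<bar> * (anorm q a * anorm q b))"
  proof (rule order.trans[OF sum_abs sum_mono])
    fix j assume j: "j \<in> {1..q}"
    have "\<bar>Im (cnj (a j) * b j)\<bar> \<le> cmod (cnj (a j) * b j)" by (rule abs_Im_le_cmod)
    also have "\<dots> = cmod (a j) * cmod (b j)" by (simp add: norm_mult)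
    also have "\<dots> \<le> anorm q a * anorm q b"
      using j by (intro mult_mono cmod_le_anorm) auto
    finally show "\<bar>\<mu> j * Im (cnj (a j) * b j)\<bar> \<le> \<bar>\<mu> j\<bar> * (anorm q a * anorm q b)"
      unfolding abs_mult by (intro mult_left_mono) auto
  qed
  also have "\<dots> = (\<Sum>j\<in>{1..q}. \<bar>\<mu> j\<bar>) * anorm q a * anorm q b"
    by (simp add: sum_distrib_right mult.assoc)
  finally show "\<bar>osc_form q \<mu> a b\<bar> \<le> ?C * anorm q a * anorm q b"
    unfolding osc_form_def distrib_right using 1 by (intro order.trans[OF abs_triangle_ineq] add_mono)
qed

text \<open>Only uniformity for bounded \<open>t\<close> matters; the factor 8 generously covers the
  passage to the eigen-coordinates and back.\<close>

lemma anorm_flow_le: "anorm q (flow \<mu> t a) \<le> 8 * exp \<bar>t\<bar> * anorm q a"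
proof -
  have e: "exp t \<le> exp \<bar>t\<bar>" "exp (- t) \<le> exp \<bar>t\<bar>" "1 \<le> exp \<bar>t\<bar>" by auto
  have "\<bar>cpos a\<bar> \<le> 2 * cmod (a 0)" "\<bar>cneg a\<bar> \<le> 2 * cmod (a 0)"
    using abs_Re_le_cmod[of "a 0"] abs_Im_le_cmod[of "a 0"] by (auto simp: cpos_def cneg_def)
  hence p: "\<bar>exp t * cpos a\<bar> \<le> exp \<bar>t\<bar> * (2 * cmod (a 0))" "\<bar>exp (- t) * cneg a\<bar> \<le> exp \<bar>t\<bar> * (2 * cmod (a 0))"
    unfolding abs_mult using e by (auto intro!: mult_mono)
  have "cmod (flow \<mu> t a 0) \<le> \<bar>Re (flow \<mu> t a 0)\<bar> + \<bar>Im (flow \<mu> t a 0)\<bar>" by (rule cmod_le)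
  also have "\<dots> \<le> 8 * exp \<bar>t\<bar> * cmod (a 0)" 
  proof -
    have "\<bar>(x + y) / 2\<bar> + \<bar>(x - y) / 2\<bar> \<le> 8 * X"
      if "\<bar>x\<bar> \<le> 2 * X" "\<bar>y\<bar> \<le> 2 * X" for x y X :: real
      using that abs_triangle_ineq[of x y] abs_triangle_ineq4[of x y] abs_ge_zero[of x]
      unfolding abs_divide abs_numeral by linarith
    from this[of "exp t * cpos a" "exp \<bar>t\<bar> * cmod (a 0)" "exp (- t) * cneg a"]
    show ?thesis using p by (simp add: flow_def mult_ac)
  qed
  finally have 0: "cmod (flow \<mu> t a 0) \<le> 8 * exp \<bar>t\<bar> * cmod (a 0)" .
  have "cmod (flow \<mu> t a j) \<le> 8 * exp \<bar>t\<bar> * cmod (a j)" for j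
  proof (cases "j = 0")
    case False
    hence "cmod (flow \<mu> t a j) = 1 * cmod (a j)" by (simp add: norm_mult)
    also have "\<dots> \<le> 8 * exp \<bar>t\<bar> * cmod (a j)" using e(3) by (intro mult_right_mono norm_ge_zero) linarith
    finally show ?thesis .
  qed (use 0 in simp)
  thus ?thesis by (simp add: anorm_def sum_distrib_left sum_mono)
qed

lemma osc_carrier_iff: "(z, a, t) \<in> osc_carrier q \<longleftrightarrow> a \<in> osc_space q"
  by (simp add: osc_carrier_def osc_space_def)

lemma osc_mult_eq:
  assumes "a' \<in> osc_space q"
  shows "osc_mult q \<mu> (z, a, t) (z', a', t') =
    (z + z' + osc_form q \<mu> a (flow \<mu> t a') / 2, a + flow \<mu> t a', t + t')"
  by (simp add: osc_mult_def osc_expL_eq[OF assms] osc_omega_eq fun_eq_iff)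

lemma osc_one_eq: "osc_one = (0, 0, 0)"
  by (simp add: osc_one_def zero_fun_def)

section \<open>Lattices in the symplectic vector space\<close>

definition add_subgroup :: "'a::ab_group_add set \<Rightarrow> bool" where
  "add_subgroup A \<longleftrightarrow> 0 \<in> A \<and> (\<forall>a\<in>A. \<forall>b\<in>A. a - b \<in> A)"

lemma add_subgroup_zero: "add_subgroup A \<Longrightarrow> 0 \<in> A"
  and add_subgroup_diff: "add_subgroup A \<Longrightarrow> a \<in> A \<Longrightarrow> b \<in> A \<Longrightarrow> a - b \<in> A"
  by (auto simp: add_subgroup_def)

lemma add_subgroup_uminus: "add_subgroup A \<Longrightarrow> a \<in> A \<Longrightarrow> - a \<in> A"
  using add_subgroup_diff[of A 0 a] add_subgroup_zero[of A] by simp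

lemma add_subgroup_add: "add_subgroup A \<Longrightarrow> a \<in> A \<Longrightarrow> b \<in> A \<Longrightarrow> a + b \<in> A"
  using add_subgroup_diff[of A a "- b"] add_subgroup_uminus[of A b] by simp

lemma add_subgroup_sum:
  "add_subgroup A \<Longrightarrow> (\<And>i. i \<in> I \<Longrightarrow> f i \<in> A) \<Longrightarrow> sum f I \<in> A"
  by (induction I rule: infinite_finite_induct) (auto intro: add_subgroup_add add_subgroup_zero)

text \<open>The multiples of \<open>x\<close> are described by their recursion, so that real
  multiples \<open>of_int k * t\<close> and vectors \<open>rscale (of_int k) a\<close> are both
  covered.\<close>

lemma add_subgroup_int_multiple:
  fixes f :: "int \<Rightarrow> 'a::ab_group_add"
  assumes "add_subgroup A" "x \<in> A" "f 0 = 0" "\<And>k. f (k + 1) = f k + x"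
  shows "f k \<in> A"
proof (induction k rule: int_induct[of _ 0])
  case (step2 i)
  have "f i = f (i - 1) + x" using assms(4)[of "i - 1"] by simp
  hence "f (i - 1) = f i - x" by simp
  thus ?case using step2 assms by (simp add: add_subgroup_diff)
qed (use assms in \<open>auto simp: add_subgroup_zero add_subgroup_add\<close>)

definition rscale :: "real \<Rightarrow> (nat \<Rightarrow> complex) \<Rightarrow> (nat \<Rightarrow> complex)" where
  "rscale c a = (\<lambda>j. of_real c * a j)"

lemma rscale_space [simp]: "a \<in> osc_space q \<Longrightarrow> rscale c a \<in> osc_space q"
  by (simp add: osc_space_def rscale_def)

lemma rscale_apply [simp]: "rscale c a j = of_real c * a j"
  and cpos_rscale [simp]: "cpos (rscale c a) = c * cpos a"
  and cneg_rscale [simp]: "cneg (rscale c a) = c * cneg a"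
  and rscale_rscale [simp]: "rscale c (rscale d a) = rscale (c * d) a"
  and rscale_one [simp]: "rscale 1 a = a"
  and rscale_zero [simp]: "rscale 0 a = 0"
  and rscale_add_left: "rscale (c + d) a = rscale c a + rscale d a"
  and rscale_diff_left: "rscale (c - d) a = rscale c a - rscale d a"
  by (auto simp: rscale_def cpos_def cneg_def algebra_simps)

lemma anorm_rscale [simp]: "anorm q (rscale c a) = \<bar>c\<bar> * anorm q a"
  by (simp add: anorm_def norm_mult sum_distrib_left)

lemma flow_rscale [simp]: "flow \<mu> t (rscale c a) = rscale c (flow \<mu> t a)"
  by (rule eq_if_coords) simp_all

lemma osc_form_rscale_right: "osc_form q \<mu> b (rscale c a) = c * osc_form q \<mu> b a"
  by (simp add: osc_form_def algebra_simps sum_distrib_left diff_divide_distrib)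

lemma osc_form_rscale_left: "osc_form q \<mu> (rscale c a) b = c * osc_form q \<mu> a b"
  using osc_form_rscale_right[of q \<mu> b c a] osc_form_anti[of q \<mu> "rscale c a" b] osc_form_anti[of q \<mu> a b]
  by simp

lemma add_subgroup_rscale_int:
  "add_subgroup A \<Longrightarrow> a \<in> A \<Longrightarrow> rscale (of_int k) a \<in> A"
  by (rule add_subgroup_int_multiple[of A a "\<lambda>k. rscale (of_int k) a"])
    (simp_all add: rscale_add_left)

text \<open>For a subgroup this is discreteness.\<close>

definition separated :: "nat \<Rightarrow> (nat \<Rightarrow> complex) set \<Rightarrow> bool" where
  "separated q A \<longleftrightarrow> (\<exists>\<delta>>0. \<forall>a\<in>A. anorm q a < \<delta> \<longrightarrow> a = 0)"

text \<open>For a subgroup of \<open>osc_space q\<close> this amounts to cocompactness of its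
  closure, with \<open>M\<close> as a covering radius.\<close>

definition relatively_dense :: "nat \<Rightarrow> (nat \<Rightarrow> complex) set \<Rightarrow> bool" where
  "relatively_dense q A \<longleftrightarrow> (\<exists>M. \<forall>a\<in>osc_space q. \<exists>b\<in>A. anorm q (a - b) \<le> M)"

lemma cnj_mult_sgn: "cnj z * sgn z = complex_of_real (cmod z)"
  by (cases "z = 0") (simp_all add: sgn_div_norm scaleR_conv_of_real complex_norm_square[symmetric]
      power2_eq_square field_simps)

text \<open>A short $a \neq 0$ pairs non-trivially, but with small value, with a vector of $A$ close to a fixed
  large multiple of the normalised dual of $a$.\<close>

lemma separated_if_form_discrete:
  assumes \<mu>: "\<forall>j\<in>{1..q}. \<mu> j \<noteq> 0"
    and dense: "relatively_dense q A"
    and c: "c > 0" "\<And>a b. a \<in> A \<Longrightarrow> b \<in> A \<Longrightarrow> osc_form q \<mu> a b \<noteq> 0 \<Longrightarrow> c \<le> \<bar>osc_form q \<mu> a b\<bar>"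
    and sub: "A \<subseteq> osc_space q"
  shows "separated q A"
proof -
  obtain C where C: "C > 0" "\<And>a b. \<bar>osc_form q \<mu> a b\<bar> \<le> C * anorm q a * anorm q b"
    using osc_form_bound by blast
  obtain M where M: "\<And>a. a \<in> osc_space q \<Longrightarrow> \<exists>b\<in>A. anorm q (a - b) \<le> M"
    using dense by (auto simp: relatively_dense_def)
  have M0: "M \<ge> 0" using M[of 0] anorm_ge0 order.trans by (metis osc_space_zero)
  \<comment> \<open>The 1 is the weight of coordinate 0, where the form has no factor
    \<open>\<mu>\<close>.\<close>
  define m where "m = Min (insert 1 ((\<lambda>j. \<bar>\<mu> j\<bar>) ` {1..q}))"
  have m: "m > 0" "m \<le> 1" "\<And>j. j \<in> {1..q} \<Longrightarrow> m \<le> \<bar>\<mu> j\<bar>"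
  proof -
    have "m \<in> insert 1 ((\<lambda>j. \<bar>\<mu> j\<bar>) ` {1..q})" unfolding m_def by (intro Min_in) auto
    thus "m > 0" using \<mu> by auto
    show "m \<le> 1" "\<And>j. j \<in> {1..q} \<Longrightarrow> m \<le> \<bar>\<mu> j\<bar>" unfolding m_def by (intro Min_le; simp)+
  qed
  \<comment> \<open>With this \<open>T\<close> the pairing of \<open>a\<close> with \<open>b\<close>
    is at least \<open>(C * M + 1) * anorm q a\<close>, while moving \<open>b\<close> to a vector of
    \<open>A\<close> within distance \<open>M\<close> costs at most
    \<open>C * M * anorm q a\<close>.\<close>
  define T where "T = (C * M + 1) / m"
  have T: "T > 0" "m * T = C * M + 1" using m(1) C(1) M0 by (auto simp: T_def add_nonneg_pos)
  \<comment> \<open>The vector of \<open>A\<close> near \<open>b\<close> has norm at most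
    \<open>real (Suc q) * T + M\<close>, so its pairing with a shorter \<open>a\<close> would be
    smaller than \<open>c\<close>.\<close>
  define \<delta> where "\<delta> = c / (C * (real (Suc q) * T + M))"
  have pos: "C * (real (Suc q) * T + M) > 0" using C(1) T(1) M0 by (intro mult_pos_pos add_pos_nonneg) auto
  have "a = 0" if a: "a \<in> A" and small: "anorm q a < \<delta>" for a
  proof (rule ccontr)
    assume "a \<noteq> 0"
    hence N: "anorm q a > 0" using anorm_eq_0[of a q] a sub anorm_ge0[of q a] by (auto simp: less_le)
    define b where "b = (\<lambda>j. if j = 0 then - \<i> * of_real T * sgn (a 0)
      else if j \<le> q then \<i> * of_real (T * sgn (\<mu> j)) * sgn (a j) else 0)"
    have bs: "b \<in> osc_space q" by (auto simp: b_def osc_space_def)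
    have "anorm q b \<le> real (Suc q) * T"
      using T(1) by (intro anorm_leI) (auto simp: b_def norm_mult norm_sgn sgn_real_def)
    have 0: "(cpos a * cneg b - cneg a * cpos b) / 2 = T * cmod (a 0)"
    proof -
      have gen: "(cpos a * (Re (- \<i> * of_real T * w) - Im (- \<i> * of_real T * w))
          - cneg a * (Re (- \<i> * of_real T * w) + Im (- \<i> * of_real T * w))) / 2 = T * Re (cnj (a 0) * w)" for w
        by (simp add: cpos_def cneg_def field_simps)
      have "(cpos a * cneg b - cneg a * cpos b) / 2 = T * Re (cnj (a 0) * sgn (a 0))"
        using gen[of "sgn (a 0)"] by (simp only: cpos_def cneg_def b_def if_True simp_thms)
      thus ?thesis by (simp add: cnj_mult_sgn)
    qed
    have j: "\<mu> j * Im (cnj (a j) * b j) = T * (\<bar>\<mu> j\<bar> * cmod (a j))" if "j \<in> {1..q}" for j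
    proof -
      have "cnj (a j) * b j = \<i> * of_real (T * sgn (\<mu> j)) * (cnj (a j) * sgn (a j))"
        using that by (simp add: b_def)
      also have "\<dots> = \<i> * of_real (T * sgn (\<mu> j) * cmod (a j))" by (simp add: cnj_mult_sgn)
      finally have "Im (cnj (a j) * b j) = T * sgn (\<mu> j) * cmod (a j)" by simp
      moreover have "\<mu> j * sgn (\<mu> j) = \<bar>\<mu> j\<bar>" by (simp add: abs_sgn)
      ultimately show ?thesis by (metis mult.assoc mult.commute)
    qed
    have ge: "m * cmod (a j) \<le> (if j = 0 then cmod (a 0) else \<bar>\<mu> j\<bar> * cmod (a j))" if "j \<le> q" for j
      using that m(2) m(3)[of j] by (auto intro!: mult_right_mono mult_left_le_one_le simp: m(1) less_imp_le)
    let ?S = "cmod (a 0) + (\<Sum>j\<in>{1..q}. \<bar>\<mu> j\<bar> * cmod (a j))"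
    have "m * anorm q a \<le> (\<Sum>j\<le>q. if j = 0 then cmod (a 0) else \<bar>\<mu> j\<bar> * cmod (a j))"
      unfolding anorm_def sum_distrib_left by (rule sum_mono) (use ge in auto)
    also have "\<dots> = ?S" by (simp add: atMost_atLeast0 sum.atLeast_Suc_atMost)
    finally have "T * (m * anorm q a) \<le> T * ?S" using T(1) by (intro mult_left_mono) auto
    also have "T * ?S = osc_form q \<mu> a b"
      unfolding osc_form_def 0 using j by (simp add: sum_distrib_left distrib_left)
    also have "T * (m * anorm q a) = (C * M + 1) * anorm q a"
      using T(2) by (simp add: mult.commute flip: mult.assoc)
    finally have fb: "osc_form q \<mu> a b \<ge> (C * M + 1) * anorm q a" .
    obtain b' where b': "b' \<in> A" "anorm q (b - b') \<le> M" using M[OF bs] by blast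
    have "\<bar>osc_form q \<mu> a (b - b')\<bar> \<le> C * anorm q a * M"
      using C(2)[of a "b - b'"] b'(2) C(1) N by (meson mult_left_mono mult_nonneg_nonneg less_imp_le order.trans)
    hence "osc_form q \<mu> a b' \<ge> anorm q a" using fb by (simp add: osc_form_bilin algebra_simps)
    hence "c \<le> \<bar>osc_form q \<mu> a b'\<bar>" using c(2)[OF a b'(1)] N by auto
    also have "\<dots> \<le> C * anorm q a * anorm q b'" by (rule C)
    also have "anorm q b' \<le> real (Suc q) * T + M"
      using anorm_triangle_diff[of q b "b - b'"] b'(2) \<open>anorm q b \<le> real (Suc q) * T\<close> by simp
    finally have "c \<le> anorm q a * (C * (real (Suc q) * T + M))" using C(1) N by (simp add: mult_ac)
    hence "\<delta> \<le> anorm q a" unfolding \<delta>_def using pos by (simp add: divide_le_eq)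
    with small show False by simp
  qed
  moreover have "\<delta> > 0" unfolding \<delta>_def using pos c(1) by simp
  ultimately show ?thesis unfolding separated_def by blast
qed

text \<open>A bounded set meets finitely many cells of a fine grid, and no cell contains two
  elements of a separated subgroup.\<close>

lemma finite_bounded_separated:
  assumes sub: "A \<subseteq> osc_space q" and grp: "add_subgroup A" and sep: "separated q A"
  shows "finite {a \<in> A. anorm q a \<le> R}"
proof -
  obtain \<delta> where d: "\<delta> > 0" "\<And>a. a \<in> A \<Longrightarrow> anorm q a < \<delta> \<Longrightarrow> a = 0"
    using sep by (auto simp: separated_def)
  \<comment> \<open>Two vectors in one cell of side \<eta> differ by at most
    \<open>2 * \<eta>\<close> in each of the \<open>Suc q\<close> coordinates, in total by
    \<delta>/2.\<close>
  define \<eta> where "\<eta> = \<delta> / (4 * real (Suc q))"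
  have eta: "\<eta> > 0" using d(1) by (simp add: \<eta>_def)
  define g where "g a = (\<lambda>j\<in>{..q}. (\<lfloor>Re (a j) / \<eta>\<rfloor>, \<lfloor>Im (a j) / \<eta>\<rfloor>))" for a :: "nat \<Rightarrow> complex"
  define I where "I = {\<lfloor>- R / \<eta>\<rfloor>..\<lfloor>R / \<eta>\<rfloor>}"
  have fl: "\<bar>x - y\<bar> < \<eta>" if "\<lfloor>x / \<eta>\<rfloor> = \<lfloor>y / \<eta>\<rfloor>" for x y
  proof -
    have "\<bar>x / \<eta> - y / \<eta>\<bar> < 1" using that by linarith
    hence "\<bar>x - y\<bar> / \<eta> < 1" using eta by (simp add: diff_divide_distrib[symmetric])
    thus ?thesis using eta by simp
  qed
  show ?thesis
  proof (rule finite_imageD)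
    have I: "\<lfloor>x / \<eta>\<rfloor> \<in> I" if "- R \<le> x" "x \<le> R" for x
      unfolding I_def atLeastAtMost_iff using that eta by (intro conjI floor_mono divide_right_mono) auto
    have "\<lfloor>Re (a j) / \<eta>\<rfloor> \<in> I" "\<lfloor>Im (a j) / \<eta>\<rfloor> \<in> I" if "anorm q a \<le> R" "j \<le> q" for a j
      using abs_Re_le_cmod[of "a j"] abs_Im_le_cmod[of "a j"] cmod_le_anorm[of j q a] that
      by (intro I; linarith)+
    hence "g ` {a \<in> A. anorm q a \<le> R} \<subseteq> (\<Pi>\<^sub>E j\<in>{..q}. I \<times> I)"
      unfolding g_def by (intro image_subsetI) (simp add: restrict_PiE_iff)
    thus "finite (g ` {a \<in> A. anorm q a \<le> R})"
      by (rule finite_subset) (auto intro!: finite_PiE simp: I_def)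
    show "inj_on g {a \<in> A. anorm q a \<le> R}"
    proof (rule inj_onI, clarify)
      fix a b assume a: "a \<in> A" and b: "b \<in> A" and e: "g a = g b"
      have "cmod ((a - b) j) \<le> 2 * \<eta>" if "j \<le> q" for j
      proof -
        have "g a j = g b j" using e by simp
        hence "\<bar>Re (a j) - Re (b j)\<bar> < \<eta>" "\<bar>Im (a j) - Im (b j)\<bar> < \<eta>" 
          using that by (auto simp: g_def intro!: fl)
        thus ?thesis using cmod_le[of "a j - b j"] by simp
      qed
      hence "anorm q (a - b) \<le> real (Suc q) * (2 * \<eta>)" by (intro anorm_leI)
      also have "\<dots> < \<delta>" using d(1) by (simp add: \<eta>_def divide_simps)
      finally have "a - b = 0" using d(2) add_subgroup_diff[OF grp a b] by blast
      thus "a = b" by simp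
    qed
  qed
qed

section \<open>Projections of a lattice\<close>

lemma tendsto_funI:
  fixes f :: "'a \<Rightarrow> 'b \<Rightarrow> 'c::topological_space"
  assumes "\<And>i. ((\<lambda>x. f x i) \<longlongrightarrow> l i) F"
  shows "(f \<longlongrightarrow> l) F"
  using assms unfolding limitin_canonical_iff[symmetric] euclidean_product_topology[symmetric]
    limitin_componentwise by auto

locale osc_lattice_subgroup =
  fixes q :: nat and \<mu> :: "nat \<Rightarrow> real" and \<Gamma> :: "(real \<times> (nat \<Rightarrow> complex) \<times> real) set"
  assumes lattice: "osc_lattice q \<mu> \<Gamma>" and \<mu>_nonzero: "\<forall>j\<in>{1..q}. \<mu> j \<noteq> 0"
begin

lemmas lattice_unfolded = lattice[unfolded osc_lattice_def]

lemmas carrier = lattice_unfolded[THEN conjunct1]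
  and one_mem = lattice_unfolded[THEN conjunct2, THEN conjunct1, unfolded osc_one_eq]
  and osc_mult_mem = lattice_unfolded[THEN conjunct2, THEN conjunct2, THEN conjunct1]
  and osc_inverse_mem = lattice_unfolded[THEN conjunct2, THEN conjunct2, THEN conjunct2, THEN conjunct1]
  and discrete = lattice_unfolded[THEN conjunct2, THEN conjunct2, THEN conjunct2, THEN conjunct2, THEN conjunct1]
  and cocompact = lattice_unfolded[THEN conjunct2, THEN conjunct2, THEN conjunct2, THEN conjunct2, THEN conjunct2]

lemma mem_space: "(z, a, t) \<in> \<Gamma> \<Longrightarrow> a \<in> osc_space q"
  using carrier osc_carrier_iff[of z a t q] by auto

lemma mult_mem:
  assumes "(z, a, t) \<in> \<Gamma>" "(z', a', t') \<in> \<Gamma>"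
  shows "(z + z' + osc_form q \<mu> a (flow \<mu> t a') / 2, a + flow \<mu> t a', t + t') \<in> \<Gamma>"
proof -
  have "osc_mult q \<mu> (z, a, t) (z', a', t') \<in> \<Gamma>"
    using osc_mult_mem assms by blast
  thus ?thesis using osc_mult_eq[OF mem_space[OF assms(2)]] by simp
qed

lemma inv_mem:
  assumes "(z, a, t) \<in> \<Gamma>"
  shows "(- z, - flow \<mu> (- t) a, - t) \<in> \<Gamma>"
proof -
  obtain z' a' t' where y: "(z', a', t') \<in> \<Gamma>" "osc_mult q \<mu> (z, a, t) (z', a', t') = osc_one"
    using bspec[OF osc_inverse_mem assms] by (metis prod_cases3)
  have eq: "z + z' + osc_form q \<mu> a (flow \<mu> t a') / 2 = 0" "a + flow \<mu> t a' = 0" "t + t' = 0"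
    using y(2) osc_mult_eq[OF mem_space[OF y(1)]] by (auto simp: osc_one_eq)
  have fa: "flow \<mu> t a' = - a" using eq(2) by (simp add: eq_neg_iff_add_eq_0 add.commute)
  hence "flow \<mu> (- t) (flow \<mu> t a') = - flow \<mu> (- t) a" by simp
  hence "a' = - flow \<mu> (- t) a" by (simp add: flow_flow)
  moreover have "z' = - z" using eq(1) by (simp add: fa osc_form_bilin)
  moreover have "t' = - t" using eq(3) by simp
  ultimately show ?thesis using y(1) by simp
qed

text \<open>Conjugation by an element over \<open>t\<close> acts on \<Lambda> through
  \<open>flow \<mu> t\<close>; the component \<open>b\<close> shows up in the centre only.\<close>

lemma conj_mem:
  assumes "(w, b, t) \<in> \<Gamma>" "(z, a, 0) \<in> \<Gamma>"
  shows "(z + osc_form q \<mu> b (flow \<mu> t a), flow \<mu> t a, 0) \<in> \<Gamma>"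
proof -
  have "osc_form q \<mu> (flow \<mu> t a) b = - osc_form q \<mu> b (flow \<mu> t a)" by (rule osc_form_anti)
  thus ?thesis using mult_mem[OF mult_mem[OF assms] inv_mem[OF assms(1)]]
    by (simp add: flow_flow osc_form_bilin add.commute[of z])
qed

lemma quot_mem:
  assumes "(z, a, 0) \<in> \<Gamma>" "(z', a', 0) \<in> \<Gamma>"
  shows "(z - z' - osc_form q \<mu> a a' / 2, a - a', 0) \<in> \<Gamma>"
  using mult_mem[OF assms(1) inv_mem[OF assms(2)]] by (simp add: osc_form_bilin)

text \<open>The group \<Lambda> of the overview; \<open>periods\<close> is its
  \<open>D\<close>.\<close>

definition nilproj :: "(nat \<Rightarrow> complex) set" where
  "nilproj = {a. \<exists>z. (z, a, 0) \<in> \<Gamma>}"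

definition periods :: "real set" where
  "periods = {t. \<exists>z a. (z, a, t) \<in> \<Gamma>}"

lemma nilproj_space: "nilproj \<subseteq> osc_space q"
  using mem_space by (auto simp: nilproj_def)

lemma nilproj_subgroup: "add_subgroup nilproj"
  unfolding add_subgroup_def nilproj_def using one_mem quot_mem by blast

lemma periods_subgroup: "add_subgroup periods"
proof -
  have "s - t \<in> periods" if st: "s \<in> periods" "t \<in> periods" for s t
  proof -
    obtain z a z' a' where "(z, a, s) \<in> \<Gamma>" "(z', a', t) \<in> \<Gamma>" using st by (auto simp: periods_def)
    from mult_mem[OF this(1) inv_mem[OF this(2)]] show ?thesis unfolding periods_def by auto
  qed
  thus ?thesis using one_mem by (auto simp: add_subgroup_def periods_def)
qed

lemma nilproj_flow: "t \<in> periods \<Longrightarrow> a \<in> nilproj \<Longrightarrow> flow \<mu> t a \<in> nilproj"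
  unfolding nilproj_def periods_def using conj_mem by blast

text \<open>The commutator of lifts of \<open>a\<close> and \<open>b\<close>: conjugate the second
  by the first and divide by the second. The unknown central parts cancel.\<close>

lemma form_mem:
  assumes "a \<in> nilproj" "b \<in> nilproj"
  shows "(osc_form q \<mu> a b, 0, 0) \<in> \<Gamma>"
proof -
  obtain z z' where zz: "(z, a, 0) \<in> \<Gamma>" "(z', b, 0) \<in> \<Gamma>" using assms by (auto simp: nilproj_def)
  from quot_mem[OF conj_mem[OF zz] zz(2)] show ?thesis by simp
qed

text \<open>Elements of \<Gamma> whose three sizes tend to 0 converge to the identity in the product
  topology, because their functions vanish beyond \<open>q\<close>. They would eventually lie in the
  isolating neighbourhood \<open>U\<close>.\<close>

lemma near_one:
  "\<exists>\<epsilon>>0. \<forall>z a t. (z, a, t) \<in> \<Gamma> \<longrightarrow> \<bar>z\<bar> < \<epsilon> \<longrightarrow> anorm q a < \<epsilon> \<longrightarrow> \<bar>t\<bar> < \<epsilon> \<longrightarrow> z = 0 \<and> a = 0 \<and> t = 0"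
proof -
  obtain U where U: "open U" "U \<inter> \<Gamma> = {osc_one}"
    using bspec[OF discrete one_mem] by (auto simp: osc_one_eq)
  show ?thesis
  proof (rule ccontr)
    assume "\<not> ?thesis"
    hence H: "\<exists>z a t. (z, a, t) \<in> \<Gamma> \<and> \<bar>z\<bar> < \<epsilon> \<and> anorm q a < \<epsilon> \<and> \<bar>t\<bar> < \<epsilon> \<and> (z, a, t) \<noteq> osc_one"
      if "\<epsilon> > 0" for \<epsilon> using that unfolding osc_one_eq prod.inject by blast
    have "\<forall>n. \<exists>z a t. (z, a, t) \<in> \<Gamma> \<and> \<bar>z\<bar> < inverse (real (Suc n)) \<and> anorm q a < inverse (real (Suc n))
      \<and> \<bar>t\<bar> < inverse (real (Suc n)) \<and> (z, a, t) \<noteq> osc_one"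
      by (intro allI H) simp
    then obtain z a t where X: "\<And>n. (z n, a n, t n) \<in> \<Gamma>" "\<And>n. \<bar>z n\<bar> < inverse (real (Suc n))"
        "\<And>n. anorm q (a n) < inverse (real (Suc n))" "\<And>n. \<bar>t n\<bar> < inverse (real (Suc n))"
        "\<And>n. (z n, a n, t n) \<noteq> osc_one" by metis
    have l: "f \<longlonglongrightarrow> 0" if "\<And>n. norm (f n) \<le> inverse (real (Suc n))" for f :: "nat \<Rightarrow> 'x::real_normed_vector"
      by (rule Lim_null_comparison[OF _ LIMSEQ_inverse_real_of_nat]) (use that in auto)
    have "a \<longlonglongrightarrow> 0"
    proof (rule tendsto_funI)
      fix j
      show "(\<lambda>n. a n j) \<longlonglongrightarrow> 0 j"
      proof (cases "j \<le> q")
        case True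
        have "norm (a n j) \<le> inverse (real (Suc n))" for n
          using cmod_le_anorm[OF True, of "a n"] X(3)[of n] by linarith
        thus ?thesis using l[of "\<lambda>n. a n j"] by simp
      next
        case False
        hence "a n j = 0" for n using mem_space[OF X(1)] by (auto simp: osc_space_def)
        thus ?thesis by simp
      qed
    qed
    moreover have "z \<longlonglongrightarrow> 0" "t \<longlonglongrightarrow> 0" using X(2,4) by (auto intro!: l less_imp_le)
    ultimately have "(\<lambda>n. (z n, a n, t n)) \<longlonglongrightarrow> osc_one"
      unfolding osc_one_eq by (intro tendsto_Pair)
    hence "\<forall>\<^sub>F n in sequentially. (z n, a n, t n) \<in> U"
      using U by (intro topological_tendstoD) auto
    then obtain n where "(z n, a n, t n) \<in> U" by (auto simp: eventually_sequentially)
    thus False using X(1,5)[of n] U(2) by blast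
  qed
qed

text \<open>Of the compact set only bounds on its vector and time components are kept; the central
  coordinate is dropped.\<close>

lemma cocompact_bound:
  "\<exists>M>0. \<forall>a\<in>osc_space q. \<forall>t. \<exists>b s z c r. (z, c, r) \<in> \<Gamma> \<and> anorm q b \<le> M \<and> \<bar>s\<bar> \<le> M
      \<and> a = b + flow \<mu> s c \<and> t = s + r"
proof -
  obtain K where K: "compact K" "K \<subseteq> osc_carrier q"
    "osc_carrier q \<subseteq> {osc_mult q \<mu> k \<gamma> | k \<gamma>. k \<in> K \<and> \<gamma> \<in> \<Gamma>}"
    using cocompact by blast
  have co: "continuous_on K (\<lambda>x. fst (snd x) j)" for j
    by (rule continuous_on_compose2[OF continuous_on_product_coordinates[of j], of K "\<lambda>x. fst (snd x)"])
      (auto intro!: continuous_on_fst continuous_on_snd continuous_on_id)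
  have "continuous_on K (\<lambda>x. anorm q (fst (snd x)) + \<bar>snd (snd x)\<bar>)"
    unfolding anorm_def by (intro continuous_intros co)
  hence "bounded ((\<lambda>x. anorm q (fst (snd x)) + \<bar>snd (snd x)\<bar>) ` K)"
    using K(1) by (intro compact_imp_bounded compact_continuous_image)
  then obtain M where M: "M > 0" "\<And>x. x \<in> K \<Longrightarrow> \<bar>anorm q (fst (snd x)) + \<bar>snd (snd x)\<bar>\<bar> \<le> M"
    by (auto simp: bounded_pos)
  show ?thesis
  proof (intro exI[of _ M] conjI ballI allI M(1))
    fix a t assume a: "a \<in> osc_space q"
    hence "(0, a, t) \<in> osc_carrier q" by (simp add: osc_carrier_iff)
    then obtain k \<gamma> where kg: "(0, a, t) = osc_mult q \<mu> k \<gamma>" "k \<in> K" "\<gamma> \<in> \<Gamma>" using K(3) by blast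
    obtain y b s where k: "k = (y, b, s)" by (cases k)
    obtain z c r where g: "\<gamma> = (z, c, r)" by (cases \<gamma>)
    have "a = b + flow \<mu> s c" "t = s + r"
      using kg(1) mem_space kg(3) unfolding k g by (auto simp: osc_mult_eq)
    moreover have "anorm q b \<le> M" "\<bar>s\<bar> \<le> M" 
    proof -
      have "anorm q b + \<bar>s\<bar> \<le> M" using M(2)[OF kg(2)] by (simp add: k)
      thus "anorm q b \<le> M" "\<bar>s\<bar> \<le> M" using anorm_ge0[of q b] abs_ge_zero[of s] by linarith+
    qed
    ultimately show "\<exists>b s z c r. (z, c, r) \<in> \<Gamma> \<and> anorm q b \<le> M \<and> \<bar>s\<bar> \<le> M
      \<and> a = b + flow \<mu> s c \<and> t = s + r" using kg(3) g by blast
  qed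
qed

text \<open>The lifts of the shrinking vectors \<open>rscale (c ^ n) a\<close> have unknown central
  parts. Dividing the conjugate of such a lift by the lift itself cancels them and leaves elements
  of \<Gamma> that tend to the identity, hence become trivial; but their vector component is a
  nonzero multiple of \<open>a\<close>.\<close>

lemma contracted_eq_0:
  assumes a: "a \<in> nilproj" and t: "t \<in> periods" and c: "0 < c" "c < 1" "flow \<mu> t a = rscale c a"
  shows "a = 0"
proof -
  obtain \<epsilon> where \<epsilon>: "\<epsilon> > 0"
    "\<forall>z a t. (z, a, t) \<in> \<Gamma> \<longrightarrow> \<bar>z\<bar> < \<epsilon> \<longrightarrow> anorm q a < \<epsilon> \<longrightarrow> \<bar>t\<bar> < \<epsilon> \<longrightarrow> z = 0 \<and> a = 0 \<and> t = 0"
    using near_one by blast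
  obtain w b where g: "(w, b, t) \<in> \<Gamma>" using t by (auto simp: periods_def)
  have ex: "\<exists>z. (z, rscale (c ^ n) a, 0) \<in> \<Gamma>" for n
  proof (induction n)
    case 0
    show ?case using a by (simp add: nilproj_def)
  next
    case (Suc n)
    then obtain z where "(z, rscale (c ^ n) a, 0) \<in> \<Gamma>" by blast
    from conj_mem[OF g this] have "(z + osc_form q \<mu> b (rscale (c * c ^ n) a), rscale (c * c ^ n) a, 0) \<in> \<Gamma>"
      by (simp add: c(3) mult.commute)
    thus ?case unfolding power_Suc by blast
  qed
  have mem: "(c ^ Suc n * osc_form q \<mu> b a, rscale (c ^ Suc n - c ^ n) a, 0) \<in> \<Gamma>" for n
  proof -
    obtain z where z: "(z, rscale (c ^ n) a, 0) \<in> \<Gamma>" using ex by blast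
    from quot_mem[OF conj_mem[OF g z] z]
    show ?thesis
      by (simp add: c(3) osc_form_rscale_left osc_form_rscale_right rscale_diff_left mult.commute)
  qed
  have pw: "(\<lambda>n. c ^ n) \<longlonglongrightarrow> 0" using c by (intro LIMSEQ_realpow_zero) auto
  have l: "(\<lambda>n. \<bar>c ^ Suc n * osc_form q \<mu> b a\<bar>) \<longlonglongrightarrow> \<bar>0 * osc_form q \<mu> b a\<bar>"
    "(\<lambda>n. \<bar>c ^ Suc n - c ^ n\<bar> * anorm q a) \<longlonglongrightarrow> \<bar>0 - 0\<bar> * anorm q a"
    by (intro tendsto_rabs tendsto_mult tendsto_diff LIMSEQ_Suc[OF pw] pw tendsto_const)+
  have "\<forall>\<^sub>F n in sequentially. \<bar>c ^ Suc n * osc_form q \<mu> b a\<bar> < \<epsilon> \<and> \<bar>c ^ Suc n - c ^ n\<bar> * anorm q a < \<epsilon>"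
    using order_tendstoD(2)[OF l(1), of \<epsilon>] order_tendstoD(2)[OF l(2), of \<epsilon>] \<epsilon>(1) by (auto intro: eventually_conj)
  then obtain n where "\<bar>c ^ Suc n * osc_form q \<mu> b a\<bar> < \<epsilon>" "\<bar>c ^ Suc n - c ^ n\<bar> * anorm q a < \<epsilon>"
    by (auto simp: eventually_sequentially)
  with \<epsilon>(2)[rule_format, OF mem[of n]] \<epsilon>(1) have "rscale (c ^ Suc n - c ^ n) a = 0" by simp
  hence "\<bar>c ^ Suc n - c ^ n\<bar> * anorm q a = 0" by (metis anorm_rscale anorm_zero)
  moreover have "c ^ Suc n - c ^ n \<noteq> 0" using c by simp
  ultimately show ?thesis using anorm_eq_0[of a q] a nilproj_space by auto
qed

end

section \<open>Discreteness of the periods\<close>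

lemma continuous_flow_diff: "isCont (\<lambda>t. anorm q (flow \<mu> t a - a)) 0"
proof -
  have "isCont (\<lambda>t. flow \<mu> t a j) 0" for j
    unfolding flow_def Complex_eq cis_conv_exp by (cases "j = 0") (auto intro!: continuous_intros)
  thus ?thesis unfolding anorm_def by (auto intro!: continuous_intros)
qed

context osc_lattice_subgroup
begin

lemma periods_approx:
  assumes dense: "\<And>\<delta>. \<delta> > 0 \<Longrightarrow> \<exists>t\<in>periods. 0 < t \<and> t < \<delta>" and "\<delta> > 0"
  shows "\<exists>t\<in>periods. \<bar>t - s\<bar> < \<delta>"
proof -
  obtain t where t: "t \<in> periods" "0 < t" "t < \<delta>" using dense[OF \<open>\<delta> > 0\<close>] by blast
  define k where "k = \<lfloor>s / t\<rfloor>"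
  have "of_int k * t \<in> periods"
    by (rule add_subgroup_int_multiple[OF periods_subgroup t(1), of "\<lambda>k. of_int k * t"])
      (simp_all add: algebra_simps)
  moreover have "of_int k \<le> s / t" "s / t < of_int k + 1" unfolding k_def by linarith+
  hence "of_int k * t \<le> s" "s < (of_int k + 1) * t"
    using t(2) by (simp_all add: le_divide_eq divide_less_eq)
  hence "\<bar>of_int k * t - s\<bar> < \<delta>" using t(3) by (simp add: distrib_right)
  ultimately show ?thesis by blast
qed

lemma osc_form_flow_self:
  "osc_form q \<mu> a (flow \<mu> t a) = - (cpos a * cneg a) * ((exp t - exp (- t)) / 2)
     + (\<Sum>j\<in>{1..q}. \<mu> j * (cmod (a j))\<^sup>2 * sin (\<mu> j * t))"
proof -
  have "\<mu> j * Im (cnj (a j) * flow \<mu> t a j) = \<mu> j * (cmod (a j))\<^sup>2 * sin (\<mu> j * t)" if "j \<in> {1..q}" for j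
  proof -
    have "cnj (a j) * flow \<mu> t a j = of_real ((cmod (a j))\<^sup>2) * cis (\<mu> j * t)"
      using that by (simp add: complex_norm_square mult_ac del: of_real_power)
    thus ?thesis by simp
  qed
  thus ?thesis by (simp add: osc_form_def field_simps)
qed

text \<open>If $\omega(a, e^{tL}a)$ vanishes for small $t$, differentiating it at $0$ and $1/2$
  separates the definite elliptic part from the hyperbolic part.\<close>

lemma form_flow_self_eq_0D:
  assumes zero: "\<And>t. \<bar>t\<bar> < 1 \<Longrightarrow> osc_form q \<mu> a (flow \<mu> t a) = 0"
  shows "cpos a * cneg a = 0" and "\<And>j. j \<in> {1..q} \<Longrightarrow> a j = 0"
proof -
  define P where "P = cpos a * cneg a"
  define Q where "Q = (\<Sum>j\<in>{1..q}. (\<mu> j)\<^sup>2 * (cmod (a j))\<^sup>2)"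
  define F where "F t = - P * ((exp t - exp (- t)) / 2) + (\<Sum>j\<in>{1..q}. \<mu> j * (cmod (a j))\<^sup>2 * sin (\<mu> j * t))" for t
  have F0: "F t = 0" if "\<bar>t\<bar> < 1" for t
    using zero[OF that] by (simp add: F_def P_def osc_form_flow_self)
  have D: "- P * ((exp t + exp (- t)) / 2) + (\<Sum>j\<in>{1..q}. (\<mu> j)\<^sup>2 * (cmod (a j))\<^sup>2 * cos (\<mu> j * t)) = 0"
    if t: "\<bar>t\<bar> < 1" for t
  proof (rule DERIV_local_const)
    show "(F has_real_derivative - P * ((exp t + exp (- t)) / 2) + (\<Sum>j\<in>{1..q}. (\<mu> j)\<^sup>2 * (cmod (a j))\<^sup>2 * cos (\<mu> j * t))) (at t)"
      unfolding F_def
      by (auto intro!: derivative_eq_intros simp: power2_eq_square mult_ac)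
    show "0 < 1 - \<bar>t\<bar>" using t by simp
    show "\<forall>y. \<bar>t - y\<bar> < 1 - \<bar>t\<bar> \<longrightarrow> F t = F y" using F0 t by auto
  qed
  \<comment> \<open>The derivative at 0 is \<open>Q - P\<close>. At 1/2 the bound
    \<open>cos \<le> 1\<close> turns it into \<open>P * cosh (1/2) \<le> Q = P\<close>, which forces
    \<open>P \<le> 0\<close>, whereas \<open>Q \<ge> 0\<close>.\<close>
  have PQ: "P = Q" using D[of 0] by (simp add: Q_def)
  have "P * ((exp (1/2) + exp (- (1/2))) / 2) = (\<Sum>j\<in>{1..q}. (\<mu> j)\<^sup>2 * (cmod (a j))\<^sup>2 * cos (\<mu> j * (1/2)))"
    using D[of "1/2"] by simp
  also have "\<dots> \<le> Q" unfolding Q_def by (intro sum_mono mult_left_le) auto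
  finally have "P * ((exp (1/2) + exp (- (1/2))) / 2 - 1) \<le> 0" using PQ by (simp add: right_diff_distrib)
  moreover have "(exp (1/2) + exp (- (1/2))) / 2 - (1::real) > 0"
  proof -
    have "(exp (1/4) - exp (- (1/4)))\<^sup>2 > (0::real)" by simp
    also have "(exp (1/4) - exp (- (1/4)))\<^sup>2 = exp (1/2) + exp (- (1/2)) - (2::real)"
      by (simp add: power2_diff flip: exp_double exp_add)
    finally show ?thesis by simp
  qed
  ultimately have "P \<le> 0" by (simp add: mult_le_0_iff)
  moreover have "Q \<ge> 0" unfolding Q_def by (intro sum_nonneg) auto
  ultimately have "P = 0" "Q = 0" using PQ by auto
  thus "cpos a * cneg a = 0" by (simp add: P_def)
  fix j assume j: "j \<in> {1..q}"
  from \<open>Q = 0\<close> have "(\<mu> j)\<^sup>2 * (cmod (a j))\<^sup>2 = 0"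
    unfolding Q_def using j by (subst (asm) sum_nonneg_eq_0_iff) auto
  thus "a j = 0" using j \<mu>_nonzero by auto
qed

lemma continuous_form_flow: "isCont (\<lambda>t. osc_form q \<mu> a (flow \<mu> t a)) s"
  unfolding osc_form_flow_self by (intro continuous_intros) auto

lemma nilproj_separated_if_dense:
  assumes dense: "\<And>\<delta>. \<delta> > 0 \<Longrightarrow> \<exists>t\<in>periods. 0 < t \<and> t < \<delta>"
  shows "separated q nilproj"
proof -
  obtain \<epsilon> where \<epsilon>: "\<epsilon> > 0"
    "\<forall>z a t. (z, a, t) \<in> \<Gamma> \<longrightarrow> \<bar>z\<bar> < \<epsilon> \<longrightarrow> anorm q a < \<epsilon> \<longrightarrow> \<bar>t\<bar> < \<epsilon> \<longrightarrow> z = 0 \<and> a = 0 \<and> t = 0"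
    using near_one by blast
  obtain C where C: "C > 0" "\<And>a b. \<bar>osc_form q \<mu> a b\<bar> \<le> C * anorm q a * anorm q b"
    using osc_form_bound by blast
  \<comment> \<open>For \<open>\<bar>t\<bar> \<le> 1\<close> the flow expands at most by
    \<open>8 * exp 1\<close>, so that the central element
    \<open>osc_form q \<mu> a (flow \<mu> t a)\<close> falls below \<epsilon> and vanishes.\<close>
  define \<delta> where "\<delta> = min 1 (\<epsilon> / (C * (8 * exp 1)))"
  have \<delta>: "\<delta> > 0" using \<epsilon>(1) C(1) by (simp add: \<delta>_def)
  have "a = 0" if a: "a \<in> nilproj" and small: "anorm q a < \<delta>" for a
  proof -
    have T0: "osc_form q \<mu> a (flow \<mu> t a) = 0" if t: "t \<in> periods" "\<bar>t\<bar> \<le> 1" for t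
    proof -
      let ?N = "anorm q a"
      have N: "0 \<le> ?N" "?N \<le> 1" using small by (auto simp: \<delta>_def)
      have "anorm q (flow \<mu> t a) \<le> 8 * exp \<bar>t\<bar> * ?N" by (rule anorm_flow_le)
      also have "\<dots> \<le> 8 * exp 1 * 1" using t(2) N by (intro mult_mono) auto
      finally have f: "anorm q (flow \<mu> t a) \<le> 8 * exp 1" by simp
      have "\<bar>osc_form q \<mu> a (flow \<mu> t a)\<bar> \<le> C * ?N * anorm q (flow \<mu> t a)" by (rule C)
      also have "\<dots> \<le> C * ?N * (8 * exp 1)" using f C(1) N by (intro mult_left_mono) auto
      also have "\<dots> = ?N * (C * (8 * exp 1))" by simp
      also have "\<dots> < \<epsilon>" using small C(1) by (simp add: \<delta>_def less_divide_eq)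
      finally show ?thesis
        using \<epsilon> form_mem[OF a nilproj_flow[OF t(1) a]] by (metis abs_zero anorm_zero)
    qed
    have "osc_form q \<mu> a (flow \<mu> s a) = 0" if s: "\<bar>s\<bar> < 1" for s
    proof (rule ccontr)
      assume "osc_form q \<mu> a (flow \<mu> s a) \<noteq> 0"
      then obtain d where d: "d > 0" "\<And>t. dist s t < d \<Longrightarrow> osc_form q \<mu> a (flow \<mu> t a) \<noteq> 0"
        using continuous_at_avoid[OF continuous_form_flow] by blast
      obtain t where t: "t \<in> periods" "\<bar>t - s\<bar> < d" "\<bar>t - s\<bar> < 1 - \<bar>s\<bar>"
        using periods_approx[OF dense, of "min d (1 - \<bar>s\<bar>)" s] d(1) s by auto
      have "\<bar>t\<bar> \<le> 1" using t(3) by linarith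
      thus False using T0[of t] d(2)[of t] t by (auto simp: dist_real_def abs_minus_commute)
    qed
    note zero = form_flow_self_eq_0D[OF this]
    obtain t where t: "t \<in> periods" "0 < t" using dense[of 1] by auto
    have sp: "a \<in> osc_space q" using a nilproj_space by blast
    show "a = 0"
    proof (cases "cpos a = 0")
      case True
      have "flow \<mu> t a = rscale (exp (- t)) a"
        by (rule osc_space_eqI[of _ q]) (use True sp zero(2) in auto)
      thus ?thesis using t by (intro contracted_eq_0[OF a t(1)]) auto
    next
      case False
      hence n: "cneg a = 0" using zero(1) by auto
      have "flow \<mu> (- t) a = rscale (exp (- t)) a"
        by (rule osc_space_eqI[of _ q]) (use n sp zero(2) in auto)
      thus ?thesis using t add_subgroup_uminus[OF periods_subgroup]
        by (intro contracted_eq_0[OF a, of "- t"]) auto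
    qed
  qed
  thus ?thesis using \<delta> unfolding separated_def by blast
qed

text \<open>For small periods \<open>t\<close> the element \<open>flow \<mu> t a - a\<close> of
  \<Lambda> is short, hence 0, and its first coordinate is
  \<open>(exp t - 1) * cpos a\<close>.\<close>

lemma cpos_nilproj_if_dense:
  assumes dense: "\<And>\<delta>. \<delta> > 0 \<Longrightarrow> \<exists>t\<in>periods. 0 < t \<and> t < \<delta>" and a: "a \<in> nilproj"
  shows "cpos a = 0"
proof -
  obtain \<delta> where \<delta>: "\<delta> > 0" "\<And>a. a \<in> nilproj \<Longrightarrow> anorm q a < \<delta> \<Longrightarrow> a = 0"
    using nilproj_separated_if_dense[OF dense] unfolding separated_def by blast
  have "((\<lambda>t. anorm q (flow \<mu> t a - a)) \<longlongrightarrow> 0) (at 0)"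
    using continuous_flow_diff[of q \<mu> a] by (simp add: isCont_def)
  hence "\<forall>\<^sub>F t in at 0. anorm q (flow \<mu> t a - a) < \<delta>" using \<delta>(1) by (rule order_tendstoD(2))
  then obtain d where d: "d > 0" "\<And>t. t \<noteq> 0 \<Longrightarrow> dist t 0 < d \<Longrightarrow> anorm q (flow \<mu> t a - a) < \<delta>"
    unfolding eventually_at by auto
  obtain t where t: "t \<in> periods" "0 < t" "t < d" using dense[OF d(1)] by auto
  have "flow \<mu> t a - a = 0"
    using t d(2)[of t] by (intro \<delta>(2) add_subgroup_diff[OF nilproj_subgroup] nilproj_flow a) auto
  hence "cpos (flow \<mu> t a - a) = 0" by simp
  hence "(exp t - 1) * cpos a = 0" by (simp add: left_diff_distrib)
  thus ?thesis using t(2) by simp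
qed

lemma periods_gap: "\<exists>\<delta>>0. \<forall>t\<in>periods. 0 < t \<longrightarrow> \<delta> \<le> t"
proof (rule ccontr)
  assume "\<not> ?thesis"
  hence dense: "\<exists>t\<in>periods. 0 < t \<and> t < \<delta>" if "\<delta> > 0" for \<delta> using that by (metis not_le)
  obtain t0 where "t0 \<in> periods" and t0: "0 < t0" using dense[of 1] by auto
  then obtain z0 b where g0: "(z0, b, t0) \<in> \<Gamma>" by (auto simp: periods_def)
  have bound: "cpos a = (exp s - 1) * (cpos b / (exp t0 - 1))" if g: "(z, a, s) \<in> \<Gamma>" for z a s
  proof -
    \<comment> \<open>The quotient of the two products of \<open>(z, a, s)\<close> and
      \<open>(z0, b, t0)\<close> lies over time 0, so \<open>cpos\<close> vanishes on it. This
      determines \<open>cpos a\<close> from \<open>s\<close>.\<close>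
    have "(a + flow \<mu> s b) + flow \<mu> (s + t0) (- flow \<mu> (- (t0 + s)) (b + flow \<mu> t0 a)) \<in> nilproj"
      using mult_mem[OF mult_mem[OF g g0] inv_mem[OF mult_mem[OF g0 g]]]
      unfolding nilproj_def by (auto simp: add.commute[of s t0])
    from cpos_nilproj_if_dense[OF dense this]
    have "cpos a + exp s * cpos b - (cpos b + exp t0 * cpos a) = 0"
      by (simp add: flow_flow add.commute[of s t0])
    hence "cpos a * (exp t0 - 1) = (exp s - 1) * cpos b" by (simp add: algebra_simps)
    thus ?thesis using t0 by (simp add: field_simps)
  qed
  obtain M where M: "M > 0"
    "\<forall>a\<in>osc_space q. \<forall>t. \<exists>b s z c r. (z, c, r) \<in> \<Gamma> \<and> anorm q b \<le> M \<and> \<bar>s\<bar> \<le> M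
      \<and> a = b + flow \<mu> s c \<and> t = s + r" using cocompact_bound by blast
  define k where "k = cpos b / (exp t0 - 1)"
  \<comment> \<open>Larger than every value of \<open>cpos (b' + flow \<mu> s c)\<close> that the
    previous formula allows for \<open>\<bar>s\<bar> \<le> M\<close>; the vector \<open>a\<close>
    below, taken over time 0, has \<open>cpos a = R\<close>.\<close>
  define R where "R = 2 * M + (1 + exp M) * \<bar>k\<bar> + 1"
  define a where "a = (\<lambda>j::nat. if j = 0 then complex_of_real R else 0)"
  have "a \<in> osc_space q" by (auto simp: a_def osc_space_def)
  from M(2)[rule_format, OF this, of 0] obtain b' s z c r where
    h: "(z, c, r) \<in> \<Gamma>" "anorm q b' \<le> M" "\<bar>s\<bar> \<le> M" "a = b' + flow \<mu> s c" "0 = s + r" by blast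
  have r: "r = - s" using h(5) by simp
  have "cpos a = cpos b' + exp s * ((exp (- s) - 1) * k)"
    using h(4) bound[OF h(1)] by (simp add: r k_def)
  also have "exp s * ((exp (- s) - 1) * k) = (1 - exp s) * k"
    by (simp add: exp_minus field_simps)
  also have "cpos b' + (1 - exp s) * k \<le> 2 * M + (1 + exp M) * \<bar>k\<bar>"
  proof (rule add_mono)
    show "cpos b' \<le> 2 * M" using cpos_le_anorm[of b' q] h(2) by linarith
    have "\<bar>1 - exp s\<bar> \<le> 1 + exp M"
    proof -
      have "exp s \<le> exp M" using h(3) by simp
      thus ?thesis using exp_gt_zero[of s] by linarith
    qed
    hence "\<bar>(1 - exp s) * k\<bar> \<le> (1 + exp M) * \<bar>k\<bar>" unfolding abs_mult by (intro mult_right_mono) auto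
    thus "(1 - exp s) * k \<le> (1 + exp M) * \<bar>k\<bar>" by linarith
  qed
  finally show False by (simp add: a_def cpos_def R_def)
qed

section \<open>The projection to the vector space is a lattice\<close>

lemma periods_pos: "\<exists>t\<in>periods. 0 < t"
proof -
  obtain M where M: "M > 0"
    "\<forall>a\<in>osc_space q. \<forall>t. \<exists>b s z c r. (z, c, r) \<in> \<Gamma> \<and> anorm q b \<le> M \<and> \<bar>s\<bar> \<le> M
      \<and> a = b + flow \<mu> s c \<and> t = s + r" using cocompact_bound by blast
  \<comment> \<open>Since \<open>\<bar>s\<bar> \<le> M\<close>, a point over \<open>M + 1\<close>
    can only be reached with \<open>r \<ge> 1\<close>.\<close>
  obtain b s z c r where h: "(z, c, r) \<in> \<Gamma>" "\<bar>s\<bar> \<le> M" "M + 1 = s + r"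
    using M(2)[rule_format, of 0 "M + 1"] by auto
  hence "r \<in> periods" "r > 0" by (auto simp: periods_def)
  thus ?thesis by blast
qed

lemma finite_periods: "finite {t \<in> periods. \<bar>t\<bar> \<le> M}"
proof -
  obtain \<delta> where \<delta>: "\<delta> > 0" "\<And>t. t \<in> periods \<Longrightarrow> 0 < t \<Longrightarrow> \<delta> \<le> t" using periods_gap by blast
  show ?thesis
  proof (rule finite_imageD)
    have "\<lfloor>t / \<delta>\<rfloor> \<in> {\<lfloor>- M / \<delta>\<rfloor>..\<lfloor>M / \<delta>\<rfloor>}" if "- M \<le> t" "t \<le> M" for t
      unfolding atLeastAtMost_iff using that \<delta>(1) by (intro conjI floor_mono divide_right_mono) auto
    hence "(\<lambda>t. \<lfloor>t / \<delta>\<rfloor>) ` {t \<in> periods. \<bar>t\<bar> \<le> M} \<subseteq> {\<lfloor>- M / \<delta>\<rfloor>..\<lfloor>M / \<delta>\<rfloor>}"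
      by (intro image_subsetI) (simp add: abs_le_iff minus_le_iff)
    thus "finite ((\<lambda>t. \<lfloor>t / \<delta>\<rfloor>) ` {t \<in> periods. \<bar>t\<bar> \<le> M})" by (rule finite_subset) simp
    have "s = t" if "s \<in> periods" "t \<in> periods" "\<lfloor>s / \<delta>\<rfloor> = \<lfloor>t / \<delta>\<rfloor>" for s t
    proof -
      have "\<bar>s / \<delta> - t / \<delta>\<bar> < 1" using that(3) by linarith
      hence "\<bar>s - t\<bar> / \<delta> < 1" using \<delta>(1) by (simp add: diff_divide_distrib[symmetric])
      hence "\<bar>s - t\<bar> < \<delta>" using \<delta>(1) by simp
      moreover have "s - t \<in> periods" "t - s \<in> periods" using that add_subgroup_diff[OF periods_subgroup] by auto
      ultimately show ?thesis using \<delta>(2)[of "s - t"] \<delta>(2)[of "t - s"] by linarith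
    qed
    thus "inj_on (\<lambda>t. \<lfloor>t / \<delta>\<rfloor>) {t \<in> periods. \<bar>t\<bar> \<le> M}" by (auto intro!: inj_onI)
  qed
qed

text \<open>Cocompactness approximates \<open>(0, a, 0)\<close> by an element of \<Gamma> over some
  period \<open>r\<close> with \<open>\<bar>r\<bar> \<le> M\<close>. Only finitely many such periods
  exist, so dividing by a fixed representative over \<open>r\<close> moves the element to time 0 at
  a bounded cost \<open>M'\<close>.\<close>

lemma nilproj_dense: "relatively_dense q nilproj"
proof -
  obtain M where M: "M > 0"
    "\<forall>a\<in>osc_space q. \<forall>t. \<exists>b s z c r. (z, c, r) \<in> \<Gamma> \<and> anorm q b \<le> M \<and> \<bar>s\<bar> \<le> M
      \<and> a = b + flow \<mu> s c \<and> t = s + r" using cocompact_bound by blast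
  define rep where "rep s = (SOME a. \<exists>z. (z, a, s) \<in> \<Gamma>)" for s
  have rep: "\<exists>z. (z, rep s, s) \<in> \<Gamma>" if "s \<in> periods" for s
  proof -
    have "\<exists>a z. (z, a, s) \<in> \<Gamma>" using that by (auto simp: periods_def)
    thus ?thesis unfolding rep_def by (rule someI_ex)
  qed
  define M' where "M' = Max (insert 0 ((\<lambda>s. anorm q (flow \<mu> (- s) (rep s))) ` {t \<in> periods. \<bar>t\<bar> \<le> M}))"
  have M': "anorm q (flow \<mu> (- s) (rep s)) \<le> M'" if "s \<in> periods" "\<bar>s\<bar> \<le> M" for s
    unfolding M'_def using finite_periods[of M] that by (intro Max_ge) auto
  have "\<exists>b\<in>nilproj. anorm q (a - b) \<le> M + M'" if a: "a \<in> osc_space q" for a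
  proof -
    obtain b s z c r where h: "(z, c, r) \<in> \<Gamma>" "anorm q b \<le> M" "\<bar>s\<bar> \<le> M" "a = b + flow \<mu> s c" "0 = s + r"
      using M(2)[rule_format, OF a, of 0] by blast
    have s: "s = - r" using h(5) by simp
    have r: "r \<in> periods" "\<bar>r\<bar> \<le> M" using h(1,3) by (auto simp: periods_def s)
    obtain z' where "(z', rep r, r) \<in> \<Gamma>" using rep[OF r(1)] by blast
    from mult_mem[OF inv_mem[OF this] h(1)]
    have mem: "- flow \<mu> (- r) (rep r) + flow \<mu> (- r) c \<in> nilproj" unfolding nilproj_def by auto
    have e: "a - (- flow \<mu> (- r) (rep r) + flow \<mu> (- r) c) = b + flow \<mu> (- r) (rep r)"
      using h(4) by (simp add: s)
    have "anorm q (a - (- flow \<mu> (- r) (rep r) + flow \<mu> (- r) c)) \<le> M + M'"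
      unfolding e using anorm_triangle[of q b "flow \<mu> (- r) (rep r)"] h(2) M'[OF r] by linarith
    thus ?thesis using mem by blast
  qed
  thus ?thesis unfolding relatively_dense_def by blast
qed

text \<open>Values of the form are commutators in \<Gamma>, so the nonzero ones are at least
  \<epsilon>; nondegeneracy and relative density do the rest.\<close>

lemma nilproj_separated: "separated q nilproj"
proof -
  obtain \<epsilon> where \<epsilon>: "\<epsilon> > 0"
    "\<forall>z a t. (z, a, t) \<in> \<Gamma> \<longrightarrow> \<bar>z\<bar> < \<epsilon> \<longrightarrow> anorm q a < \<epsilon> \<longrightarrow> \<bar>t\<bar> < \<epsilon> \<longrightarrow> z = 0 \<and> a = 0 \<and> t = 0"
    using near_one by blast
  show ?thesis
  proof (rule separated_if_form_discrete[OF \<mu>_nonzero nilproj_dense \<epsilon>(1) _ nilproj_space])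
    fix a b assume "a \<in> nilproj" "b \<in> nilproj" "osc_form q \<mu> a b \<noteq> 0"
    thus "\<epsilon> \<le> \<bar>osc_form q \<mu> a b\<bar>"
      using \<epsilon> form_mem[of a b] by (metis abs_zero anorm_zero not_le)
  qed
qed

end

text \<open>From here on the group law is forgotten: the arithmetic needs only a lattice of vectors
  and one positive time that preserves it.\<close>

lemma lattice_imp_invariant_lattice:
  assumes "osc_lattice q \<mu> \<Gamma>" "\<forall>j\<in>{1..q}. \<mu> j \<noteq> 0"
  shows "\<exists>A t. t > 0 \<and> A \<subseteq> osc_space q \<and> add_subgroup A \<and> separated q A \<and> relatively_dense q A
    \<and> (\<forall>a\<in>A. flow \<mu> t a \<in> A)"
proof -
  interpret osc_lattice_subgroup q \<mu> \<Gamma> using assms by unfold_locales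
  show ?thesis using periods_pos nilproj_flow nilproj_space nilproj_subgroup nilproj_separated nilproj_dense
    by blast
qed

section \<open>Construction of lattices\<close>

lemma sum_fun_apply: "(\<Sum>i\<in>I. f i) x = (\<Sum>i\<in>I. f i x :: 'b::comm_monoid_add)"
  by (induction I rule: infinite_finite_induct) auto

lemma cpos_sum: "cpos (\<Sum>i\<in>I. f i) = (\<Sum>i\<in>I. cpos (f i))"
  and cneg_sum: "cneg (\<Sum>i\<in>I. f i) = (\<Sum>i\<in>I. cneg (f i))"
  by (induction I rule: infinite_finite_induct) auto

lemma anorm_sum: "anorm q (\<Sum>i\<in>I. f i) \<le> (\<Sum>i\<in>I. anorm q (f i))"
proof (induction I rule: infinite_finite_induct)
  case (insert i I)
  thus ?case using anorm_triangle[of q "f i" "sum f I"] unfolding sum.insert[OF insert(1,2)] by linarith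
qed (auto simp: anorm_def)

lemma compact_fun_box:
  fixes S :: "'a \<Rightarrow> 'b::topological_space set"
  assumes "\<And>j. compact (S j)"
  shows "compact {a. \<forall>j. a j \<in> S j}"
proof -
  have "compactin (product_topology (\<lambda>j. euclidean) UNIV) (PiE UNIV S)"
    unfolding compactin_PiE using assms by simp
  moreover have "PiE UNIV S = {a. \<forall>j. a j \<in> S j}" by auto
  ultimately show ?thesis by (simp add: euclidean_product_topology)
qed

text \<open>The lattice is the product of the half-integers, \<open>A\<close> and the multiples of
  \<open>t0\<close>; half-integers absorb the factor 1/2 in the Heisenberg law.\<close>

lemma admits_lattice_if_invariant_lattice:
  assumes \<mu>: "\<forall>j\<in>{1..q}. \<mu> j \<noteq> 0" and t0: "t0 > 0" and sub: "A \<subseteq> osc_space q"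
    and grp: "add_subgroup A" and dense: "relatively_dense q A"
    and fl: "\<And>a. a \<in> A \<Longrightarrow> flow \<mu> t0 a \<in> A" "\<And>a. a \<in> A \<Longrightarrow> flow \<mu> (- t0) a \<in> A"
    and int: "\<And>a b. a \<in> A \<Longrightarrow> b \<in> A \<Longrightarrow> osc_form q \<mu> a b \<in> \<int>"
  shows "osc_admits_lattice q \<mu>"
proof -
  have sp: "a \<in> osc_space q" if "a \<in> A" for a using sub that by blast
  have flk: "flow \<mu> (of_int k * t0) a \<in> A" if a: "a \<in> A" for k a
  proof (induction k rule: int_induct[of _ 0])
    case base show ?case using a by simp
  next
    case (step1 i) from fl(1)[OF step1(2)] show ?case by (simp add: flow_flow algebra_simps)
  next
    case (step2 i) from fl(2)[OF step2(2)] show ?case by (simp add: flow_flow algebra_simps)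
  qed
  have "separated q A"
  proof (rule separated_if_form_discrete[OF \<mu> dense, of 1])
    fix a b assume "a \<in> A" "b \<in> A" "osc_form q \<mu> a b \<noteq> 0"
    thus "1 \<le> \<bar>osc_form q \<mu> a b\<bar>" using int[of a b] by (auto elim!: Ints_cases)
  qed (use sub in auto)
  then obtain \<delta> where \<delta>: "\<delta> > 0" "\<And>a. a \<in> A \<Longrightarrow> anorm q a < \<delta> \<Longrightarrow> a = 0"
    by (auto simp: separated_def)
  obtain M where M: "\<And>a. a \<in> osc_space q \<Longrightarrow> \<exists>b\<in>A. anorm q (a - b) \<le> M"
    using dense by (auto simp: relatively_dense_def)
  define \<Gamma> where "\<Gamma> = {(z :: real, a, t) | z a t. 2 * z \<in> \<int> \<and> a \<in> A \<and> t / t0 \<in> \<int>}"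
  have mem: "(z, a, t) \<in> \<Gamma> \<longleftrightarrow> 2 * z \<in> \<int> \<and> a \<in> A \<and> t / t0 \<in> \<int>" for z a t
    by (auto simp: \<Gamma>_def)
  have flt: "flow \<mu> t a \<in> A" if a: "a \<in> A" and t: "t / t0 \<in> \<int>" for t a
  proof -
    obtain k where "t / t0 = of_int k" using t by (auto elim: Ints_cases)
    hence "t = of_int k * t0" using t0 by (simp add: field_simps)
    thus ?thesis using flk[OF a] by simp
  qed
  have "osc_lattice q \<mu> \<Gamma>"
    unfolding osc_lattice_def
  proof (intro conjI ballI)
    show "\<Gamma> \<subseteq> osc_carrier q" using sp by (auto simp: \<Gamma>_def osc_carrier_iff)
    show "osc_one \<in> \<Gamma>" using add_subgroup_zero[OF grp] by (simp add: osc_one_eq mem)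
  next
    fix x y assume xy: "x \<in> \<Gamma>" "y \<in> \<Gamma>"
    obtain z a t z' a' t' where e: "x = (z, a, t)" "y = (z', a', t')" by (cases x, cases y)
    have h: "2 * z \<in> \<int>" "a \<in> A" "t / t0 \<in> \<int>" "2 * z' \<in> \<int>" "a' \<in> A" "t' / t0 \<in> \<int>"
      using xy by (auto simp: e mem)
    have "2 * z + 2 * z' + osc_form q \<mu> a (flow \<mu> t a') \<in> \<int>"
      by (intro Ints_add h int flt)
    thus "osc_mult q \<mu> x y \<in> \<Gamma>"
      unfolding e osc_mult_eq[OF sp[OF h(5)]] mem
      by (auto simp: algebra_simps add_divide_distrib h intro!: add_subgroup_add[OF grp] flt Ints_add)
  next
    fix x assume x: "x \<in> \<Gamma>"
    obtain z a t where e: "x = (z, a, t)" by (cases x)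
    have h: "2 * z \<in> \<int>" "a \<in> A" "t / t0 \<in> \<int>" using x by (auto simp: e mem)
    have m: "- flow \<mu> (- t) a \<in> A" using h by (intro add_subgroup_uminus[OF grp] flt) auto
    show "\<exists>y\<in>\<Gamma>. osc_mult q \<mu> x y = osc_one \<and> osc_mult q \<mu> y x = osc_one"
    proof (rule bexI[of _ "(- z, - flow \<mu> (- t) a, - t)"])
      show "(- z, - flow \<mu> (- t) a, - t) \<in> \<Gamma>" using h m by (simp add: mem)
      show "osc_mult q \<mu> x (- z, - flow \<mu> (- t) a, - t) = osc_one \<and>
        osc_mult q \<mu> (- z, - flow \<mu> (- t) a, - t) x = osc_one"
        unfolding e osc_mult_eq[OF sp[OF m]] osc_mult_eq[OF sp[OF h(2)]]
        by (simp add: flow_flow osc_form_bilin osc_one_eq)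
    qed
  next
    fix \<gamma> assume g: "\<gamma> \<in> \<Gamma>"
    obtain z a t where e: "\<gamma> = (z, a, t)" by (cases \<gamma>)
    \<comment> \<open>Different elements of the three factors of \<Gamma> are at least 1/2, \<delta>
      and \<open>t0\<close> apart.\<close>
    define U where "U = {x. \<bar>fst x - z\<bar> < 1/2 \<and> anorm q (fst (snd x) - a) < \<delta> \<and> \<bar>snd (snd x) - t\<bar> < t0}"
    have co: "continuous_on UNIV (\<lambda>x :: real \<times> (nat \<Rightarrow> complex) \<times> real. fst (snd x) j)" for j
      by (rule continuous_on_compose2[OF continuous_on_product_coordinates[of j], of UNIV "\<lambda>x. fst (snd x)"])
        (auto intro!: continuous_on_fst continuous_on_snd continuous_on_id)
    have "open U"
      unfolding U_def anorm_def minus_apply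
      by (intro open_Collect_conj open_Collect_less continuous_intros co)
    moreover have "U \<inter> \<Gamma> = {\<gamma>}"
    proof (intro equalityI subsetI)
      fix x assume "x \<in> U \<inter> \<Gamma>"
      moreover obtain z' a' t' where x: "x = (z', a', t')" by (cases x)
      ultimately have h: "2 * z' \<in> \<int>" "a' \<in> A" "t' / t0 \<in> \<int>" "\<bar>z' - z\<bar> < 1/2" "anorm q (a' - a) < \<delta>" "\<bar>t' - t\<bar> < t0"
        by (auto simp: mem U_def)
      have g': "2 * z \<in> \<int>" "a \<in> A" "t / t0 \<in> \<int>" using g by (auto simp: e mem)
      have "2 * z' - 2 * z \<in> \<int>" "\<bar>2 * z' - 2 * z\<bar> < 1" using Ints_diff[OF h(1) g'(1)] h(4) by (simp, linarith)
      hence "2 * z' - 2 * z = 0" by (rule Ints_nonzero_abs_less1)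
      moreover have "a' - a = 0" using h(5) by (intro \<delta>(2) add_subgroup_diff[OF grp] h g')
      moreover have "t' / t0 - t / t0 \<in> \<int>" "\<bar>t' / t0 - t / t0\<bar> < 1"
        using Ints_diff[OF h(3) g'(3)] h(6) t0 by (auto simp flip: diff_divide_distrib)
      hence "t' / t0 - t / t0 = 0" by (rule Ints_nonzero_abs_less1)
      hence "t' = t" using t0 by simp
      ultimately show "x \<in> {\<gamma>}" by (simp add: x e)
    qed (use g \<delta>(1) t0 in \<open>auto simp: U_def e\<close>)
    ultimately show "\<exists>U. open U \<and> U \<inter> \<Gamma> = {\<gamma>}" by blast
  next
    \<comment> \<open>The remainder modulo \<open>A\<close>, of norm at most \<open>M\<close>, is
      still transported by a flow of time between 0 and \<open>t0\<close>.\<close>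
    define R where "R = 8 * exp t0 * M"
    define B where "B = {a. \<forall>j. a j \<in> (if j \<le> q then cball 0 R else {0 :: complex})}"
    have "compact B" unfolding B_def by (rule compact_fun_box) auto
    hence "compact ({0..1::real} \<times> B \<times> {0..t0})" by (intro compact_Times) auto
    moreover have "{0..1::real} \<times> B \<times> {0..t0} \<subseteq> osc_carrier q"
      by (auto simp: osc_carrier_iff osc_space_def B_def)
    moreover have "osc_carrier q \<subseteq> {osc_mult q \<mu> k \<gamma> | k \<gamma>. k \<in> {0..1::real} \<times> B \<times> {0..t0} \<and> \<gamma> \<in> \<Gamma>}"
    proof
      fix x assume x: "x \<in> osc_carrier q"
      obtain z a t where e: "x = (z, a, t)" by (cases x)
      have a: "a \<in> osc_space q" using x by (simp add: e osc_carrier_iff)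
      define k where "k = \<lfloor>t / t0\<rfloor>"
      define s where "s = t - of_int k * t0"
      have "of_int k \<le> t / t0" "t / t0 \<le> of_int k + 1" unfolding k_def by linarith+
      hence "of_int k * t0 \<le> t" "t \<le> (of_int k + 1) * t0" using t0 by (simp_all add: field_simps)
      hence s: "0 \<le> s" "s \<le> t0" by (simp_all add: s_def algebra_simps)
      obtain c where c: "c \<in> A" "anorm q (flow \<mu> (- s) a - c) \<le> M" using M[of "flow \<mu> (- s) a"] a by auto
      define b where "b = flow \<mu> s (flow \<mu> (- s) a - c)"
      have b: "b + flow \<mu> s c = a" by (simp add: b_def flow_flow)
      have "anorm q b \<le> 8 * exp \<bar>s\<bar> * anorm q (flow \<mu> (- s) a - c)" unfolding b_def by (rule anorm_flow_le)
      also have "\<dots> \<le> 8 * exp t0 * M" using s c(2) by (intro mult_mono) auto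
      finally have "anorm q b \<le> R" by (simp add: R_def)
      moreover have bsp: "b \<in> osc_space q" using a sp[OF c(1)] by (simp add: b_def)
      ultimately have bB: "b \<in> B" using cmod_le_anorm[of _ q b]
        by (auto simp: B_def osc_space_def intro: order.trans)
      \<comment> \<open>Twice the central coordinate that remains after the form term of the
        product; its integer part goes to \<Gamma>, its fractional part to the compact set.\<close>
      define w where "w = 2 * z - osc_form q \<mu> b (flow \<mu> s c)"
      have wf: "of_int \<lfloor>w\<rfloor> \<le> w" "w - of_int \<lfloor>w\<rfloor> \<le> 2" by linarith+
      have "(z, a, t) = osc_mult q \<mu> ((w - of_int \<lfloor>w\<rfloor>) / 2, b, s) (of_int \<lfloor>w\<rfloor> / 2, c, of_int k * t0)"
        unfolding osc_mult_eq[OF sp[OF c(1)]] by (simp add: b w_def) (simp add: s_def field_simps)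
      moreover have "((w - of_int \<lfloor>w\<rfloor>) / 2, b, s) \<in> {0..1::real} \<times> B \<times> {0..t0}" using wf(2) bB s by auto
      moreover have "(of_int \<lfloor>w\<rfloor> / 2, c, of_int k * t0) \<in> \<Gamma>" using c(1) t0 by (simp add: mem)
      ultimately show "x \<in> {osc_mult q \<mu> k \<gamma> | k \<gamma>. k \<in> {0..1::real} \<times> B \<times> {0..t0} \<and> \<gamma> \<in> \<Gamma>}"
        unfolding e by blast
    qed
    ultimately show "\<exists>K. compact K \<and> K \<subseteq> osc_carrier q \<and>
      osc_carrier q \<subseteq> {osc_mult q \<mu> k \<gamma> | k \<gamma>. k \<in> K \<and> \<gamma> \<in> \<Gamma>}" by blast
  qed
  thus ?thesis unfolding osc_admits_lattice_def by blast
qed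

section \<open>Integer combinations, interpolation and prescribed signs\<close>

lemma bounded_remainder_int_combination:
  assumes "add_subgroup A" "finite I" "\<And>i. i \<in> I \<Longrightarrow> g i \<in> A"
  shows "\<exists>b\<in>A. anorm q ((\<Sum>i\<in>I. rscale (c i) (g i)) - b) \<le> (\<Sum>i\<in>I. anorm q (g i))"
\<comment> \<open>Rounding the coefficients down costs at most one copy of each generator.\<close>
proof (rule bexI[of _ "\<Sum>i\<in>I. rscale (of_int \<lfloor>c i\<rfloor>) (g i)"])
  have e: "(\<Sum>i\<in>I. rscale (c i) (g i)) - (\<Sum>i\<in>I. rscale (of_int \<lfloor>c i\<rfloor>) (g i))
      = (\<Sum>i\<in>I. rscale (c i - of_int \<lfloor>c i\<rfloor>) (g i))"
    by (simp add: rscale_diff_left sum_subtractf)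
  have "anorm q (\<Sum>i\<in>I. rscale (c i - of_int \<lfloor>c i\<rfloor>) (g i)) \<le> (\<Sum>i\<in>I. anorm q (rscale (c i - of_int \<lfloor>c i\<rfloor>) (g i)))" by (rule anorm_sum)
  also have "\<dots> \<le> (\<Sum>i\<in>I. anorm q (g i))"
  proof (rule sum_mono)
    fix i
    have "\<bar>c i - of_int \<lfloor>c i\<rfloor>\<bar> \<le> 1" by linarith
    thus "anorm q (rscale (c i - of_int \<lfloor>c i\<rfloor>) (g i)) \<le> anorm q (g i)"
      by (simp add: mult_left_le_one_le)
  qed
  finally show "anorm q ((\<Sum>i\<in>I. rscale (c i) (g i)) - (\<Sum>i\<in>I. rscale (of_int \<lfloor>c i\<rfloor>) (g i)))
    \<le> (\<Sum>i\<in>I. anorm q (g i))" unfolding e .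
  show "(\<Sum>i\<in>I. rscale (of_int \<lfloor>c i\<rfloor>) (g i)) \<in> A"
    using assms by (intro add_subgroup_sum add_subgroup_rscale_int) auto
qed

text \<open>As an intersection, it lets \<open>zspan_least\<close> carry a property from the
  generators to the span whenever the property defines a subgroup; bilinearity is used one argument
  at a time.\<close>

definition zspan :: "'a::ab_group_add set \<Rightarrow> 'a set" where
  "zspan G = \<Inter>{H. add_subgroup H \<and> G \<subseteq> H}"

lemma add_subgroup_zspan: "add_subgroup (zspan G)"
  unfolding add_subgroup_def zspan_def by (auto intro: add_subgroup_zero add_subgroup_diff)

lemma zspan_superset: "g \<in> G \<Longrightarrow> g \<in> zspan G"
  by (auto simp: zspan_def)

lemma zspan_least: "add_subgroup H \<Longrightarrow> G \<subseteq> H \<Longrightarrow> a \<in> zspan G \<Longrightarrow> a \<in> H"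
  by (auto simp: zspan_def)

text \<open>Newton's scheme: the value at a new node is corrected by a multiple of the polynomial
  vanishing at the old ones. Bounding the degree through coefficients keeps the empty set of nodes
  correct.\<close>

lemma polynomial_interpolation:
  fixes g :: "'a::field \<Rightarrow> 'a"
  assumes "finite S"
  shows "\<exists>p. (\<forall>x\<in>S. poly p x = g x) \<and> (\<forall>i\<ge>card S. coeff p i = 0)"
  using assms
proof (induction S rule: finite_induct)
  case empty
  show ?case by (intro exI[of _ 0]) auto
next
  case (insert y S)
  then obtain p where p: "\<And>x. x \<in> S \<Longrightarrow> poly p x = g x" "\<And>i. i \<ge> card S \<Longrightarrow> coeff p i = 0" by blast
  define w where "w = (\<Prod>s\<in>S. [:-s, 1:])"
  have wS: "poly w x = 0" if "x \<in> S" for x using that insert(1) by (auto simp: w_def poly_prod)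
  have wy: "poly w y \<noteq> 0" using insert(1,2) by (auto simp: w_def poly_prod)
  have "degree w = card S" unfolding w_def by (subst degree_prod_eq_sum_degree) auto
  hence "coeff w i = 0" if "i \<ge> card (insert y S)" for i
    using that insert(1,2) by (intro coeff_eq_0) auto
  hence "\<forall>i\<ge>card (insert y S). coeff (p + Polynomial.smult ((g y - poly p y) / poly w y) w) i = 0"
    using p(2) insert(1,2) by auto
  moreover have "\<forall>x\<in>insert y S. poly (p + Polynomial.smult ((g y - poly p y) / poly w y) w) x = g x"
    using p(1) wS wy by auto
  ultimately show ?case by blast
qed

lemma poly_eq_sum_lessThan:
  fixes p :: "'a::comm_semiring_1 poly"
  assumes "\<And>i. i \<ge> n \<Longrightarrow> coeff p i = 0"
  shows "poly p x = (\<Sum>i<n. coeff p i * x ^ i)"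
proof -
  have "degree p < n \<or> p = 0" using assms[of "degree p"] by (cases "degree p < n") auto
  thus ?thesis
  proof
    assume "degree p < n"
    thus ?thesis unfolding poly_altdef by (intro sum.mono_neutral_left) (auto simp: coeff_eq_0)
  qed simp
qed

text \<open>Interpolate \<sigma> over the reals, scale by a large \<open>N\<close> and round the
  coefficients. The rounding changes the value at \<open>y\<close> by at most \<open>E y\<close>,
  whatever \<open>N\<close> is, and \<open>N\<close> is chosen with
  \<open>E y < N * \<bar>\<sigma> y\<bar>\<close> at every \<open>y\<close> in
  \<open>Y\<close>.\<close>

lemma int_poly_prescribed_signs:
  fixes \<sigma> :: "real \<Rightarrow> real"
  assumes "finite Y" "\<And>y. y \<in> Y \<Longrightarrow> \<sigma> y \<noteq> 0"
  shows "\<exists>s :: int poly. \<forall>y\<in>Y. poly (map_poly of_int s) y * \<sigma> y > 0"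
proof -
  obtain p where p: "\<And>y. y \<in> Y \<Longrightarrow> poly p y = \<sigma> y" using polynomial_interpolation[OF assms(1), of \<sigma>] by blast
  define E where "E y = (\<Sum>i\<le>degree p. \<bar>y\<bar> ^ i)" for y :: real
  define N where "N = (\<Sum>y\<in>Y. E y / \<bar>\<sigma> y\<bar>) + 1"
  have E0: "E y \<ge> 0" for y unfolding E_def by (intro sum_nonneg) auto
  have N: "N * \<bar>\<sigma> y\<bar> > E y" if "y \<in> Y" for y
  proof -
    have "E y / \<bar>\<sigma> y\<bar> \<le> (\<Sum>y\<in>Y. E y / \<bar>\<sigma> y\<bar>)" using that assms(1) E0 by (intro member_le_sum) auto
    hence "E y / \<bar>\<sigma> y\<bar> < N" by (simp add: N_def)
    thus ?thesis using assms(2)[OF that] by (simp add: divide_less_eq)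
  qed
  define s where "s = map_poly (\<lambda>c. \<lfloor>N * c\<rfloor>) p"
  have "poly (map_poly of_int s) y * \<sigma> y > 0" if y: "y \<in> Y" for y
  proof -
    define d where "d = Polynomial.smult N p - map_poly of_int s"
    have cd: "coeff d i = N * coeff p i - of_int \<lfloor>N * coeff p i\<rfloor>" for i
      by (simp add: d_def s_def coeff_map_poly)
    have "degree d \<le> degree p" by (rule degree_le) (simp add: cd coeff_eq_0)
    have c1: "\<bar>coeff d i\<bar> \<le> 1" for i unfolding cd by linarith
    have "\<bar>poly d y\<bar> \<le> (\<Sum>i\<le>degree d. \<bar>coeff d i * y ^ i\<bar>)" unfolding poly_altdef by (rule sum_abs)
    also have "\<dots> \<le> (\<Sum>i\<le>degree d. \<bar>y\<bar> ^ i)"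
    proof (rule sum_mono)
      fix i show "\<bar>coeff d i * y ^ i\<bar> \<le> \<bar>y\<bar> ^ i"
        using c1[of i] by (simp add: abs_mult power_abs mult_left_le_one_le)
    qed
    also have "\<dots> \<le> E y" unfolding E_def using \<open>degree d \<le> degree p\<close> by (intro sum_mono2) auto
    finally have "\<bar>N * \<sigma> y - poly (map_poly of_int s) y\<bar> \<le> E y" by (simp add: d_def p[OF y])
    hence close: "\<bar>N * \<sigma> y - poly (map_poly of_int s) y\<bar> < N * \<bar>\<sigma> y\<bar>" using N[OF y] by linarith
    show ?thesis
    proof (cases "\<sigma> y > 0")
      case True
      hence "poly (map_poly of_int s) y > 0" using close by (simp add: abs_less_iff)
      thus ?thesis using True by simp
    next
      case False
      hence n: "\<sigma> y < 0" using assms(2)[OF y] by simp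
      hence "poly (map_poly of_int s) y < 0" using close by (simp add: abs_less_iff)
      thus ?thesis using n by (simp add: mult_neg_neg)
    qed
  qed
  thus ?thesis by blast
qed

section \<open>Integral trace forms\<close>

text \<open>The polynomial $\sum_\rho \rho^k f(x)/(x-\rho)$ is the remainder of $x^k f'(x)$ modulo the monic $f$,
  hence integral, and its leading coefficient is the power sum.\<close>

lemma power_sum_roots_int:
  fixes f :: "int poly" and S :: "complex set"
  assumes S: "finite S" and f: "map_poly of_int f = (\<Prod>\<rho>\<in>S. [:-\<rho>, 1:])"
  shows "(\<Sum>\<rho>\<in>S. \<rho> ^ k) \<in> \<int>"
proof (cases "S = {}")
  case False
  define F :: "complex poly" where "F = map_poly of_int f"
  define G where "G \<rho> = (\<Prod>\<sigma>\<in>S - {\<rho>}. [:-\<sigma>, 1:])" for \<rho> :: complex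
  define R where "R = (\<Sum>\<rho>\<in>S. Polynomial.smult (\<rho> ^ k) (G \<rho>))"
  define d where "d = card S"
  have d: "d > 0" using S False by (auto simp: d_def card_gt_0_iff)
  have degF: "degree F = d" unfolding F_def f d_def by (subst degree_prod_eq_sum_degree) auto
  have degG: "degree (G \<rho>) = d - 1" if "\<rho> \<in> S" for \<rho>
    unfolding G_def d_def using S that by (subst degree_prod_eq_sum_degree) auto
  have lcG: "lead_coeff (G \<rho>) = 1" for \<rho> unfolding G_def by (simp add: lead_coeff_prod)
  have FG: "F = [:-\<rho>, 1:] * G \<rho>" if "\<rho> \<in> S" for \<rho>
    unfolding F_def f G_def by (rule prod.remove[OF S that])
  have "lead_coeff F = 1" unfolding F_def f by (simp add: lead_coeff_prod)
  have degf: "degree f = d" using degF by (simp add: F_def)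
  have lcf: "lead_coeff f = 1"
    using \<open>lead_coeff F = 1\<close> by (simp add: F_def)
  have pF: "pderiv F = (\<Sum>\<rho>\<in>S. G \<rho>)"
    unfolding F_def f pderiv_prod G_def by (simp add: pderiv_pCons)
  have dvd1: "F dvd (monom 1 k * pderiv F - R)"
  proof -
    have "monom 1 k * pderiv F - R = (\<Sum>\<rho>\<in>S. (monom 1 k - [:\<rho> ^ k:]) * G \<rho>)"
      unfolding pF R_def sum_distrib_left by (simp add: left_diff_distrib sum_subtractf)
    moreover have "F dvd (monom 1 k - [:\<rho> ^ k:]) * G \<rho>" if "\<rho> \<in> S" for \<rho>
      unfolding FG[OF that] by (intro mult_dvd_mono) (simp_all add: poly_eq_0_iff_dvd[symmetric] poly_monom)
    ultimately show ?thesis by (simp add: dvd_sum)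
  qed
  define p where "p = monom 1 k * pderiv f"
  define r where "r = pseudo_mod p f"
  have f0: "f \<noteq> 0" using lcf by auto
  obtain Q where "pseudo_divmod p f = (Q, r)" unfolding r_def pseudo_mod_def by (metis prod.collapse)
  from pseudo_divmod[OF f0 this] have Q: "p = f * Q + r" and r: "r = 0 \<or> degree r < degree f"
    using lcf by auto
  define r' :: "complex poly" where "r' = map_poly of_int r"
  have "monom 1 k * pderiv F = F * map_poly of_int Q + r'"
  proof -
    have "map_poly of_int p = (F * map_poly of_int Q + r' :: complex poly)"
      unfolding Q F_def r'_def by (simp add: of_int_poly_hom.hom_add of_int_poly_hom.hom_mult)
    moreover have "map_poly of_int p = monom 1 k * pderiv F"
      unfolding p_def F_def by (simp add: of_int_poly_hom.hom_mult of_int_hom.map_poly_pderiv)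
    ultimately show ?thesis by simp
  qed
  hence "r' - R = (monom 1 k * pderiv F - R) - F * map_poly of_int Q" by simp
  hence "F dvd r' - R" using dvd1 by (metis dvd_diff dvd_triv_left)
  moreover have "degree (r' - R) < degree F"
  proof (rule degree_diff_less)
    show "degree r' < degree F" using r degf d degF unfolding r'_def by auto
    have "degree R \<le> d - 1" unfolding R_def
      by (intro degree_sum_le S) (use degG in \<open>auto intro: order.trans[OF degree_smult_le]\<close>)
    thus "degree R < degree F" using d degF by simp
  qed
  ultimately have "r' - R = 0" by (metis dvd_imp_degree_le not_le)
  hence "R = r'" by simp
  hence "coeff R (d - 1) = of_int (coeff r (d - 1))" by (simp add: r'_def)
  moreover have "coeff R (d - 1) = (\<Sum>\<rho>\<in>S. \<rho> ^ k)"
  proof -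
    have "coeff (G \<rho>) (d - 1) = 1" if "\<rho> \<in> S" for \<rho> using degG[OF that] lcG[of \<rho>] by simp
    thus ?thesis unfolding R_def coeff_sum by (intro sum.cong) simp_all
  qed
  ultimately show ?thesis by (metis Ints_of_int)
qed simp

text \<open>Inversion permutes \<open>S\<close> and turns negative exponents into positive
  ones.\<close>

lemma power_sum_roots_int':
  fixes f :: "int poly" and S :: "complex set"
  assumes S: "finite S" and f: "map_poly of_int f = (\<Prod>\<rho>\<in>S. [:-\<rho>, 1:])"
    and inv: "inverse ` S = S"
  shows "(\<Sum>\<rho>\<in>S. \<rho> powi h) \<in> \<int>"
proof (cases "h \<ge> 0")
  case True
  thus ?thesis using power_sum_roots_int[OF S f, of "nat h"] by (simp add: power_int_def)
next
  case False
  have "(\<Sum>\<rho>\<in>S. \<rho> powi h) = (\<Sum>\<rho>\<in>inverse ` S. \<rho> ^ nat (- h))"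
    using False by (subst sum.reindex) (auto simp: power_int_def inj_on_def)
  thus ?thesis using power_sum_roots_int[OF S f, of "nat (- h)"] by (simp add: inv)
qed

text \<open>Each factor \<open>\<rho> + inverse \<rho>\<close> shifts the exponent by 1 up and down;
  therefore the induction on \<open>s\<close> runs over all \<open>h\<close> at once.\<close>

lemma twisted_power_sum_roots_int:
  fixes f :: "int poly" and S :: "complex set" and s :: "int poly"
  assumes S: "finite S" and f: "map_poly of_int f = (\<Prod>\<rho>\<in>S. [:-\<rho>, 1:])"
    and inv: "inverse ` S = S" and nz: "0 \<notin> S"
  shows "(\<Sum>\<rho>\<in>S. poly (map_poly of_int s) (\<rho> + inverse \<rho>) * \<rho> powi h) \<in> \<int>"
proof (induction s arbitrary: h rule: pCons_induct)
  case 0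
  show ?case by simp
next
  case (pCons c s)
  have "poly (map_poly of_int (pCons c s)) (\<rho> + inverse \<rho>) * \<rho> powi h =
      of_int c * \<rho> powi h + (poly (map_poly of_int s) (\<rho> + inverse \<rho>) * \<rho> powi (h + 1)
      + poly (map_poly of_int s) (\<rho> + inverse \<rho>) * \<rho> powi (h - 1))" if "\<rho> \<in> S" for \<rho> :: complex
  proof -
    have "\<rho> \<noteq> 0" using that nz by auto
    hence "\<rho> powi (h + 1) = \<rho> * \<rho> powi h" "\<rho> powi (h - 1) = inverse \<rho> * \<rho> powi h"
      by (simp_all add: power_int_add power_int_diff field_simps)
    thus ?thesis by (simp add: of_int_hom.map_poly_pCons_hom algebra_simps)
  qed
  hence "(\<Sum>\<rho>\<in>S. poly (map_poly of_int (pCons c s)) (\<rho> + inverse \<rho>) * \<rho> powi h) =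
      of_int c * (\<Sum>\<rho>\<in>S. \<rho> powi h) + ((\<Sum>\<rho>\<in>S. poly (map_poly of_int s) (\<rho> + inverse \<rho>) * \<rho> powi (h + 1))
      + (\<Sum>\<rho>\<in>S. poly (map_poly of_int s) (\<rho> + inverse \<rho>) * \<rho> powi (h - 1)))"
    by (simp add: sum.distrib sum_distrib_left)
  thus ?case using pCons.IH power_sum_roots_int'[OF S f inv] by (simp add: Ints_add Ints_mult)
qed

lemma poly_of_int_of_real:
  "poly (map_poly of_int s) (complex_of_real x) = complex_of_real (poly (map_poly of_int s) x)"
  by (induction s) (simp_all add: of_int_hom.map_poly_pCons_hom)

lemma add_inverse_gt_2:
  fixes r :: real
  assumes "r > 1"
  shows "r + inverse r > 2"
proof -
  have "(r - 1)\<^sup>2 / r > 0" using assms by simp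
  also have "(r - 1)\<^sup>2 / r = r + inverse r - 2" using assms by (simp add: power2_eq_square field_simps)
  finally show ?thesis by simp
qed

section \<open>The lattice built from the roots of a polynomial\<close>

definition unit_vector :: "nat \<Rightarrow> complex \<Rightarrow> (nat \<Rightarrow> complex)" where
  "unit_vector j c = (\<lambda>i. if i = j then c else 0)"

lemma unit_vector_apply: "unit_vector j c i = (if i = j then c else 0)"
  by (simp add: unit_vector_def)

lemma cpos_unit_vector [simp]: "j \<noteq> 0 \<Longrightarrow> cpos (unit_vector j c) = 0"
  and cneg_unit_vector [simp]: "j \<noteq> 0 \<Longrightarrow> cneg (unit_vector j c) = 0"
  by (simp_all add: cpos_def cneg_def unit_vector_def)

lemma osc_form_unit_vector_right:
  assumes "j \<in> {1..q}"
  shows "osc_form q \<mu> a (unit_vector j c) = \<mu> j * Im (cnj (a j) * c)"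
proof -
  have "(\<Sum>i\<in>{1..q}. \<mu> i * Im (cnj (a i) * unit_vector j c i)) =
      (\<Sum>i\<in>{1..q}. if i = j then \<mu> j * Im (cnj (a j) * c) else 0)"
    by (rule sum.cong) (auto simp: unit_vector_def)
  thus ?thesis using assms by (simp add: osc_form_def)
qed

text \<open>\<open>J\<close> collects the coordinates that rotate; \<open>inj\<close> and
  \<open>ncnj\<close> say that they contribute \<open>2 * card J\<close> different roots of
  \<open>f\<close>. The remaining coordinates are fixed by the flow at time \<open>t0\<close> and
  receive a scaled square lattice each, orthogonal to everything else.\<close>

lemma admits_lattice_if_roots:
  fixes f :: "int poly" and q :: nat and \<mu> :: "nat \<Rightarrow> real" and J :: "nat set" and t0 :: real
  defines "\<nu> \<equiv> \<lambda>j. cis (\<mu> j * t0)"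
  defines "S \<equiv> insert (of_real (exp t0)) (insert (of_real (exp (- t0))) (\<nu> ` J \<union> (\<lambda>j. cnj (\<nu> j)) ` J))"
  assumes \<mu>: "\<forall>j\<in>{1..q}. \<mu> j \<noteq> 0" and t0: "t0 > 0" and J: "J \<subseteq> {1..q}"
    and J': "\<And>j. j \<in> {1..q} - J \<Longrightarrow> \<nu> j = 1"
    and f: "map_poly of_int f = (\<Prod>\<rho>\<in>S. [:-\<rho>, 1:])"
    and inj: "inj_on \<nu> J" and ncnj: "\<And>i j. i \<in> J \<Longrightarrow> j \<in> J \<Longrightarrow> \<nu> i \<noteq> cnj (\<nu> j)"
  shows "osc_admits_lattice q \<mu>"
proof -
  define \<theta> where "\<theta> j = \<mu> j * t0" for j
  have \<nu>: "\<nu> j = cis (\<theta> j)" "cnj (\<nu> j) = cis (- \<theta> j)" "inverse (\<nu> j) = cis (- \<theta> j)" for j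
    by (simp_all add: \<nu>_def \<theta>_def cis_cnj cis_inverse)
  have finJ: "finite J" using J finite_subset by blast
  hence finS: "finite S" by (simp add: S_def)
  define r where "r = exp t0"
  have r: "r > 1" using t0 by (simp add: r_def)
  have rinv: "exp (- t0) = inverse r" by (simp add: r_def exp_minus)
  have cm1: "cmod (\<nu> j) = 1" for j by (simp add: \<nu>_def)
  have ir: "inverse r < 1" using r by (simp add: inverse_less_1_iff)
  have ir0: "inverse r > 0" using r by simp
  have nin: "of_real r \<notin> \<nu> ` J" "of_real r \<notin> (\<lambda>j. cnj (\<nu> j)) ` J"
    "of_real (inverse r) \<notin> \<nu> ` J" "of_real (inverse r) \<notin> (\<lambda>j. cnj (\<nu> j)) ` J"
  proof -
    have "cmod z = 1" if "z \<in> \<nu> ` J \<or> z \<in> (\<lambda>j. cnj (\<nu> j)) ` J" for z using that cm1 by auto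
    moreover have "cmod (of_real r) \<noteq> 1" "cmod (of_real (inverse r)) \<noteq> 1"
      unfolding norm_of_real using r ir ir0 by auto
    ultimately show "of_real r \<notin> \<nu> ` J" "of_real r \<notin> (\<lambda>j. cnj (\<nu> j)) ` J"
      "of_real (inverse r) \<notin> \<nu> ` J" "of_real (inverse r) \<notin> (\<lambda>j. cnj (\<nu> j)) ` J" by blast+
  qed
  have rneq: "complex_of_real r \<noteq> of_real (inverse r)" using r ir by (simp only: of_real_eq_iff)
  have S_eq: "S = insert (of_real r) (insert (of_real (inverse r)) (\<nu> ` J \<union> (\<lambda>j. cnj (\<nu> j)) ` J))"
    unfolding S_def rinv r_def ..
  have sumS: "(\<Sum>\<rho>\<in>S. g \<rho>) = g (of_real r) + (g (of_real (inverse r)) + ((\<Sum>j\<in>J. g (\<nu> j)) + (\<Sum>j\<in>J. g (cnj (\<nu> j)))))"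
    for g :: "complex \<Rightarrow> complex"
  proof -
    have "\<nu> ` J \<inter> (\<lambda>j. cnj (\<nu> j)) ` J = {}" using ncnj by auto
    hence "sum g (\<nu> ` J \<union> (\<lambda>j. cnj (\<nu> j)) ` J) = sum g (\<nu> ` J) + sum g ((\<lambda>j. cnj (\<nu> j)) ` J)"
      using finJ by (intro sum.union_disjoint) auto
    also have "sum g (\<nu> ` J) = (\<Sum>j\<in>J. g (\<nu> j))" using inj by (simp add: sum.reindex)
    also have "sum g ((\<lambda>j. cnj (\<nu> j)) ` J) = (\<Sum>j\<in>J. g (cnj (\<nu> j)))"
      using inj by (subst sum.reindex) (auto simp: inj_on_def)
    finally show ?thesis using nin rneq finJ unfolding S_eq by (subst sum.insert; simp)+
  qed
  have invS: "inverse ` S = S"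
  proof -
    have inv\<nu>: "inverse (\<nu> j) = cnj (\<nu> j)" "inverse (cnj (\<nu> j)) = \<nu> j" for j
      by (simp_all add: \<nu>_def cis_cnj cis_inverse)
    have "inverse ` \<nu> ` J = (\<lambda>j. cnj (\<nu> j)) ` J" "inverse ` (\<lambda>j. cnj (\<nu> j)) ` J = \<nu> ` J"
      unfolding image_image by (simp_all add: inv\<nu>)
    thus ?thesis unfolding S_eq image_insert image_Un by (auto simp: of_real_inverse)
  qed
  have nzS: "0 \<notin> S" using r by (auto simp: S_eq \<nu>_def)

  \<comment> \<open>These are the numbers \<rho> + 1/\<rho>. They have to be distinct for the signs
    of \<open>s\<close> to be independent; \<open>y0 > 2\<close> is away from the others.\<close>
  define y where "y j = 2 * cos (\<theta> j)" for j
  define y0 where "y0 = r + inverse r"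
  have y0: "y0 > 2" unfolding y0_def using r by (rule add_inverse_gt_2)
  have yy0: "y j \<noteq> y0" for j using y0 cos_le_one[of "\<theta> j"] unfolding y_def by linarith
  have injy: "inj_on y J"
  proof (rule inj_onI)
    fix i j assume ij: "i \<in> J" "j \<in> J" "y i = y j"
    have "cos (\<theta> i) = cos (\<theta> j)" using ij(3) by (simp add: y_def)
    moreover from this have "(sin (\<theta> i))\<^sup>2 = (sin (\<theta> j))\<^sup>2" by (simp add: sin_squared_eq)
    hence "sin (\<theta> i) = sin (\<theta> j) \<or> sin (\<theta> i) = - sin (\<theta> j)" by (simp add: power2_eq_iff)
    ultimately have "\<nu> i = \<nu> j \<or> \<nu> i = cnj (\<nu> j)" by (auto simp: \<nu> complex_eq_iff)
    thus "i = j" using ncnj[OF ij(1,2)] inj ij by (auto simp: inj_on_def)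
  qed
  have sin0: "sin (\<theta> j) \<noteq> 0" if "j \<in> J" for j
    using ncnj[OF that that] by (auto simp: \<nu> complex_eq_iff)
  \<comment> \<open>The trace form contributes \<open>4 * sv (y j) * sin (\<theta> j)\<close> at
    coordinate \<open>j\<close>, to be equal to \<open>\<mu> j * (\<kappa> j)\<^sup>2\<close> for a
    real \<open>\<kappa> j\<close>; so \<open>sv (y j)\<close> must have the sign of
    \<open>\<mu> j * sin (\<theta> j)\<close>.\<close>
  define \<sigma> where "\<sigma> x = (if x = y0 then 1 else let j = the_inv_into J y x in \<mu> j * sin (\<theta> j))" for x
  have \<sigma>j: "\<sigma> (y j) = \<mu> j * sin (\<theta> j)" if "j \<in> J" for j
    using that yy0[of j] by (simp add: \<sigma>_def the_inv_into_f_f[OF injy] Let_def)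
  have "\<sigma> x \<noteq> 0" if x: "x \<in> insert y0 (y ` J)" for x
  proof (cases "x = y0")
    case False
    then obtain j where "j \<in> J" "x = y j" using x by auto
    thus ?thesis using \<sigma>j[of j] sin0[of j] \<mu> J by auto
  qed (simp add: \<sigma>_def)
  then obtain s :: "int poly" where s: "\<And>x. x \<in> insert y0 (y ` J) \<Longrightarrow> poly (map_poly of_int s) x * \<sigma> x > 0"
    using int_poly_prescribed_signs[of "insert y0 (y ` J)" \<sigma>] finJ by blast
  define sv where "sv x = poly (map_poly of_int s) x" for x :: real
  have sv0: "sv y0 > 0" using s[of y0] by (simp add: sv_def \<sigma>_def)
  have svj: "sv (y j) * (\<mu> j * sin (\<theta> j)) > 0" if "j \<in> J" for j
    using s[of "y j"] \<sigma>j[OF that] that by (simp add: sv_def)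

  \<comment> \<open>Scaling of the contracted axis by which the hyperbolic part of the form
    reproduces the trace terms at \<open>r\<close> and \<open>inverse r\<close>.\<close>
  define \<beta> where "\<beta> = 2 * sv y0 * (r - inverse r)"
  have \<beta>: "\<beta> > 0" using sv0 r ir by (simp add: \<beta>_def)
  \<comment> \<open>Outside \<open>J\<close> the scaling gives the square lattice the values 0, 1
    and -1 of the form on its generators.\<close>
  define \<kappa> where "\<kappa> j = (if j \<in> J then sqrt (4 * sv (y j) * sin (\<theta> j) / \<mu> j) else 1 / sqrt \<bar>\<mu> j\<bar>)" for j
  have \<kappa>pos: "\<kappa> j > 0" if "j \<in> {1..q}" for j
  proof (cases "j \<in> J")
    case True
    have m: "\<mu> j \<noteq> 0" using that \<mu> by auto
    have "0 < 4 * (sv (y j) * (\<mu> j * sin (\<theta> j))) / (\<mu> j)\<^sup>2"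
      using svj[OF True] m by (intro divide_pos_pos) simp_all
    also have "\<dots> = 4 * sv (y j) * sin (\<theta> j) / \<mu> j" using m by (simp add: power2_eq_square)
    finally show ?thesis using True by (simp add: \<kappa>_def)
  qed (use that \<mu> in \<open>auto simp: \<kappa>_def\<close>)
  have \<kappa>J: "\<mu> j * (\<kappa> j)\<^sup>2 = 4 * sv (y j) * sin (\<theta> j)" if j: "j \<in> J" for j
  proof -
    have m: "\<mu> j \<noteq> 0" using J \<mu> j by auto
    have "\<kappa> j > 0" using \<kappa>pos J j by auto
    hence "4 * sv (y j) * sin (\<theta> j) / \<mu> j > 0" using j by (simp add: \<kappa>_def)
    hence "(\<kappa> j)\<^sup>2 = 4 * sv (y j) * sin (\<theta> j) / \<mu> j" using j by (simp add: \<kappa>_def)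
    thus ?thesis using m by simp
  qed
  have \<kappa>J': "\<bar>\<mu> j\<bar> * (\<kappa> j)\<^sup>2 = 1" if "j \<in> {1..q} - J" for j
    using that \<mu> by (simp add: \<kappa>_def power_divide)

  \<comment> \<open>The image of the monomial with exponent \<open>m\<close> under evaluation at the
    roots, rescaled by \<beta> and \<kappa>; the flow at time \<open>t0\<close> is multiplication by
    the variable.\<close>
  define b where "b m = (\<lambda>i. if i = 0
      then Complex ((exp (of_int m * t0) + \<beta> * exp (- (of_int m * t0))) / 2) ((exp (of_int m * t0) - \<beta> * exp (- (of_int m * t0))) / 2)
      else if i \<in> J then of_real (\<kappa> i) * cis (of_int m * \<theta> i) else 0)" for m :: int
  have b0: "cpos (b m) = exp (of_int m * t0)" "cneg (b m) = \<beta> * exp (- (of_int m * t0))" for m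
    by (simp_all add: b_def cpos_def cneg_def field_simps)
  have bJ: "b m i = (if i \<in> J then of_real (\<kappa> i) * cis (of_int m * \<theta> i) else 0)" if "i \<noteq> 0" for m i
    using that by (simp add: b_def)
  define G where "G = range b \<union> (\<lambda>j. unit_vector j (of_real (\<kappa> j))) ` ({1..q} - J)
      \<union> (\<lambda>j. unit_vector j (\<i> * of_real (\<kappa> j))) ` ({1..q} - J)"
  have Gcases: "g \<in> G \<Longrightarrow> (\<exists>m. g = b m) \<or> (\<exists>j\<in>{1..q} - J. \<exists>c\<in>{1, \<i>}. g = unit_vector j (c * of_real (\<kappa> j)))" for g
    unfolding G_def by force
  define A where "A = zspan G"
  have grp: "add_subgroup A" unfolding A_def by (rule add_subgroup_zspan)
  have GA: "g \<in> A" if "g \<in> G" for g using that by (simp add: A_def zspan_superset)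

  have form_bb: "osc_form q \<mu> (b m) (b k) \<in> \<int>" for m k
  proof -
    define h where "h = k - m"
    define H where "H = of_int h * t0"
    \<comment> \<open>The trace of \<delta>(\<rho>) \<rho>^h, summed over the two real roots and the
      conjugate pairs; the pairs give a negative sign as a product of two factors
      \<open>2 * \<i>\<close>.\<close>
    define V where "V = sv y0 * (r - inverse r) * (exp H - exp (- H)) - (\<Sum>j\<in>J. 4 * sv (y j) * sin (\<theta> j) * sin (of_int h * \<theta> j))"
    have "(cpos (b m) * cneg (b k) - cneg (b m) * cpos (b k)) / 2 = - (\<beta> / 2) * (exp H - exp (- H))"
    proof -
      have "exp (of_int m * t0) * exp (- (of_int k * t0)) = exp (- H)"
        "exp (- (of_int m * t0)) * exp (of_int k * t0) = exp H"
        by (simp_all add: H_def h_def algebra_simps flip: exp_add)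
      thus ?thesis unfolding b0 by (simp add: algebra_simps diff_divide_distrib)
    qed
    moreover have "(\<Sum>j\<in>{1..q}. \<mu> j * Im (cnj (b m j) * b k j)) = (\<Sum>j\<in>J. 4 * sv (y j) * sin (\<theta> j) * sin (of_int h * \<theta> j))"
    proof (rule sum.mono_neutral_cong_right[OF _ J])
      show "\<forall>j\<in>{1..q} - J. \<mu> j * Im (cnj (b m j) * b k j) = 0" by (auto simp: bJ)
      fix j assume j: "j \<in> J"
      hence "j \<noteq> 0" using J by auto
      hence "cnj (b m j) * b k j = of_real ((\<kappa> j)\<^sup>2) * (cis (- (of_int m * \<theta> j)) * cis (of_int k * \<theta> j))"
        using j by (simp add: bJ cis_cnj power2_eq_square)
      also have "cis (- (of_int m * \<theta> j)) * cis (of_int k * \<theta> j) = cis (of_int h * \<theta> j)"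
        by (simp add: cis_mult h_def algebra_simps)
      finally have "Im (cnj (b m j) * b k j) = (\<kappa> j)\<^sup>2 * sin (of_int h * \<theta> j)" by simp
      thus "\<mu> j * Im (cnj (b m j) * b k j) = 4 * sv (y j) * sin (\<theta> j) * sin (of_int h * \<theta> j)"
        using \<kappa>J[OF j] by (simp add: mult.assoc[symmetric])
    qed simp
    ultimately have form: "osc_form q \<mu> (b m) (b k) = - V"
      by (simp add: osc_form_def V_def \<beta>_def)
    \<comment> \<open>The factor \<open>\<rho> - inverse \<rho>\<close> of \<delta> shifts the
      exponent, so \<open>V\<close> is a difference of two twisted power sums and therefore
      integral.\<close>
    let ?T = "\<lambda>h. \<Sum>\<rho>\<in>S. poly (map_poly of_int s) (\<rho> + inverse \<rho>) * \<rho> powi h"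
    have "?T (h + 1) - ?T (h - 1) = (\<Sum>\<rho>\<in>S. poly (map_poly of_int s) (\<rho> + inverse \<rho>) * ((\<rho> - inverse \<rho>) * \<rho> powi h))"
      unfolding sum_subtractf[symmetric]
    proof (rule sum.cong[OF refl])
      fix \<rho> assume "\<rho> \<in> S"
      hence "\<rho> \<noteq> 0" using nzS by auto
      hence "\<rho> powi (h + 1) = \<rho> * \<rho> powi h" "\<rho> powi (h - 1) = inverse \<rho> * \<rho> powi h"
        by (simp_all add: power_int_add power_int_diff field_simps)
      thus "poly (map_poly of_int s) (\<rho> + inverse \<rho>) * \<rho> powi (h + 1) - poly (map_poly of_int s) (\<rho> + inverse \<rho>) * \<rho> powi (h - 1)
        = poly (map_poly of_int s) (\<rho> + inverse \<rho>) * ((\<rho> - inverse \<rho>) * \<rho> powi h)"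
        by (simp add: algebra_simps)
    qed
    also have "\<dots> = of_real V"
    proof -
      let ?P = "\<lambda>x :: complex. poly (map_poly of_int s) x"
      have pw: "complex_of_real r powi h = of_real (exp H)" "complex_of_real (inverse r) powi h = of_real (exp (- H))"
        unfolding of_real_power_int[symmetric] r_def H_def exp_minus[symmetric]
        by (simp_all add: exp_power_int)
      have cpw: "cis x powi h = cis (of_int h * x)" for x
        by (simp add: cis_conv_exp exp_power_int mult_ac)
      have P: "?P (of_real x) = of_real (sv x)" for x by (simp add: poly_of_int_of_real sv_def)
      have yr: "complex_of_real r + inverse (of_real r) = of_real y0"
        "complex_of_real (inverse r) + inverse (of_real (inverse r)) = of_real y0" by (simp_all add: y0_def)
      have t1: "?P (of_real r + inverse (of_real r)) * ((of_real r - inverse (of_real r)) * of_real r powi h)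
          = of_real (sv y0 * (r - inverse r) * exp H)"
        unfolding yr P pw by simp
      have t2: "?P (of_real (inverse r) + inverse (of_real (inverse r))) *
          ((of_real (inverse r) - inverse (of_real (inverse r))) * of_real (inverse r) powi h)
          = of_real (sv y0 * (inverse r - r) * exp (- H))"
        unfolding yr P pw by simp
      have yj: "cis (\<theta> j) + cis (- \<theta> j) = of_real (y j)" "cis (- \<theta> j) + cis (\<theta> j) = of_real (y j)" for j
        by (simp_all add: y_def complex_eq_iff)
      have t3: "?P (\<nu> j + inverse (\<nu> j)) * ((\<nu> j - inverse (\<nu> j)) * \<nu> j powi h)
          + ?P (cnj (\<nu> j) + inverse (cnj (\<nu> j))) * ((cnj (\<nu> j) - inverse (cnj (\<nu> j))) * cnj (\<nu> j) powi h)
          = of_real (- (4 * sv (y j) * sin (\<theta> j) * sin (of_int h * \<theta> j)))" for j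
        unfolding \<nu>(2) unfolding \<nu>(1) cis_inverse minus_minus yj P cpw by (simp add: complex_eq_iff)
      have "(\<Sum>j\<in>J. ?P (\<nu> j + inverse (\<nu> j)) * ((\<nu> j - inverse (\<nu> j)) * \<nu> j powi h))
          + (\<Sum>j\<in>J. ?P (cnj (\<nu> j) + inverse (cnj (\<nu> j))) * ((cnj (\<nu> j) - inverse (cnj (\<nu> j))) * cnj (\<nu> j) powi h))
          = of_real (- (\<Sum>j\<in>J. 4 * sv (y j) * sin (\<theta> j) * sin (of_int h * \<theta> j)))"
        unfolding sum.distrib[symmetric] t3 by (simp add: sum_negf)
      thus ?thesis unfolding sumS t1 t2 V_def by (simp only: of_real_add[symmetric] of_real_eq_iff) (simp add: algebra_simps)
    qed
    finally have "complex_of_real V = ?T (h + 1) - ?T (h - 1)" ..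
    hence "complex_of_real V \<in> \<int>"
      using twisted_power_sum_roots_int[OF finS f invS nzS] by (simp add: Ints_diff)
    hence "V \<in> \<int>" by (metis Ints_cases Ints_of_int of_real_eq_iff of_real_of_int_eq)
    thus ?thesis by (simp add: form)
  qed

  have form_GG: "osc_form q \<mu> g g' \<in> \<int>" if g: "g \<in> G" and g': "g' \<in> G" for g g'
  proof -
    have be: "osc_form q \<mu> (b m) (unit_vector j c) = 0" if "j \<in> {1..q} - J" for m j c
      using that by (subst osc_form_unit_vector_right) (auto simp: bJ)
    have ee: "osc_form q \<mu> (unit_vector j (c * of_real (\<kappa> j))) (unit_vector k (c' * of_real (\<kappa> k))) \<in> \<int>"
      if j: "j \<in> {1..q} - J" and k: "k \<in> {1..q} - J" and c: "c \<in> {1, \<i>}" "c' \<in> {1, \<i>}" for j k c c'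
    proof (cases "j = k")
      case True
      have "osc_form q \<mu> (unit_vector j (c * of_real (\<kappa> j))) (unit_vector k (c' * of_real (\<kappa> k)))
          = \<mu> j * Im (of_real ((\<kappa> j)\<^sup>2) * (cnj c * c'))"
        using k True by (subst osc_form_unit_vector_right) (auto simp: unit_vector_apply power2_eq_square mult_ac)
      also have "\<dots> = sgn (\<mu> j) * (\<bar>\<mu> j\<bar> * (\<kappa> j)\<^sup>2) * Im (cnj c * c')"
      proof -
        have "\<mu> j = sgn (\<mu> j) * \<bar>\<mu> j\<bar>" by (simp add: sgn_mult_abs)
        moreover have "Im (complex_of_real ((\<kappa> j)\<^sup>2) * (cnj c * c')) = (\<kappa> j)\<^sup>2 * Im (cnj c * c')"
          by (simp only: times_complex.sel Re_complex_of_real Im_complex_of_real mult_zero_left add_0_right add_0_left)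
        ultimately show ?thesis by (metis mult.assoc)
      qed
      also have "\<dots> = sgn (\<mu> j) * Im (cnj c * c')" using \<kappa>J'[OF j] by simp
      also have "\<dots> \<in> \<int>" using c by (auto simp: sgn_real_def)
      finally show ?thesis .
    next
      case False
      thus ?thesis using k by (subst osc_form_unit_vector_right) (auto simp: unit_vector_apply)
    qed
    from Gcases[OF g] Gcases[OF g'] show ?thesis
    proof (elim disjE exE bexE)
      fix m m' assume "g = b m" "g' = b m'"
      thus ?thesis using form_bb by simp
    next
      fix m j c assume "g = b m" "j \<in> {1..q} - J" "g' = unit_vector j (c * of_real (\<kappa> j))"
      thus ?thesis using be by simp
    next
      fix m j c assume "g' = b m" "j \<in> {1..q} - J" "g = unit_vector j (c * of_real (\<kappa> j))"
      thus ?thesis using be by (subst osc_form_anti) simp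
    next
      fix j c k c' assume "j \<in> {1..q} - J" "c \<in> {1, \<i>}" "g = unit_vector j (c * of_real (\<kappa> j))"
        "k \<in> {1..q} - J" "c' \<in> {1, \<i>}" "g' = unit_vector k (c' * of_real (\<kappa> k))"
      thus ?thesis using ee by blast
    qed
  qed
  have form_GA: "osc_form q \<mu> g a \<in> \<int>" if g: "g \<in> G" and a: "a \<in> A" for g a
  proof -
    have "a \<in> {x. osc_form q \<mu> g x \<in> \<int>}"
    proof (rule zspan_least[OF _ _ a[unfolded A_def]])
      show "add_subgroup {x. osc_form q \<mu> g x \<in> \<int>}"
        by (auto simp: add_subgroup_def osc_form_bilin)
    qed (use form_GG[OF g] in blast)
    thus ?thesis by simp
  qed
  have form_AA: "osc_form q \<mu> x a \<in> \<int>" if x: "x \<in> A" and a: "a \<in> A" for x a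
  proof -
    have "x \<in> {x. osc_form q \<mu> x a \<in> \<int>}"
    proof (rule zspan_least[OF _ _ x[unfolded A_def]])
      show "add_subgroup {x. osc_form q \<mu> x a \<in> \<int>}"
        by (auto simp: add_subgroup_def osc_form_bilin)
    qed (use form_GA[OF _ a] in blast)
    thus ?thesis by simp
  qed
  have flow_b: "flow \<mu> (of_int h * t0) (b m) = b (m + h)" for h m
  proof (rule eq_if_coords)
    fix i :: nat assume i: "i \<noteq> 0"
    have "cis (\<mu> i * (of_int h * t0)) * cis (of_int m * \<theta> i) = cis (of_int (m + h) * \<theta> i)"
      by (simp add: cis_mult \<theta>_def algebra_simps)
    thus "flow \<mu> (of_int h * t0) (b m) i = b (m + h) i" using i by (simp add: bJ mult_ac)
  qed (simp_all add: b0 algebra_simps flip: exp_add)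
  have flow_e: "flow \<mu> (of_int h * t0) (unit_vector j c) = unit_vector j c" if j: "j \<in> {1..q} - J" for h j c
  proof (rule eq_if_coords)
    fix i :: nat assume i: "i \<noteq> 0"
    have "cis (\<mu> j * (of_int h * t0)) = \<nu> j powi h"
      unfolding \<nu>_def by (simp add: cis_conv_exp exp_power_int mult_ac)
    thus "flow \<mu> (of_int h * t0) (unit_vector j c) i = unit_vector j c i"
      using i J'[OF j] by (simp add: unit_vector_apply)
  qed (use j in simp_all)
  have flow_A: "flow \<mu> (of_int h * t0) a \<in> A" if a: "a \<in> A" for a h
  proof -
    have "a \<in> {x. flow \<mu> (of_int h * t0) x \<in> A}"
    proof (rule zspan_least[OF _ _ a[unfolded A_def]])
      show "add_subgroup {x. flow \<mu> (of_int h * t0) x \<in> A}"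
        using add_subgroup_zero[OF grp] by (auto simp: add_subgroup_def add_subgroup_diff[OF grp])
      show "G \<subseteq> {x. flow \<mu> (of_int h * t0) x \<in> A}"
      proof
        fix g assume g: "g \<in> G"
        show "g \<in> {x. flow \<mu> (of_int h * t0) x \<in> A}"
          using Gcases[OF g]
        proof (elim disjE exE bexE)
          fix m assume "g = b m"
          thus ?thesis using GA[of "b (m + h)"] by (simp add: flow_b G_def)
        next
          fix j c assume "j \<in> {1..q} - J" "g = unit_vector j (c * of_real (\<kappa> j))"
          thus ?thesis using GA[OF g] flow_e by simp
        qed
      qed
    qed
    thus ?thesis by simp
  qed
  have sub: "A \<subseteq> osc_space q"
  proof
    fix a assume a: "a \<in> A"
    show "a \<in> osc_space q"
    proof (rule zspan_least[OF _ _ a[unfolded A_def]])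
      show "add_subgroup (osc_space q)" by (simp add: add_subgroup_def)
      show "G \<subseteq> osc_space q" using J by (auto simp: G_def osc_space_def bJ unit_vector_apply)
    qed
  qed
  define d where "d = card S"
  define K where "K = {1..q} - J"
  have spanning: "\<exists>c1 c2 c3. a = (\<Sum>i<d. rscale (c1 i) (b (int i))) + (\<Sum>j\<in>K. rscale (c2 j) (unit_vector j (of_real (\<kappa> j))))
      + (\<Sum>j\<in>K. rscale (c3 j) (unit_vector j (\<i> * of_real (\<kappa> j))))" if a: "a \<in> osc_space q" for a
  proof -
    define h where "h j = a j / of_real (\<kappa> j)" for j
    \<comment> \<open>The values that a polynomial must take at the roots in order to represent
      \<open>a\<close>. They are compatible with conjugation, hence the real parts of the
      coefficients of the complex interpolant \<open>C\<close> already suffice; this is what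
      \<open>key\<close> expresses.\<close>
    define g where "g x = (if x = of_real r then of_real (cpos a) else if x = of_real (inverse r) then of_real (cneg a / \<beta>)
      else if x \<in> \<nu> ` J then h (the_inv_into J \<nu> x) else cnj (h (the_inv_into J \<nu> (cnj x))))" for x
    obtain C where C: "\<And>x. x \<in> S \<Longrightarrow> poly C x = g x" "\<And>i. i \<ge> d \<Longrightarrow> coeff C i = 0"
      using polynomial_interpolation[OF finS, of g] unfolding d_def by blast
    define c1 where "c1 i = Re (coeff C i)" for i
    have key: "(\<Sum>i<d. of_real (c1 i) * x ^ i) = (g x + cnj (g (cnj x))) / 2" if x: "x \<in> S" "cnj x \<in> S" for x
    proof -
      have "g x + cnj (g (cnj x)) = (\<Sum>i<d. coeff C i * x ^ i) + (\<Sum>i<d. cnj (coeff C i) * x ^ i)"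
        using C(1)[OF x(1), symmetric] C(1)[OF x(2), symmetric]
        by (simp add: poly_eq_sum_lessThan[OF C(2)])
      also have "\<dots> = (\<Sum>i<d. (coeff C i + cnj (coeff C i)) * x ^ i)"
        by (simp add: distrib_right sum.distrib)
      also have "\<dots> = 2 * (\<Sum>i<d. of_real (c1 i) * x ^ i)"
        by (simp add: complex_add_cnj c1_def sum_distrib_left mult_ac)
      finally show ?thesis by simp
    qed
    have kreal: "(\<Sum>i<d. c1 i * x ^ i) = z" if "of_real x \<in> S" "g (of_real x) = of_real z" for x z
    proof -
      have "complex_of_real (\<Sum>i<d. c1 i * x ^ i) = of_real z"
        using key[of "of_real x"] that by simp
      thus ?thesis by (simp only: of_real_eq_iff)
    qed
    have k1: "(\<Sum>i<d. c1 i * r ^ i) = cpos a" by (rule kreal) (simp_all add: S_eq g_def)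
    have k2: "(\<Sum>i<d. c1 i * inverse r ^ i) = cneg a / \<beta>"
      by (rule kreal) (use rneq in \<open>simp_all add: S_eq g_def del: of_real_inverse\<close>)
    have k3: "(\<Sum>i<d. of_real (c1 i) * \<nu> j ^ i) = a j / of_real (\<kappa> j)" if j: "j \<in> J" for j
    proof -
      have nj: "\<nu> j \<noteq> of_real r" "\<nu> j \<noteq> of_real (inverse r)"
        "cnj (\<nu> j) \<noteq> of_real r" "cnj (\<nu> j) \<noteq> of_real (inverse r)"
        using nin imageI[OF j, of \<nu>] imageI[OF j, of "\<lambda>j. cnj (\<nu> j)"] by metis+
      have "g (\<nu> j) = h j"
        using j nj by (simp add: g_def the_inv_into_f_f[OF inj] del: of_real_inverse)
      moreover have "cnj (\<nu> j) \<notin> \<nu> ` J" using j ncnj by force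
      hence "g (cnj (\<nu> j)) = cnj (h j)" 
        using j nj by (simp add: g_def the_inv_into_f_f[OF inj] del: of_real_inverse)
      moreover have "\<nu> j \<in> S" "cnj (\<nu> j) \<in> S" using j by (auto simp: S_eq)
      ultimately show ?thesis using key[of "\<nu> j"] by (simp add: h_def)
    qed
    let ?v = "(\<Sum>i<d. rscale (c1 i) (b (int i))) + (\<Sum>j\<in>K. rscale (Re (a j) / \<kappa> j) (unit_vector j (of_real (\<kappa> j))))
      + (\<Sum>j\<in>K. rscale (Im (a j) / \<kappa> j) (unit_vector j (\<i> * of_real (\<kappa> j))))"
    have K0: "j \<noteq> 0" if "j \<in> K" for j using that by (auto simp: K_def)
    have pw: "exp (real i * t0) = r ^ i" "exp (- (real i * t0)) = inverse r ^ i" for i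
      by (simp_all add: r_def exp_of_nat_mult exp_minus power_inverse)
    have v3: "a j = ?v j" if j: "j \<noteq> 0" for j
    proof -
      have finK: "finite K" by (simp add: K_def)
      have e2: "(\<Sum>k\<in>K. rscale (c k) (unit_vector k (w k))) j = (if j \<in> K then of_real (c j) * w j else 0)" for c w
      proof -
        have "(\<Sum>k\<in>K. rscale (c k) (unit_vector k (w k))) j = (\<Sum>k\<in>K. if k = j then of_real (c j) * w j else 0)"
          unfolding sum_fun_apply by (rule sum.cong) (auto simp: unit_vector_apply)
        thus ?thesis using finK by simp
      qed
      have e1: "(\<Sum>i<d. rscale (c1 i) (b (int i))) j = (if j \<in> J then a j else 0)"
      proof (cases "j \<in> J")
        case True
        have "(\<Sum>i<d. rscale (c1 i) (b (int i))) j = of_real (\<kappa> j) * (\<Sum>i<d. of_real (c1 i) * \<nu> j ^ i)"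

        proof -
          have "cis (of_int (int i) * \<theta> j) = \<nu> j ^ i" for i 

            by (simp only: \<nu>(1) of_int_of_nat_eq Complex.DeMoivre)
          thus ?thesis using True j by (simp add: sum_fun_apply bJ sum_distrib_left mult.left_commute)
        qed
        also have "\<dots> = a j" using k3[OF True] \<kappa>pos[of j] True J by auto
        finally show ?thesis using True by simp
      qed (simp add: sum_fun_apply bJ j)
      have "?v j = (if j \<in> J then a j else 0)
          + (if j \<in> K then of_real (Re (a j) / \<kappa> j) * of_real (\<kappa> j) else 0)
          + (if j \<in> K then of_real (Im (a j) / \<kappa> j) * (\<i> * of_real (\<kappa> j)) else 0)"
        by (simp only: plus_fun_apply e1 e2)
      moreover have "of_real (Re (a j) / \<kappa> j) * of_real (\<kappa> j) + of_real (Im (a j) / \<kappa> j) * (\<i> * of_real (\<kappa> j)) = a j" if "j \<in> K"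
        using \<kappa>pos[of j] that by (simp add: K_def complex_eq_iff)
      moreover have "a j = 0" if "j \<notin> J" "j \<notin> K" using that a j by (auto simp: K_def osc_space_def)
      moreover have "j \<notin> K" if "j \<in> J" using that by (simp add: K_def)
      ultimately show ?thesis by (cases "j \<in> J"; cases "j \<in> K") simp_all
    qed
    have v1: "cpos a = cpos ?v"
      using K0 k1 by (simp add: cpos_sum b0 pw)
    have v2: "cneg a = cneg ?v"
    proof -
      have "cneg ?v = (\<Sum>i<d. c1 i * (\<beta> * inverse r ^ i))"
        using K0 by (simp add: cneg_sum b0 pw del: power_inverse)
      also have "\<dots> = \<beta> * (\<Sum>i<d. c1 i * inverse r ^ i)"
        by (simp add: sum_distrib_left mult.left_commute)
      finally show ?thesis using k2 \<beta> by simp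
    qed
    have "a = ?v" by (rule eq_if_coords[OF v1 v2 v3])
    thus ?thesis
      by (rule exI[of _ c1, OF exI[of _ "\<lambda>j. Re (a j) / \<kappa> j", OF exI[of _ "\<lambda>j. Im (a j) / \<kappa> j"]]])
  qed
  have finK: "finite K" by (simp add: K_def)
  define M where "M = (\<Sum>i<d. anorm q (b (int i))) + (\<Sum>j\<in>K. anorm q (unit_vector j (of_real (\<kappa> j))))
    + (\<Sum>j\<in>K. anorm q (unit_vector j (\<i> * of_real (\<kappa> j))))"
  have "relatively_dense q A"
    unfolding relatively_dense_def
  proof (intro exI[of _ M] ballI)
    fix a assume "a \<in> osc_space q"
    from spanning[OF this] obtain c1 c2 c3 where c: "a = (\<Sum>i<d. rscale (c1 i) (b (int i)))
      + (\<Sum>j\<in>K. rscale (c2 j) (unit_vector j (of_real (\<kappa> j))))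
      + (\<Sum>j\<in>K. rscale (c3 j) (unit_vector j (\<i> * of_real (\<kappa> j))))" (is "_ = ?x1 + ?x2 + ?x3") by blast
    obtain a1 where a1: "a1 \<in> A" "anorm q (?x1 - a1) \<le> (\<Sum>i<d. anorm q (b (int i)))"
      using bounded_remainder_int_combination[OF grp, of "{..<d}" "\<lambda>i. b (int i)" q c1] GA by (auto simp: G_def)
    obtain a2 where a2: "a2 \<in> A" "anorm q (?x2 - a2) \<le> (\<Sum>j\<in>K. anorm q (unit_vector j (of_real (\<kappa> j))))"
      using bounded_remainder_int_combination[OF grp finK, of "\<lambda>j. unit_vector j (of_real (\<kappa> j))" q c2] GA
      by (auto simp: G_def K_def)
    obtain a3 where a3: "a3 \<in> A" "anorm q (?x3 - a3) \<le> (\<Sum>j\<in>K. anorm q (unit_vector j (\<i> * of_real (\<kappa> j))))"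
      using bounded_remainder_int_combination[OF grp finK, of "\<lambda>j. unit_vector j (\<i> * of_real (\<kappa> j))" q c3] GA
      by (auto simp: G_def K_def)
    have e: "a - (a1 + a2 + a3) = (?x1 - a1) + (?x2 - a2) + (?x3 - a3)" unfolding c by (simp only: algebra_simps)
    have "anorm q (a - (a1 + a2 + a3)) \<le> M"
      unfolding e M_def using anorm_triangle[of q "(?x1 - a1) + (?x2 - a2)" "?x3 - a3"]
        anorm_triangle[of q "?x1 - a1" "?x2 - a2"] a1(2) a2(2) a3(2) by linarith
    moreover have "a1 + a2 + a3 \<in> A" using a1(1) a2(1) a3(1) by (intro add_subgroup_add[OF grp])
    ultimately show "\<exists>b\<in>A. anorm q (a - b) \<le> M" by blast
  qed
  from admits_lattice_if_invariant_lattice[OF \<mu> t0 sub grp this] show ?thesis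
    using flow_A[of _ 1] flow_A[of _ "-1"] form_AA by simp
qed

section \<open>Integer polynomials and their roots\<close>

abbreviation cpoly :: "int poly \<Rightarrow> complex poly" where
  "cpoly f \<equiv> map_poly of_int f"

text \<open>\<open>f\<close> is prime, and its positive degree keeps it from dividing a nonzero
  constant.\<close>

lemma irreducible_dvd_smultD:
  fixes f p :: "int poly"
  assumes f: "irreducible f" "degree f > 0" and a: "a \<noteq> 0" and dvd: "f dvd Polynomial.smult a p"
  shows "f dvd p"
proof -
  have pf: "prime_elem f" using f(1) by (simp add: prime_elem_iff_irreducible)
  have "f dvd [:a:] * p" using dvd by simp
  hence "f dvd [:a:] \<or> f dvd p" using pf by (intro prime_elem_dvd_multD)
  moreover have "\<not> f dvd [:a:]"
  proof
    assume "f dvd [:a:]"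
    hence "degree f \<le> degree [:a:]" using a by (intro dvd_imp_degree_le) auto
    thus False using f(2) by simp
  qed
  ultimately show ?thesis by blast
qed

text \<open>Gauss' lemma is circumvented by pseudo-division by an integer polynomial $h$ of minimal degree
  with root $z$.\<close>

lemma irreducible_dvd_if_common_root:
  fixes f g :: "int poly"
  assumes f: "irreducible f" "degree f > 0" and z: "poly (cpoly f) z = 0" "poly (cpoly g) z = 0"
  shows "f dvd g"
proof -
  define P where "P h \<longleftrightarrow> h \<noteq> 0 \<and> poly (cpoly h) z = 0" for h
  have "P f" using f z by (auto simp: P_def)
  then obtain h where h: "P h" "\<And>h'. P h' \<Longrightarrow> degree h \<le> degree h'"
    using ex_has_least_nat[of P f degree] by blast
  have div: "\<exists>a q. a \<noteq> 0 \<and> Polynomial.smult a p = h * q" if p: "poly (cpoly p) z = 0" for p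
  proof -
    obtain a q where aq: "a \<noteq> 0" "Polynomial.smult a p = h * q + pseudo_mod p h"
      using pseudo_mod(1)[of h p] h(1) by (auto simp: P_def)
    have "poly (cpoly (Polynomial.smult a p)) z = 0" using p by (simp add: of_int_hom.map_poly_hom_smult)
    hence "poly (cpoly (pseudo_mod p h)) z = 0"
      unfolding aq(2) using h(1) by (simp add: P_def of_int_poly_hom.hom_add of_int_poly_hom.hom_mult)
    moreover have "pseudo_mod p h = 0 \<or> degree (pseudo_mod p h) < degree h"
      using pseudo_mod(2)[of h p] h(1) by (auto simp: P_def)
    ultimately have "pseudo_mod p h = 0" by (metis P_def h(2) not_le)
    thus ?thesis using aq by auto
  qed
  have pf: "prime_elem f" using f(1) by (simp add: prime_elem_iff_irreducible)
  have degh: "degree h > 0"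
  proof (rule ccontr)
    assume "\<not> degree h > 0"
    then obtain c where "h = [:c:]" by (auto elim: degree_eq_zeroE)
    thus False using h(1) by (auto simp: P_def of_int_hom.map_poly_pCons_hom)
  qed
  have "f dvd h"
  proof -
    obtain a q where aq: "a \<noteq> 0" "Polynomial.smult a f = h * q" using div[OF z(1)] by blast
    hence "f dvd h * q" by (metis dvd_refl dvd_smult)
    hence "f dvd h \<or> f dvd q" using pf by (simp add: prime_elem_dvd_mult_iff)
    moreover have False if fq: "f dvd q"
    proof -
      obtain q' where "q = f * q'" using fq by (elim dvdE)
      hence "f * [:a:] = f * (h * q')" using aq(2) by (simp add: mult_ac)
      hence "[:a:] = h * q'" using f(2) by (metis degree_0 less_irrefl mult_cancel_left)
      hence "degree [:a:] = degree h + degree q'" using aq(1) by (metis degree_mult_eq mult_eq_0_iff pCons_eq_0_iff)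
      thus False using degh by simp
    qed
    ultimately show ?thesis by blast
  qed
  moreover obtain a q where aq: "a \<noteq> 0" "Polynomial.smult a g = h * q" using div[OF z(2)] by blast
  ultimately have "f dvd Polynomial.smult a g" by simp
  thus ?thesis using irreducible_dvd_smultD[OF f aq(1)] by blast
qed

text \<open>A multiple root is shared with the derivative, which \<open>f\<close> would then divide
  in spite of its smaller degree.\<close>

lemma irreducible_rsquarefree:
  assumes f: "irreducible f" "degree f > 0"
  shows "rsquarefree (cpoly f)"
  unfolding rsquarefree_roots
proof (intro allI notI)
  fix z assume z: "poly (cpoly f) z = 0 \<and> poly (pderiv (cpoly f)) z = 0"
  have "poly (cpoly (pderiv f)) z = 0" using z by (simp add: of_int_hom.map_poly_pderiv)
  hence "f dvd pderiv f" using irreducible_dvd_if_common_root[OF f] z by blast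
  moreover have "pderiv f \<noteq> 0" using f(2) by (simp add: pderiv_eq_0_iff)
  ultimately have "degree f \<le> degree (pderiv f)" by (rule dvd_imp_degree_le)
  thus False using f(2) by (simp add: degree_pderiv)
qed

text \<open>The conjugate of \<open>z\<close> is both a root and the inverse of \<open>z\<close>. So
  \<open>z\<close> is a common root of \<open>f\<close> and its reflection, \<open>f\<close> divides
  the latter, and the roots of \<open>f\<close> are closed under inversion.\<close>

lemma root_inverse_if_unit_root:
  assumes f: "irreducible f" "degree f > 0" and z: "poly (cpoly f) z = 0" "cmod z = 1"
    and r: "poly (cpoly f) r = 0" "r \<noteq> 0"
  shows "poly (cpoly f) (inverse r) = 0"
proof -
  have refl: "cpoly (reflect_poly f) = reflect_poly (cpoly f)"
    by (rule poly_eqI) (simp add: coeff_reflect_poly)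
  have z0: "z \<noteq> 0" using z by auto
  have "cnj (poly (cpoly f) z) = poly (cpoly f) (cnj z)"
    by (simp add: poly_altdef)
  moreover have "cnj z = inverse z"
    using z(2) complex_norm_square[of z] z0 by (simp add: field_simps)
  ultimately have "poly (cpoly f) (inverse z) = 0" using z by simp
  hence "poly (cpoly (reflect_poly f)) z = 0"
    unfolding refl using z0 by (simp add: poly_reflect_poly_nz)
  hence "f dvd reflect_poly f" using irreducible_dvd_if_common_root[OF f z(1)] by blast
  then obtain g where "reflect_poly f = f * g" by (elim dvdE)
  hence "poly (cpoly (reflect_poly f)) r = 0" using r(1) by (simp add: of_int_poly_hom.hom_mult)
  thus ?thesis unfolding refl using r(2) by (simp add: poly_reflect_poly_nz)
qed

lemma cpoly_eq_prod_roots: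
  assumes "rsquarefree (cpoly f)" "lead_coeff f = 1"
  shows "cpoly f = (\<Prod>z\<in>{z. poly (cpoly f) z = 0}. [:-z, 1:])"
  using complex_poly_decompose_rsquarefree[OF assms(1)] assms(2) by simp

lemma proots_eq_mset_set:
  assumes "rsquarefree p" "p \<noteq> 0"
  shows "proots p = mset_set {z. poly p z = 0}"
proof (rule multiset_eqI)
  fix z
  have "finite {z. poly p z = 0}" using assms(2) by (rule poly_roots_finite)
  thus "count (proots p) z = count (mset_set {z. poly p z = 0}) z"
    using rsquarefree_root_order[OF assms(1) _ assms(2), of z] assms(2)
    by (cases "poly p z = 0") (auto simp: order_0I)
qed

lemma root_cpoly_of_real:
  "poly (map_poly of_int f) x = 0 \<Longrightarrow> poly (cpoly f) (complex_of_real x) = 0"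
  by (simp add: poly_of_int_of_real)

section \<open>From roots to lattices\<close>

lemma unit_conj_pair_mset:
  fixes \<mu> :: "nat \<Rightarrow> real" and t0 :: real
  shows "image_mset (\<lambda>j. exp (\<i> * complex_of_real (\<mu> j * t0))) M = image_mset (\<lambda>j. cis (\<mu> j * t0)) M"
    "image_mset (\<lambda>j. exp (- \<i> * complex_of_real (\<mu> j * t0))) M = image_mset (\<lambda>j. cnj (cis (\<mu> j * t0))) M"
  by (simp_all add: cis_conv_exp exp_cnj)

lemma cpoly_quadratic:
  fixes r :: real
  assumes r: "r > 1" and root: "poly (map_poly of_int [:1, - a, 1:]) r = 0"
  shows "cpoly [:1, - a, 1:] = [:- of_real r, 1:] * [:- of_real (inverse r), 1:]"
proof -
  have "r * (r + inverse r - of_int a) = 0"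
    using r root by (simp add: of_int_hom.map_poly_pCons_hom algebra_simps)
  hence "real_of_int a = r + inverse r" using r by simp
  hence "complex_of_int a = of_real (r + inverse r)" by (metis of_real_of_int_eq)
  thus ?thesis using r by (simp add: of_int_hom.map_poly_pCons_hom)
qed

text \<open>Serves to strip the padding by ones in \<open>in_M\<close>: the two members of a
  conjugate pair equal 1 simultaneously.\<close>

lemma filter_conj_pairs:
  fixes \<nu> :: "nat \<Rightarrow> complex"
  assumes "finite I"
  shows "filter_mset (\<lambda>z. z \<noteq> 1) (image_mset \<nu> (mset_set I) + image_mset (\<lambda>j. cnj (\<nu> j)) (mset_set I))
    = image_mset \<nu> (mset_set {j \<in> I. \<nu> j \<noteq> 1}) + image_mset (\<lambda>j. cnj (\<nu> j)) (mset_set {j \<in> I. \<nu> j \<noteq> 1})"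
proof -
  have c: "cnj (\<nu> j) = 1 \<longleftrightarrow> \<nu> j = 1" for j by (metis complex_cnj_cnj complex_cnj_one)
  show ?thesis
    by (simp only: filter_union_mset filter_mset_image_mset c filter_mset_mset_set[OF assms])
qed

lemma filter_mset_set_replicate:
  assumes "finite U" "x \<notin> U"
  shows "filter_mset (\<lambda>z. z \<noteq> x) (mset_set U + replicate_mset k x) = mset_set U"
  using assms by (intro multiset_eqI) (auto simp: count_mset_set')

text \<open>The case of an empty \<open>J\<close>: the flow at time \<open>ln r\<close> moves only
  the hyperbolic plane.\<close>

lemma admits_lattice_quadratic:
  assumes \<mu>: "\<forall>j\<in>{1..q}. \<mu> j \<noteq> 0" and r: "r > 1" "poly (map_poly of_int [:1, - a, 1:]) (r::real) = 0"
    and one: "\<And>j. j \<in> {1..q} \<Longrightarrow> cis (\<mu> j * ln r) = 1"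
  shows "osc_admits_lattice q \<mu>"
proof -
  have e: "exp (ln r) = r" "exp (- ln r) = inverse r" using r(1) by (simp_all add: exp_minus)
  have "inverse r < 1" using r(1) by (simp add: inverse_less_1_iff)
  hence ne: "complex_of_real r \<noteq> complex_of_real (inverse r)" using r(1) by (simp only: of_real_eq_iff)
  have "cpoly [:1, - a, 1:] = [:- of_real r, 1:] * [:- of_real (inverse r), 1:]"
    using r by (rule cpoly_quadratic)
  also have "\<dots> = (\<Prod>\<rho>\<in>{of_real r, of_real (inverse r)}. [:- \<rho>, 1:])"
    using ne by (subst prod.insert) auto
  finally have "cpoly [:1, - a, 1:] = (\<Prod>\<rho>\<in>{of_real r, of_real (inverse r)}. [:- \<rho>, 1:])" .
  thus ?thesis
    using \<mu> r(1) one by (intro admits_lattice_if_roots[of q \<mu> "ln r" "{}" "[:1, - a, 1:]"]) (simp_all only: e, auto)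
qed

lemma admits_lattice_if_in_M:
  assumes \<mu>: "\<forall>j\<in>{1..q}. \<mu> j \<noteq> 0" and f: "f \<in> Fplus (2 * qb + 2)" and M: "in_M f q qb \<mu>"
  shows "osc_admits_lattice q \<mu>"
proof -
  obtain r :: real where r: "r > 1" "poly (map_poly of_int f) r = 0" and
    M: "image_mset (\<lambda>j. cis (\<mu> j * ln r)) (mset_set {1..q}) + image_mset (\<lambda>j. cnj (cis (\<mu> j * ln r))) (mset_set {1..q})
        = filter_mset (\<lambda>z. cmod z = 1) (proots (cpoly f)) + replicate_mset (2 * (q - qb)) 1"
    using M unfolding in_M_def unit_conj_pair_mset by blast
  define \<nu> where "\<nu> j = cis (\<mu> j * ln r)" for j
  have cm1: "cmod (\<nu> j) = 1" for j by (simp add: \<nu>_def)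
  show ?thesis
  \<comment> \<open>For \<open>qb = 0\<close> there is no unit root to make \<open>f\<close>
    reciprocal; the constant coefficient 1 of the quadratic provides the root
    \<open>inverse r\<close> instead.\<close>
  proof (cases "qb = 0")
    case True
    then obtain a where a: "f = [:1, - a, 1:]" using f by (auto simp: Fplus_def)
    have F: "cpoly f = [:- of_real r, 1:] * [:- of_real (inverse r), 1:]"
      using r unfolding a by (rule cpoly_quadratic)
    have "inverse r < 1" "inverse r > 0" using r(1) by (simp_all add: inverse_less_1_iff)
    hence "cmod (of_real r) \<noteq> 1" "cmod (of_real (inverse r)) \<noteq> 1" unfolding norm_of_real using r(1) by auto
    hence "filter_mset (\<lambda>z. cmod z = 1) (proots (cpoly f)) = {#}"
      unfolding F by (subst proots_mult) auto
    hence "set_mset (image_mset \<nu> (mset_set {1..q})) \<subseteq> {1}"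
      using arg_cong[OF M, of set_mset] by (auto simp: \<nu>_def split: if_splits)
    hence "\<nu> j = 1" if "j \<in> {1..q}" for j using that by (auto simp: image_subset_iff)
    thus ?thesis using admits_lattice_quadratic[OF \<mu> r(1) r(2)[unfolded a]] by (simp add: \<nu>_def)
  next
    case False
    hence f: "lead_coeff f = 1" "degree f = 2 * qb + 2" "irreducible f"
      "size (filter_mset (\<lambda>z. cmod z = 1) (proots (cpoly f))) = 2 * qb"
      using f by (auto simp: Fplus_def)
    have deg: "degree f > 0" using f(2) by simp
    define S where "S = {z. poly (cpoly f) z = 0}"
    define U where "U = {z \<in> S. cmod z = 1}"
    have f0: "cpoly f \<noteq> 0" using f(1) by auto
    have finS: "finite S" unfolding S_def using f0 by (rule poly_roots_finite)
    have rsq: "rsquarefree (cpoly f)" using f(3) deg by (rule irreducible_rsquarefree)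
    have F: "cpoly f = (\<Prod>z\<in>S. [:-z, 1:])" unfolding S_def using rsq f(1) by (rule cpoly_eq_prod_roots)
    have "degree (cpoly f) = card S" unfolding F by (subst degree_prod_eq_sum_degree) auto
    hence cS: "card S = 2 * qb + 2" using f(2) by simp
    have fU: "filter_mset (\<lambda>z. cmod z = 1) (proots (cpoly f)) = mset_set U"
      unfolding proots_eq_mset_set[OF rsq f0] S_def[symmetric] using finS by (simp add: filter_mset_mset_set U_def)
    have cU: "card U = 2 * qb" using f(4) unfolding fU by simp
    have "U \<noteq> {}" using cU False by auto
    then obtain z where z: "poly (cpoly f) z = 0" "cmod z = 1" by (auto simp: U_def S_def)
    have rS: "of_real r \<in> S" using root_cpoly_of_real[OF r(2)] by (simp add: S_def)
    hence "inverse (of_real r) \<in> S"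
      using root_inverse_if_unit_root[OF f(3) deg z, of "of_real r"] r(1) by (simp add: S_def)
    hence irS: "of_real (inverse r) \<in> S" by simp
    have ir: "inverse r < 1" "inverse r > 0" using r(1) by (simp_all add: inverse_less_1_iff)
    hence nU: "of_real r \<notin> U" "of_real (inverse r) \<notin> U"
      unfolding U_def mem_Collect_eq norm_of_real using r(1) by auto
    have ne: "complex_of_real r \<noteq> of_real (inverse r)" using r(1) ir by (simp only: of_real_eq_iff)
    have finU: "finite U" using finS by (simp add: U_def)
    \<comment> \<open>The \<open>2 * qb\<close> unit roots together with \<open>r\<close> and
      \<open>inverse r\<close> exhaust the degree.\<close>
    have S_eq: "S = insert (of_real r) (insert (of_real (inverse r)) U)"
    proof (rule card_subset_eq[symmetric, OF finS])
      show "insert (of_real r) (insert (of_real (inverse r)) U) \<subseteq> S" using rS irS by (auto simp: U_def)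
      show "card (insert (of_real r) (insert (of_real (inverse r)) U)) = card S"
        using nU ne finU by (simp add: cS cU del: of_real_inverse)
    qed
    \<comment> \<open>Hence discarding the ones in \<open>M\<close> removes the padding and no root
      of \<open>f\<close>.\<close>
    have "1 \<notin> U"
    proof
      assume "1 \<in> U"
      hence "poly (cpoly f) 1 = 0" by (simp add: U_def S_def)
      moreover have "poly (cpoly [:-1, 1:]) 1 = 0" by (simp add: of_int_hom.map_poly_pCons_hom)
      ultimately have "f dvd [:-1, 1:]" using irreducible_dvd_if_common_root[OF f(3) deg] by blast
      hence "degree f \<le> degree [:-1, 1 :: int:]" by (rule dvd_imp_degree_le) simp
      thus False using f(2) by simp
    qed
    define J where "J = {j \<in> {1..q}. \<nu> j \<noteq> 1}"
    have EU: "image_mset \<nu> (mset_set J) + image_mset (\<lambda>j. cnj (\<nu> j)) (mset_set J) = mset_set U"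
      using arg_cong[OF M, of "filter_mset (\<lambda>z. z \<noteq> 1)"]
      unfolding fU \<nu>_def J_def by (simp only: filter_conj_pairs filter_mset_set_replicate[OF finU \<open>1 \<notin> U\<close>] finite_atLeastAtMost)
    have finJ: "finite J" by (simp add: J_def)
    have JU: "U = \<nu> ` J \<union> (\<lambda>j. cnj (\<nu> j)) ` J"
      using arg_cong[OF EU, of set_mset] finU finJ by simp
    \<comment> \<open>As \<open>U\<close> is a set, no unit root is attained twice; both
      \<open>inj\<close> and \<open>ncnj\<close> come from this.\<close>
    have cnt: "count (image_mset \<nu> (mset_set J)) z + count (image_mset (\<lambda>j. cnj (\<nu> j)) (mset_set J)) z \<le> 1" for z
      using arg_cong[OF EU, of "\<lambda>M. count M z"] finU by (auto simp: count_mset_set')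
    have inj: "inj_on \<nu> J"
    proof (rule inj_onI, rule ccontr)
      fix i j assume ij: "i \<in> J" "j \<in> J" "\<nu> i = \<nu> j" "i \<noteq> j"
      have "mset_set {i, j} \<subseteq># mset_set J" using ij finJ by (intro msubset_mset_set_iff[THEN iffD2]) auto
      hence "image_mset \<nu> (mset_set {i, j}) \<subseteq># image_mset \<nu> (mset_set J)" by (rule image_mset_subseteq_mono)
      hence "count (image_mset \<nu> (mset_set {i, j})) (\<nu> j) \<le> count (image_mset \<nu> (mset_set J)) (\<nu> j)"
        by (rule mset_subset_eq_count)
      thus False using cnt[of "\<nu> j"] ij by simp
    qed
    have ncnj: "\<nu> i \<noteq> cnj (\<nu> j)" if ij: "i \<in> J" "j \<in> J" for i j
    proof
      assume e: "\<nu> i = cnj (\<nu> j)"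
      have "\<nu> i \<in># image_mset \<nu> (mset_set J)" "\<nu> i \<in># image_mset (\<lambda>j. cnj (\<nu> j)) (mset_set J)"
        using imageI[OF ij(1), of \<nu>] imageI[OF ij(2), of "\<lambda>j. cnj (\<nu> j)"] finJ by (simp_all add: e)
      hence "count (image_mset \<nu> (mset_set J)) (\<nu> i) \<ge> 1" "count (image_mset (\<lambda>j. cnj (\<nu> j)) (mset_set J)) (\<nu> i) \<ge> 1"
        by (simp_all add: Suc_le_eq)
      thus False using cnt[of "\<nu> i"] by linarith
    qed
    have e: "exp (ln r) = r" "exp (- ln r) = inverse r" using r(1) by (simp_all add: exp_minus)
    show ?thesis
    proof (rule admits_lattice_if_roots[of q \<mu> "ln r" J f])
      show "cpoly f = (\<Prod>\<rho>\<in>insert (complex_of_real (exp (ln r))) (insert (complex_of_real (exp (- ln r)))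
          ((\<lambda>j. cis (\<mu> j * ln r)) ` J \<union> (\<lambda>j. cnj (cis (\<mu> j * ln r))) ` J)). [:- \<rho>, 1:])"
        unfolding e F S_eq JU \<nu>_def ..
      show "inj_on (\<lambda>j. cis (\<mu> j * ln r)) J" using inj by (simp add: \<nu>_def inj_on_def)
      show "cis (\<mu> i * ln r) \<noteq> cnj (cis (\<mu> j * ln r))" if "i \<in> J" "j \<in> J" for i j
        using ncnj[OF that] by (simp add: \<nu>_def)
      show "cis (\<mu> j * ln r) = 1" if "j \<in> {1..q} - J" for j using that by (auto simp: J_def \<nu>_def)
    qed (use \<mu> r(1) in \<open>auto simp: J_def\<close>)
  qed
qed

text \<open>Nothing rotates, so every quadratic in \<open>Fplus 2\<close> would serve; the root of
  x^2 - 3x + 1 is taken.\<close>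

lemma admits_lattice_0: "osc_admits_lattice 0 \<mu>"
proof (rule admits_lattice_quadratic[of 0 \<mu> "(3 + sqrt 5) / 2" 3])
  show "1 < (3 + sqrt 5) / 2" by (simp add: add_pos_nonneg)
  show "poly (map_poly of_int [:1, - 3, 1:]) ((3 + sqrt 5) / 2) = 0"
    by (simp add: of_int_hom.map_poly_pCons_hom field_simps)
qed auto

section \<open>Integrality of the characteristic polynomial\<close>

text \<open>Entries are given as a function, so that tuples of vectors enter through their
  coordinates directly.\<close>

abbreviation mdet :: "nat \<Rightarrow> (nat \<Rightarrow> nat \<Rightarrow> 'a::comm_ring_1) \<Rightarrow> 'a" where
  "mdet n f \<equiv> Determinant.det (Matrix.mat n n (\<lambda>(i, k). f i k))"

lemma mult_mat_vec_mat:
  "Matrix.mat n n (\<lambda>(i, k). f i k) *\<^sub>v Matrix.vec n x = Matrix.vec n (\<lambda>i. \<Sum>k<n. f i k * x k)"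
  by (rule eq_vecI) (simp_all add: scalar_prod_def atLeast0LessThan)

lemma mult_mat_mat:
  "Matrix.mat n n (\<lambda>(i, k). f i k) * Matrix.mat n n (\<lambda>(i, k). g i k)
    = Matrix.mat n n (\<lambda>(i, k). \<Sum>l<n. f i l * g l k)"
  by (rule eq_matI) (simp_all add: scalar_prod_def atLeast0LessThan)

lemma mdet_eq_0_iff:
  fixes f :: "nat \<Rightarrow> nat \<Rightarrow> 'a::field"
  shows "mdet n f = 0 \<longleftrightarrow> (\<exists>x. (\<exists>k<n. x k \<noteq> 0) \<and> (\<forall>i<n. (\<Sum>k<n. f i k * x k) = 0))"
proof -
  let ?A = "Matrix.mat n n (\<lambda>(i, k). f i k)"
  have "mdet n f = 0 \<longleftrightarrow> (\<exists>v. v \<in> carrier_vec n \<and> v \<noteq> 0\<^sub>v n \<and> ?A *\<^sub>v v = 0\<^sub>v n)"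
    by (rule det_0_iff_vec_prod_zero_field) simp
  also have "\<dots> \<longleftrightarrow> (\<exists>x. (\<exists>k<n. x k \<noteq> 0) \<and> (\<forall>i<n. (\<Sum>k<n. f i k * x k) = 0))" (is "?l = ?r")
  proof
    assume ?l
    then obtain v where v: "v \<in> carrier_vec n" "v \<noteq> 0\<^sub>v n" "?A *\<^sub>v v = 0\<^sub>v n" by blast
    have ve: "v = Matrix.vec n (vec_index v)" using v(1) by (intro eq_vecI) auto
    have E: "Matrix.vec n (\<lambda>i. \<Sum>k<n. f i k * vec_index v k) = 0\<^sub>v n"
      unfolding mult_mat_vec_mat[symmetric] ve[symmetric] by (rule v(3))
    have "(\<Sum>k<n. f i k * vec_index v k) = 0" if "i < n" for i
      using arg_cong[OF E, of "\<lambda>v. vec_index v i"] that by simp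
    hence "\<forall>i<n. (\<Sum>k<n. f i k * vec_index v k) = 0" by blast
    moreover have "\<exists>k<n. vec_index v k \<noteq> 0"
    proof (rule ccontr)
      assume "\<not> ?thesis"
      hence "v = 0\<^sub>v n" using v(1) by (intro eq_vecI) auto
      thus False using v(2) by simp
    qed
    ultimately show ?r by blast
  next
    assume ?r
    then obtain x k where x: "k < n" "x k \<noteq> 0" "\<forall>i<n. (\<Sum>k<n. f i k * x k) = 0" by blast
    have "?A *\<^sub>v Matrix.vec n x = 0\<^sub>v n" unfolding mult_mat_vec_mat using x(3) by (intro eq_vecI) auto
    moreover have "Matrix.vec n x \<noteq> 0\<^sub>v n" 
    proof
      assume e: "Matrix.vec n x = 0\<^sub>v n"
      have "vec_index (Matrix.vec n x) k = vec_index (0\<^sub>v n) k" by (simp only: e)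
      thus False using x(1,2) by simp
    qed
    ultimately show ?l by (intro exI[of _ "Matrix.vec n x"]) simp
  qed
  finally show ?thesis .
qed

lemma mdet_nonzero_injective:
  fixes f :: "nat \<Rightarrow> nat \<Rightarrow> 'a::field"
  assumes "mdet n f \<noteq> 0" "\<And>i. i < n \<Longrightarrow> (\<Sum>k<n. f i k * x k) = 0" "k < n"
  shows "x k = 0"
proof (rule ccontr)
  assume "x k \<noteq> 0"
  hence "\<exists>x. (\<exists>k<n. x k \<noteq> 0) \<and> (\<forall>i<n. (\<Sum>k<n. f i k * x k) = 0)"
    using assms(2,3) by (intro exI[of _ x] conjI exI[of _ k]) auto
  thus False using assms(1) unfolding mdet_eq_0_iff by simp
qed

lemma mdet_solve:
  fixes f :: "nat \<Rightarrow> nat \<Rightarrow> 'a::field"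
  assumes "mdet n f \<noteq> 0"
  shows "\<exists>x. \<forall>i<n. (\<Sum>k<n. f i k * x k) = w i"
proof -
  let ?A = "Matrix.mat n n (\<lambda>(i, k). f i k)"
  have A: "?A \<in> carrier_mat n n" by simp
  define B where "B = adj_mat ?A"
  have B: "B \<in> carrier_mat n n" "?A * B = mdet n f \<cdot>\<^sub>m 1\<^sub>m n" using adj_mat[OF A] by (auto simp: B_def)
  define y where "y = B *\<^sub>v Matrix.vec n w"
  have y: "y \<in> carrier_vec n" using B(1) by (simp add: y_def)
  have ye: "y = Matrix.vec n (vec_index y)" using y by (intro eq_vecI) auto
  have "?A *\<^sub>v y = (?A * B) *\<^sub>v Matrix.vec n w" unfolding y_def by (rule assoc_mult_mat_vec[symmetric]) (use A B in auto)
  also have "\<dots> = mdet n f \<cdot>\<^sub>v Matrix.vec n w"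
  proof (rule eq_vecI)
    fix i assume "i < dim_vec (mdet n f \<cdot>\<^sub>v Matrix.vec n w)"
    hence i: "i < n" by simp
    have "(\<Sum>k = 0..<n. (mdet n f * (if k = i then 1 else 0)) * w k) = (\<Sum>k = 0..<n. if k = i then mdet n f * w i else 0)"
      by (rule sum.cong) auto
    also have "\<dots> = mdet n f * w i" using i by simp
    finally show "vec_index ((?A * B) *\<^sub>v Matrix.vec n w) i = vec_index (mdet n f \<cdot>\<^sub>v Matrix.vec n w) i"
      unfolding B(2) using i by (simp add: scalar_prod_def)
  qed (simp add: B(2))
  finally have E: "Matrix.vec n (\<lambda>i. \<Sum>k<n. f i k * vec_index y k) = mdet n f \<cdot>\<^sub>v Matrix.vec n w"
    unfolding mult_mat_vec_mat[symmetric] ye[symmetric] .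
  have "(\<Sum>k<n. f i k * vec_index y k) = mdet n f * w i" if "i < n" for i
    using that arg_cong[OF E, of "\<lambda>v. vec_index v i"] by simp
  hence "\<forall>i<n. (\<Sum>k<n. f i k * (vec_index y k / mdet n f)) = w i"
    using assms by (simp flip: sum_divide_distrib add: times_divide_eq_right)
  thus ?thesis by (rule exI[where x = "\<lambda>k. vec_index y k / mdet n f"])
qed

lemma mdet_mult:
  "mdet n f * mdet n g = mdet n (\<lambda>i k. \<Sum>l<n. f i l * g l k)"
  unfolding mult_mat_mat[symmetric] by (rule Determinant.det_mult[symmetric]) auto

lemma mdet_scale: "mdet n (\<lambda>i k. c * f i k) = c ^ n * mdet n f"
proof -
  have "Matrix.mat n n (\<lambda>(i, k). c * f i k) = c \<cdot>\<^sub>m Matrix.mat n n (\<lambda>(i, k). f i k)"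
    by (rule eq_matI) auto
  thus ?thesis by simp
qed

lemma mdet_of_int:
  fixes f :: "nat \<Rightarrow> nat \<Rightarrow> int"
  shows "mdet n (\<lambda>i k. of_int (f i k)) = (of_int (mdet n f) :: complex)"
proof -
  have e: "Matrix.mat n n (\<lambda>(i, k). of_int (f i k)) = (map_mat of_int (Matrix.mat n n (\<lambda>(i, k). f i k)) :: complex mat)"
    by (rule eq_matI) auto
  show ?thesis unfolding e by (rule of_int_hom.hom_det)
qed

text \<open>Cramer's rule in the form that measures how the determinant of a tuple changes when one
  vector is replaced.\<close>

lemma mdet_cramer:
  assumes "k < n" "\<And>i. i < n \<Longrightarrow> w i = (\<Sum>l<n. f i l * x l)"
  shows "mdet n (\<lambda>i l. if l = k then w i else f i l) = x k * mdet n f"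
proof -
  let ?A = "Matrix.mat n n (\<lambda>(i, k). f i k)"
  have "replace_col ?A (?A *\<^sub>v Matrix.vec n x) k = Matrix.mat n n (\<lambda>(i, l). if l = k then w i else f i l)"
    unfolding mult_mat_vec_mat replace_col_def using assms by (intro eq_matI) auto
  thus ?thesis using cramer_lemma_mat[of ?A n "Matrix.vec n x" k] assms(1) by simp
qed

lemma tendsto_mdet:
  fixes f :: "'b \<Rightarrow> nat \<Rightarrow> nat \<Rightarrow> complex"
  assumes "\<And>i k. i < n \<Longrightarrow> k < n \<Longrightarrow> ((\<lambda>m. f m i k) \<longlongrightarrow> g i k) F"
  shows "((\<lambda>m. mdet n (f m)) \<longlongrightarrow> mdet n g) F"
proof -
  have e: "mdet n h = (\<Sum>p\<in>{p. p permutes {0..<n}}. signof p * (\<Prod>i = 0..<n. h i (p i)))"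
    for h :: "nat \<Rightarrow> nat \<Rightarrow> complex"
    unfolding det_def'[OF mat_carrier]
    by (intro sum.cong refl arg_cong2[of _ _ _ _ "(*)"] prod.cong) (auto dest: permutes_in_image)
  show ?thesis
    unfolding e using assms by (intro tendsto_intros) (auto dest: permutes_in_image)
qed

section \<open>Coordinates that diagonalise the flow\<close>

definition rdim :: "nat \<Rightarrow> nat" where
  "rdim q = 2 * q + 2"

text \<open>Coordinates of the complexified space: the flow is diagonal in them, each
  \<open>a j\<close> being listed at index \<open>2 * j\<close> and its conjugate at
  \<open>2 * j + 1\<close>.\<close>

definition ccoord :: "(nat \<Rightarrow> complex) \<Rightarrow> nat \<Rightarrow> complex" where
  "ccoord a i = (if i = 0 then of_real (cpos a) else if i = 1 then of_real (cneg a)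
    else if even i then a (i div 2) else cnj (a (i div 2)))"

definition flow_eigenvalue :: "(nat \<Rightarrow> real) \<Rightarrow> real \<Rightarrow> nat \<Rightarrow> complex" where
  "flow_eigenvalue \<mu> t i = (if i = 0 then of_real (exp t) else if i = 1 then of_real (exp (- t))
    else if even i then cis (\<mu> (i div 2) * t) else cnj (cis (\<mu> (i div 2) * t)))"

text \<open>The permutation by which complex conjugation acts on the coordinates of a real
  vector.\<close>

definition conj_index :: "nat \<Rightarrow> nat" where
  "conj_index i = (if i < 2 then i else if even i then i + 1 else i - 1)"

lemma div2_nonzero: "i \<noteq> 0 \<Longrightarrow> i \<noteq> Suc 0 \<Longrightarrow> i div 2 \<noteq> 0"
  by presburger

lemma ccoord_add [simp]: "ccoord (a + b) i = ccoord a i + ccoord b i"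
  and ccoord_diff [simp]: "ccoord (a - b) i = ccoord a i - ccoord b i"
  and ccoord_zero [simp]: "ccoord 0 i = 0"
  and ccoord_rscale [simp]: "ccoord (rscale c a) i = of_real c * ccoord a i"
  and ccoord_flow: "ccoord (flow \<mu> t a) i = flow_eigenvalue \<mu> t i * ccoord a i"
  using div2_nonzero[of i] by (auto simp: ccoord_def flow_eigenvalue_def)

lemma ccoord_sum: "ccoord (\<Sum>k\<in>I. f k) i = (\<Sum>k\<in>I. ccoord (f k) i)"
  by (induction I rule: infinite_finite_induct) (simp_all del: plus_fun_apply zero_fun_apply)

lemma cnj_ccoord: "cnj (ccoord a i) = ccoord a (conj_index i)"
  by (auto simp: ccoord_def conj_index_def elim!: evenE oddE)

lemma conj_index_less: "i < rdim q \<Longrightarrow> conj_index i < rdim q"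
  unfolding conj_index_def rdim_def by (auto, presburger)

lemma ccoord_inject:
  assumes "a \<in> osc_space q" "b \<in> osc_space q" "\<And>i. i < rdim q \<Longrightarrow> ccoord a i = ccoord b i"
  shows "a = b"
proof (rule osc_space_eqI[OF assms(1,2)])
  show "cpos a = cpos b" using assms(3)[of 0] by (simp add: ccoord_def rdim_def)
  show "cneg a = cneg b" using assms(3)[of 1] by (simp add: ccoord_def rdim_def)
  show "a j = b j" if "j \<in> {1..q}" for j using assms(3)[of "2 * j"] that by (simp add: ccoord_def rdim_def)
qed

lemma cmod_ccoord_le: "i < rdim q \<Longrightarrow> cmod (ccoord a i) \<le> 2 * anorm q a"
proof -
  assume i: "i < rdim q"
  have "cmod (a (i div 2)) \<le> 2 * anorm q a"
    using cmod_le_anorm[of "i div 2" q a] anorm_ge0[of q a] i unfolding rdim_def by linarith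
  thus ?thesis using cpos_le_anorm[of a q] cneg_le_anorm[of a q] by (auto simp: ccoord_def)
qed

text \<open>The numbers \<open>(1 + \<i>) / 2\<close> and \<open>(1 - \<i>) / 2\<close> are dual to
  \<open>cpos\<close> and \<open>cneg\<close>.\<close>

definition real_basis :: "nat \<Rightarrow> (nat \<Rightarrow> complex)" where
  "real_basis k = (if k = 0 then unit_vector 0 ((1 + \<i>) / 2) else if k = 1 then unit_vector 0 ((1 - \<i>) / 2)
    else unit_vector (k div 2) (if even k then 1 else \<i>))"

lemma real_basis_space: "k < rdim q \<Longrightarrow> real_basis k \<in> osc_space q"
  by (auto simp: real_basis_def osc_space_def unit_vector_def rdim_def)

lemma ccoord_real_basis:
  "ccoord (real_basis k) i = (if k < 2 \<or> i < 2 then (if k = i then 1 else 0)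
    else if k div 2 = i div 2 then (if even k then 1 else if even i then \<i> else - \<i>) else 0)"
proof -
  have "cpos (unit_vector 0 c) = Re c + Im c" "cneg (unit_vector 0 c) = Re c - Im c" for c
    by (simp_all add: cpos_def cneg_def unit_vector_def)
  thus ?thesis
    using div2_nonzero[of k] div2_nonzero[of i]
    by (auto simp: ccoord_def real_basis_def unit_vector_apply)
qed

text \<open>The matrix is block diagonal, with an identity block of size 2 and blocks with rows
  \<open>(1, \<i>)\<close> and \<open>(1, - \<i>)\<close>.\<close>

lemma mdet_real_basis: "mdet (rdim q) (\<lambda>i k. ccoord (real_basis k) i) \<noteq> 0"
proof
  let ?n = "rdim q"
  assume "mdet ?n (\<lambda>i k. ccoord (real_basis k) i) = 0"
  then obtain x k0 where x: "k0 < ?n" "x k0 \<noteq> 0" "\<And>i. i < ?n \<Longrightarrow> (\<Sum>k<?n. ccoord (real_basis k) i * x k) = 0"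
    unfolding mdet_eq_0_iff by blast
  show False
  proof (cases "k0 < 2")
    case True
    have "(\<Sum>k<?n. ccoord (real_basis k) k0 * x k) = (\<Sum>k<?n. if k = k0 then x k0 else 0)"
      by (rule sum.cong) (use True in \<open>auto simp: ccoord_real_basis\<close>)
    thus False using x by simp
  next
    case False
    define j where "j = k0 div 2"
    have j: "j \<ge> 1" "2 * j + 1 < ?n" using False x(1) unfolding j_def rdim_def by presburger+
    have row: "(\<Sum>k<?n. ccoord (real_basis k) i * x k)
        = x (2 * j) + (if even i then \<i> else - \<i>) * x (2 * j + 1)" if i: "i div 2 = j" for i
    proof -
      have "i \<ge> 2" using i j(1) by presburger
      have "(\<Sum>k<?n. ccoord (real_basis k) i * x k) = (\<Sum>k\<in>{2 * j, 2 * j + 1}. ccoord (real_basis k) i * x k)"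
      proof (rule sum.mono_neutral_right)
        show "\<forall>k\<in>{..<?n} - {2 * j, 2 * j + 1}. ccoord (real_basis k) i * x k = 0"
        proof
          fix k assume "k \<in> {..<?n} - {2 * j, 2 * j + 1}"
          hence "k \<noteq> 2 * j \<and> k \<noteq> 2 * j + 1" by simp
          hence "k div 2 \<noteq> j" by presburger
          thus "ccoord (real_basis k) i * x k = 0" using i \<open>i \<ge> 2\<close> by (auto simp: ccoord_real_basis)
        qed
      qed (use j in auto)
      also have "\<dots> = x (2 * j) + (if even i then \<i> else - \<i>) * x (2 * j + 1)"
        using i j(1) \<open>i \<ge> 2\<close> by (simp add: ccoord_real_basis)
      finally show ?thesis .
    qed
    have e: "x (2 * j) + \<i> * x (2 * j + 1) = 0" "x (2 * j) - \<i> * x (2 * j + 1) = 0"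
      using row[of "2 * j"] row[of "2 * j + 1"] x(3)[of "2 * j"] x(3)[of "2 * j + 1"] j by simp_all
    have "2 * x (2 * j) = (x (2 * j) + \<i> * x (2 * j + 1)) + (x (2 * j) - \<i> * x (2 * j + 1))" by simp
    hence "x (2 * j) = 0" unfolding e by simp
    moreover from this have "x (2 * j + 1) = 0" using e(1) by simp
    moreover have "k0 = 2 * j \<or> k0 = 2 * j + 1" unfolding j_def by presburger
    ultimately show False using x(2) by auto
  qed
qed

section \<open>Integer bases of a lattice\<close>

abbreviation tuple_det :: "nat \<Rightarrow> (nat \<Rightarrow> nat \<Rightarrow> complex) \<Rightarrow> complex" where
  "tuple_det q v \<equiv> mdet (rdim q) (\<lambda>i k. ccoord (v k) i)"

text \<open>Approximate large multiples of the standard basis by elements of \<open>A\<close>. After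
  rescaling, the bounded error disappears in the limit, and the determinant is continuous.\<close>

lemma exists_independent_tuple:
  assumes "relatively_dense q A" "A \<subseteq> osc_space q"
  shows "\<exists>v. (\<forall>k. v k \<in> A) \<and> tuple_det q v \<noteq> 0"
proof -
  let ?n = "rdim q"
  obtain M where M: "\<And>a. a \<in> osc_space q \<Longrightarrow> \<exists>b\<in>A. anorm q (a - b) \<le> M"
    using assms(1) by (auto simp: relatively_dense_def)
  \<comment> \<open>The value 0 beyond the dimension lies in \<open>osc_space q\<close>, so that
    \<open>v m k\<close> can be chosen in \<open>A\<close> for all \<open>k\<close>.\<close>
  define e where "e k = (if k < ?n then real_basis k else 0)" for k
  have e: "e k \<in> osc_space q" for k by (simp add: e_def real_basis_space del: zero_fun_apply)
  have "\<forall>m k. \<exists>b. b \<in> A \<and> anorm q (rscale (real (Suc m)) (e k) - b) \<le> M"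
    using M e by (meson rscale_space)
  then obtain v where v: "\<And>m k. v m k \<in> A" "\<And>m k. anorm q (rscale (real (Suc m)) (e k) - v m k) \<le> M"
    by metis
  have "(\<lambda>m. inverse (of_nat (Suc m)) * ccoord (v m k) i) \<longlonglongrightarrow> ccoord (real_basis k) i"
    if i: "i < ?n" and k: "k < ?n" for i k
  proof (rule LIM_zero_cancel, rule Lim_null_comparison)
    show "(\<lambda>m. inverse (real (Suc m)) * (2 * M)) \<longlonglongrightarrow> 0"
      using tendsto_mult_right[OF LIMSEQ_inverse_real_of_nat, of "2 * M"] by simp
    show "\<forall>\<^sub>F m in sequentially. norm (inverse (of_nat (Suc m)) * ccoord (v m k) i - ccoord (real_basis k) i)
        \<le> inverse (real (Suc m)) * (2 * M)"
    proof (intro always_eventually allI)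
      fix m
      have "inverse (of_nat (Suc m)) * ccoord (v m k) i - ccoord (real_basis k) i
          = - inverse (of_nat (Suc m)) * ccoord (rscale (real (Suc m)) (e k) - v m k) i"
        using k by (simp add: e_def right_diff_distrib del: of_nat_Suc)
      hence "norm (inverse (of_nat (Suc m)) * ccoord (v m k) i - ccoord (real_basis k) i)
          = inverse (real (Suc m)) * cmod (ccoord (rscale (real (Suc m)) (e k) - v m k) i)"
        by (simp add: norm_mult norm_inverse del: of_nat_Suc ccoord_diff ccoord_rscale)
      also have "\<dots> \<le> inverse (real (Suc m)) * (2 * M)"
        using cmod_ccoord_le[OF i, of "rscale (real (Suc m)) (e k) - v m k"] v(2)[of m k]
        by (intro mult_left_mono) auto
      finally show "norm (inverse (of_nat (Suc m)) * ccoord (v m k) i - ccoord (real_basis k) i)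
        \<le> inverse (real (Suc m)) * (2 * M)" .
    qed
  qed
  hence "(\<lambda>m. mdet ?n (\<lambda>i k. inverse (of_nat (Suc m)) * ccoord (v m k) i)) \<longlonglongrightarrow> tuple_det q real_basis"
    by (rule tendsto_mdet)
  hence "\<forall>\<^sub>F m in sequentially. mdet ?n (\<lambda>i k. inverse (of_nat (Suc m)) * ccoord (v m k) i) \<noteq> 0"
    using mdet_real_basis by (rule tendsto_imp_eventually_ne)
  then obtain m where "mdet ?n (\<lambda>i k. inverse (of_nat (Suc m)) * ccoord (v m k) i) \<noteq> 0"
    by (auto simp: eventually_sequentially)
  hence "tuple_det q (v m) \<noteq> 0" unfolding mdet_scale by auto
  thus ?thesis using v(1) by blast
qed

text \<open>Conjugation permutes the equations of the complex linear system, so the conjugate of a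
  solution is a solution; by uniqueness the solution is real.\<close>

lemma real_coordinates:
  assumes v: "\<And>k. v k \<in> osc_space q" "tuple_det q v \<noteq> 0" and w: "w \<in> osc_space q"
  shows "\<exists>c. w = (\<Sum>k<rdim q. rscale (c k) (v k))"
proof -
  let ?n = "rdim q"
  obtain x where x: "\<And>i. i < ?n \<Longrightarrow> (\<Sum>k<?n. ccoord (v k) i * x k) = ccoord w i"
    using mdet_solve[OF v(2)] by blast
  have "(\<Sum>k<?n. ccoord (v k) i * (x k - cnj (x k))) = 0" if i: "i < ?n" for i
  proof -
    have "(\<Sum>k<?n. ccoord (v k) i * cnj (x k)) = cnj (\<Sum>k<?n. ccoord (v k) (conj_index i) * x k)"
      by (simp add: cnj_sum flip: cnj_ccoord)
    also have "\<dots> = ccoord w i" using x[OF conj_index_less[OF i]] by (simp flip: cnj_ccoord)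
    finally show ?thesis using x[OF i] by (simp add: right_diff_distrib sum_subtractf)
  qed
  hence "x k - cnj (x k) = 0" if "k < ?n" for k
    using mdet_nonzero_injective[OF v(2), of "\<lambda>k. x k - cnj (x k)" k] that by blast
  hence xr: "x k = of_real (Re (x k))" if "k < ?n" for k using that by (simp add: complex_eq_iff)
  have "w = (\<Sum>k<?n. rscale (Re (x k)) (v k))"
  proof (rule ccoord_inject[OF w])
    show "(\<Sum>k<?n. rscale (Re (x k)) (v k)) \<in> osc_space q"
      using v(1) by (intro add_subgroup_sum) (auto simp: add_subgroup_def)
    fix i assume i: "i < ?n"
    show "ccoord w i = ccoord (\<Sum>k<?n. rscale (Re (x k)) (v k)) i"
      unfolding x[OF i, symmetric] ccoord_sum using xr by (intro sum.cong) (auto simp: mult.commute)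
  qed
  thus ?thesis by (intro exI)
qed

lemma real_coordinates_unique:
  assumes v: "tuple_det q v \<noteq> 0" and eq: "(\<Sum>k<rdim q. rscale (c k) (v k)) = (\<Sum>k<rdim q. rscale (d k) (v k))"
    and k: "k < rdim q"
  shows "c k = d k"
proof -
  have "(\<Sum>k<rdim q. ccoord (v k) i * of_real (c k - d k)) = 0" if "i < rdim q" for i
    using arg_cong[OF eq, of "\<lambda>a. ccoord a i"]
    by (simp add: ccoord_sum right_diff_distrib sum_subtractf mult.commute)
  hence "complex_of_real (c k - d k) = 0"
    using mdet_nonzero_injective[OF v, of "\<lambda>k. of_real (c k - d k)" k] k by blast
  thus ?thesis by simp
qed

text \<open>Reducing the multiples of a lattice vector modulo the \<open>v k\<close> gives lattice
  points in the finite set \<open>B\<close>. Two of the first \<open>card B + 1\<close> multiples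
  coincide, so the coordinates have a denominator of at most \<open>card B\<close>, which divides
  its factorial.\<close>

lemma common_denominator:
  assumes A: "A \<subseteq> osc_space q" "add_subgroup A" "separated q A"
    and v: "\<And>k. v k \<in> A" "tuple_det q v \<noteq> 0"
  shows "\<exists>N::nat. N > 0 \<and> (\<forall>c k. (\<Sum>k<rdim q. rscale (c k) (v k)) \<in> A \<longrightarrow> k < rdim q \<longrightarrow> of_nat N * c k \<in> \<int>)"
proof -
  let ?n = "rdim q"
  define R where "R = (\<Sum>k<?n. anorm q (v k))"
  define B where "B = {a \<in> A. anorm q a \<le> R}"
  have finB: "finite B" unfolding B_def using A by (rule finite_bounded_separated)
  have "of_nat (fact (card B)) * c k \<in> \<int>" if c: "(\<Sum>k<?n. rscale (c k) (v k)) \<in> A" and k: "k < ?n" for c k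
  proof -
    define x where "x m = (\<Sum>k<?n. rscale (frac (of_nat m * c k)) (v k))" for m :: nat
    have "x m \<in> B" for m
    proof -
      have "x m = rscale (of_int (int m)) (\<Sum>k<?n. rscale (c k) (v k)) - (\<Sum>k<?n. rscale (of_int \<lfloor>of_nat m * c k\<rfloor>) (v k))"
      proof -
        have "rscale r (\<Sum>k<?n. rscale (c k) (v k)) = (\<Sum>k<?n. rscale (r * c k) (v k))" for r
        proof -
          have "rscale r (\<Sum>k\<in>I. f k) = (\<Sum>k\<in>I. rscale r (f k))" for I :: "nat set" and f
            by (rule ext) (simp add: sum_fun_apply sum_distrib_left)
          thus ?thesis by simp
        qed
        thus ?thesis by (simp add: x_def frac_def rscale_diff_left sum_subtractf)
      qed
      also have "\<dots> \<in> A"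
        by (intro add_subgroup_diff[OF A(2)] add_subgroup_rscale_int[OF A(2) c]
            add_subgroup_sum[OF A(2) add_subgroup_rscale_int[OF A(2) v(1)]])
      finally have "x m \<in> A" .
      moreover have "anorm q (x m) \<le> R"
        unfolding x_def R_def
        by (rule order.trans[OF anorm_sum], rule sum_mono)
          (auto intro!: mult_left_le_one_le simp: frac_ge_0 frac_lt_1 less_imp_le)
      ultimately show ?thesis by (simp add: B_def)
    qed
    hence "\<not> inj_on x {..card B}"
      using card_inj_on_le[of x "{..card B}" B] finB by auto
    then obtain m m' where m: "m < m'" "m' \<le> card B" "x m = x m'"
      unfolding inj_on_def by (metis atMost_iff linorder_neqE_nat)
    have "frac (of_nat m * c k) = frac (of_nat m' * c k)"
      using real_coordinates_unique[OF v(2) m(3)[unfolded x_def] k] .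
    hence "of_nat m' * c k - of_nat m * c k = of_int (\<lfloor>of_nat m' * c k\<rfloor> - \<lfloor>of_nat m * c k\<rfloor>)"
      by (simp add: frac_def)
    hence h: "of_nat (m' - m) * c k \<in> \<int>" using m(1) by (simp add: of_nat_diff left_diff_distrib)
    have "m' - m dvd fact (card B)" using m by (intro dvd_fact) auto
    then obtain l where "fact (card B) = (m' - m) * l" by (elim dvdE)
    hence e: "of_nat (fact (card B)) * c k = of_nat l * (of_nat (m' - m) * c k)" by (simp only: of_nat_mult mult_ac)
    show ?thesis unfolding e using h by (rule Ints_mult[OF Ints_of_nat])
  qed
  thus ?thesis by (intro exI[of _ "fact (card B)"] conjI allI impI) (simp_all only: fact_gt_zero)
qed

text \<open>A tuple of vectors of the lattice with minimal non-zero determinant is a basis over the integers: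
  otherwise replacing a basis vector by a fractional remainder would decrease the determinant.\<close>

lemma exists_int_basis:
  assumes A: "A \<subseteq> osc_space q" "add_subgroup A" "separated q A" "relatively_dense q A"
  shows "\<exists>v. (\<forall>k. v k \<in> A) \<and> tuple_det q v \<noteq> 0 \<and>
    (\<forall>w\<in>A. \<exists>c :: nat \<Rightarrow> int. w = (\<Sum>k<rdim q. rscale (of_int (c k)) (v k)))"
proof -
  let ?n = "rdim q"
  obtain v0 where v0: "\<And>k. v0 k \<in> A" "tuple_det q v0 \<noteq> 0"
    using exists_independent_tuple[OF A(4,1)] by blast
  have v0s: "v0 k \<in> osc_space q" for k using v0(1) A(1) by blast
  obtain N :: nat where N: "N > 0" "\<forall>c k. (\<Sum>k<?n. rscale (c k) (v0 k)) \<in> A \<longrightarrow> k < ?n \<longrightarrow> of_nat N * c k \<in> \<int>"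
    using common_denominator[OF A(1-3) v0] by blast
  \<comment> \<open>By the common denominator, determinants of tuples from \<open>A\<close> are
    integer multiples of a fixed number; this is why a smallest nonzero one exists.\<close>
  have quant: "\<exists>z::int. of_nat N ^ ?n * tuple_det q v = tuple_det q v0 * of_int z" if v: "\<And>k. v k \<in> A" for v
  proof -
    have "\<forall>k. \<exists>c. v k = (\<Sum>l<?n. rscale (c l) (v0 l))"
      using real_coordinates[OF v0s v0(2)] v A(1) by blast
    then obtain c where c: "\<And>k. v k = (\<Sum>l<?n. rscale (c k l) (v0 l))" by metis
    define z where "z l k = \<lfloor>of_nat N * c k l\<rfloor>" for l k
    have "of_nat N * c k l = of_int (z l k)" if "l < ?n" for k l
    proof -
      have "of_nat N * c k l \<in> \<int>" using N(2)[rule_format, of "c k" l] v[of k] that unfolding c[symmetric] by simp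
      thus ?thesis by (auto simp: z_def elim!: Ints_cases)
    qed
    hence zc: "complex_of_nat N * of_real (c k l) = of_int (z l k)" if "l < ?n" for k l
      using that by (metis of_real_mult of_real_of_int_eq of_real_of_nat_eq)
    have "of_nat N ^ ?n * tuple_det q v = mdet ?n (\<lambda>i k. of_nat N * ccoord (v k) i)"
      by (rule mdet_scale[symmetric])
    also have "(\<lambda>i k. of_nat N * ccoord (v k) i) = (\<lambda>i k. \<Sum>l<?n. ccoord (v0 l) i * of_int (z l k))"
    proof (intro ext)
      fix i k
      have "of_nat N * ccoord (v k) i = (\<Sum>l<?n. ccoord (v0 l) i * (of_nat N * of_real (c k l)))"
        unfolding c ccoord_sum by (simp add: sum_distrib_left mult_ac)
      thus "of_nat N * ccoord (v k) i = (\<Sum>l<?n. ccoord (v0 l) i * of_int (z l k))"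
        using zc by simp
    qed
    also have "mdet ?n \<dots> = tuple_det q v0 * of_int (mdet ?n z)"
      unfolding mdet_mult[symmetric] mdet_of_int ..
    finally show ?thesis by blast
  qed
  \<comment> \<open>The floor is exact on tuples from \<open>A\<close>; it only turns the quotient
    into a natural number to be minimised.\<close>
  define size where "size v = nat \<lfloor>of_nat N ^ ?n * cmod (tuple_det q v) / cmod (tuple_det q v0)\<rfloor>" for v
  have size: "real (size v) = of_nat N ^ ?n * cmod (tuple_det q v) / cmod (tuple_det q v0)" if v: "\<And>k. v k \<in> A" for v
  proof -
    obtain z where "of_nat N ^ ?n * tuple_det q v = tuple_det q v0 * of_int z" using quant[of v, OF v] by blast
    hence "cmod (of_nat N ^ ?n * tuple_det q v) = cmod (tuple_det q v0 * of_int z)" by simp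
    hence "of_nat N ^ ?n * cmod (tuple_det q v) / cmod (tuple_det q v0) = of_int \<bar>z\<bar>"
      using v0(2) by (simp add: norm_mult norm_power)
    thus ?thesis by (simp add: size_def)
  qed
  define P where "P v \<longleftrightarrow> (\<forall>k. v k \<in> A) \<and> tuple_det q v \<noteq> 0" for v
  have "P v0" using v0 by (simp add: P_def)
  then obtain v where v: "P v" "\<And>v'. P v' \<Longrightarrow> size v \<le> size v'"
    using ex_has_least_nat[of P v0 size] by blast
  have vA: "v k \<in> A" for k using v(1) by (simp add: P_def)
  have vs: "v k \<in> osc_space q" for k using vA A(1) by blast
  have vd: "tuple_det q v \<noteq> 0" using v(1) by (simp add: P_def)
  have min: "cmod (tuple_det q v) \<le> cmod (tuple_det q v')" if "P v'" for v'
  proof -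
    have "real (size v) \<le> real (size v')" using v(2)[OF that] by simp
    thus ?thesis using that N(1) v0(2) vA unfolding P_def
      by (subst (asm) (1 2) size) (auto simp: divide_le_cancel)
  qed
  have "\<exists>c :: nat \<Rightarrow> int. w = (\<Sum>k<?n. rscale (of_int (c k)) (v k))" if w: "w \<in> A" for w
  proof -
    obtain c where c: "w = (\<Sum>k<?n. rscale (c k) (v k))" using real_coordinates[OF vs vd] w A(1) by blast
    have "c k = of_int \<lfloor>c k\<rfloor>" if k: "k < ?n" for k
    proof (rule ccontr)
      assume "c k \<noteq> of_int \<lfloor>c k\<rfloor>"
      hence fr: "0 < frac (c k)" "frac (c k) < 1" by (simp_all add: frac_def frac_lt_1) linarith+
      define w' where "w' = w - rscale (of_int \<lfloor>c k\<rfloor>) (v k)"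
      have w'A: "w' \<in> A" unfolding w'_def using A(2) w vA by (intro add_subgroup_diff add_subgroup_rscale_int)
      define v' where "v' = v(k := w')"
      have co: "ccoord w' i = (\<Sum>l<?n. ccoord (v l) i * of_real (if l = k then frac (c k) else c l))" for i
      proof -
        have "(\<Sum>l<?n. ccoord (v l) i * of_real (if l = k then frac (c k) else c l))
            = (\<Sum>l<?n. ccoord (v l) i * of_real (c l) - (if l = k then of_real (of_int \<lfloor>c k\<rfloor>) * ccoord (v k) i else 0))"
          by (rule sum.cong) (auto simp: frac_def algebra_simps)
        also have "\<dots> = (\<Sum>l<?n. ccoord (v l) i * of_real (c l)) - of_real (of_int \<lfloor>c k\<rfloor>) * ccoord (v k) i"
          using k by (simp add: sum_subtractf)
        finally show ?thesis unfolding w'_def c by (simp add: ccoord_sum mult.commute)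
      qed
      have "tuple_det q v' = mdet ?n (\<lambda>i l. if l = k then ccoord w' i else ccoord (v l) i)"
        by (intro arg_cong[of _ _ Determinant.det] eq_matI) (auto simp: v'_def)
      also have "\<dots> = of_real (if k = k then frac (c k) else c k) * tuple_det q v"
        by (rule mdet_cramer[OF k co])
      finally have d': "tuple_det q v' = of_real (frac (c k)) * tuple_det q v" by simp
      hence "P v'" using fr vA w'A vd by (simp add: P_def v'_def)
      from min[OF this] have "cmod (tuple_det q v) \<le> frac (c k) * cmod (tuple_det q v)"
        unfolding d' norm_mult norm_of_real using fr by simp
      thus False using fr vd by (simp add: mult_le_cancel_right1)
    qed
    hence "w = (\<Sum>k<?n. rscale (of_int \<lfloor>c k\<rfloor>) (v k))" unfolding c by (intro sum.cong) auto
    thus ?thesis by (rule exI[of _ "\<lambda>k. \<lfloor>c k\<rfloor>"])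
  qed
  thus ?thesis using vA vd by blast
qed

text \<open>An integer basis of \<open>A\<close> makes the flow an integer matrix \<open>B\<close>.
  The coordinate matrix \<open>V\<close> of the basis conjugates it to the diagonal matrix
  \<open>D\<close> of the eigenvalues.\<close>

lemma flow_char_poly_int:
  assumes A: "A \<subseteq> osc_space q" "add_subgroup A" "separated q A" "relatively_dense q A"
    and inv: "\<And>a. a \<in> A \<Longrightarrow> flow \<mu> t a \<in> A"
  shows "\<exists>P. cpoly P = (\<Prod>i<rdim q. [:- flow_eigenvalue \<mu> t i, 1:])"
proof -
  let ?n = "rdim q"
  obtain v where v: "\<And>k. v k \<in> A" "tuple_det q v \<noteq> 0"
    "\<And>w. w \<in> A \<Longrightarrow> \<exists>c :: nat \<Rightarrow> int. w = (\<Sum>k<?n. rscale (of_int (c k)) (v k))"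
    using exists_int_basis[OF A] by blast
  have "\<forall>k. \<exists>c :: nat \<Rightarrow> int. flow \<mu> t (v k) = (\<Sum>l<?n. rscale (of_int (c l)) (v l))"
    using v(1,3) inv by blast
  then obtain \<beta> :: "nat \<Rightarrow> nat \<Rightarrow> int" where \<beta>: "\<And>k. flow \<mu> t (v k) = (\<Sum>l<?n. rscale (of_int (\<beta> k l)) (v l))"
    by metis
  define B where "B = Matrix.mat ?n ?n (\<lambda>(l, k). \<beta> k l)"
  define V where "V = Matrix.mat ?n ?n (\<lambda>(i, k). ccoord (v k) i)"
  define D where "D = Matrix.mat ?n ?n (\<lambda>(i, k). if i = k then flow_eigenvalue \<mu> t i else 0)"
  define W where "W = (1 / Determinant.det V) \<cdot>\<^sub>m adj_mat V"
  have car: "B \<in> carrier_mat ?n ?n" "V \<in> carrier_mat ?n ?n" "D \<in> carrier_mat ?n ?n"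
    by (auto simp: B_def V_def D_def)
  have dV: "Determinant.det V \<noteq> 0" using v(2) by (simp add: V_def)
  have W: "W \<in> carrier_mat ?n ?n" "V * W = 1\<^sub>m ?n" "W * V = 1\<^sub>m ?n"
    using adj_mat[OF car(2)] car(2) dV
    by (auto simp: W_def mult_smult_distrib[of V ?n ?n _ ?n] mult_smult_assoc_mat[of _ ?n ?n V ?n])
  let ?B = "map_mat complex_of_int B"
  have "D * V = V * ?B"
  proof -
    have "D * V = Matrix.mat ?n ?n (\<lambda>(i, k). \<Sum>l<?n. (if i = l then flow_eigenvalue \<mu> t i else 0) * ccoord (v k) l)"
      unfolding D_def V_def by (rule mult_mat_mat)
    also have "\<dots> = Matrix.mat ?n ?n (\<lambda>(i, k). \<Sum>l<?n. ccoord (v l) i * of_int (\<beta> k l))"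
    proof (rule eq_matI)
      fix i k assume "i < dim_row (Matrix.mat ?n ?n (\<lambda>(i, k). \<Sum>l<?n. ccoord (v l) i * complex_of_int (\<beta> k l)))"
        "k < dim_col (Matrix.mat ?n ?n (\<lambda>(i, k). \<Sum>l<?n. ccoord (v l) i * complex_of_int (\<beta> k l)))"
      hence ik: "i < ?n" "k < ?n" by auto
      have "(\<Sum>l<?n. (if i = l then flow_eigenvalue \<mu> t i else 0) * ccoord (v k) l) = (\<Sum>l<?n. if l = i then flow_eigenvalue \<mu> t i * ccoord (v k) i else 0)"
        by (rule sum.cong) auto
      also have "\<dots> = flow_eigenvalue \<mu> t i * ccoord (v k) i" using ik by simp
      also have "\<dots> = ccoord (flow \<mu> t (v k)) i" by (simp add: ccoord_flow)
      also have "\<dots> = (\<Sum>l<?n. ccoord (v l) i * of_int (\<beta> k l))" unfolding \<beta> by (simp add: ccoord_sum mult.commute)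
      finally show "Matrix.mat ?n ?n (\<lambda>(i, k). \<Sum>l<?n. (if i = l then flow_eigenvalue \<mu> t i else 0) * ccoord (v k) l) $$ (i, k)
        = Matrix.mat ?n ?n (\<lambda>(i, k). \<Sum>l<?n. ccoord (v l) i * of_int (\<beta> k l)) $$ (i, k)" using ik by simp
    qed auto
    also have "\<dots> = V * Matrix.mat ?n ?n (\<lambda>(l, k). of_int (\<beta> k l))"
      unfolding V_def by (rule mult_mat_mat[symmetric])
    also have "Matrix.mat ?n ?n (\<lambda>(l, k). of_int (\<beta> k l)) = ?B" unfolding B_def by (rule eq_matI) auto
    finally show ?thesis .
  qed
  hence "D = V * ?B * W"
    using assoc_mult_mat[OF car(3,2) W(1)] W(2) car(3) by simp
  hence "similar_mat D ?B"
    using car W by (intro similar_matI[of D ?B V W ?n]) auto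
  hence "char_poly D = char_poly ?B" by (rule char_poly_similar)
  also have "\<dots> = cpoly (char_poly B)" by (rule of_int_hom.char_poly_hom[OF car(1)])
  finally have "cpoly (char_poly B) = char_poly D" ..
  also have "char_poly D = (\<Prod>a\<leftarrow>diag_mat D. [:- a, 1:])"
    by (rule char_poly_upper_triangular[OF car(3)]) (auto simp: D_def)
  also have "diag_mat D = map (flow_eigenvalue \<mu> t) [0..<?n]" unfolding diag_mat_def D_def by (rule map_cong) auto
  also have "(\<Prod>a\<leftarrow>map (flow_eigenvalue \<mu> t) [0..<?n]. [:- a, 1:]) = (\<Prod>i<?n. [:- flow_eigenvalue \<mu> t i, 1:])"
    by (simp add: prod.list_conv_set_nth atLeast0LessThan)
  finally show ?thesis by (rule exI)
qed

section \<open>The polynomial of a lattice\<close>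

lemma prod_flow_eigenvalue:
  "(\<Prod>i<rdim q. [:- flow_eigenvalue \<mu> t i, 1:]) = [:- of_real (exp t), 1:] * [:- of_real (exp (- t)), 1:] *
    (\<Prod>j\<in>{1..q}. [:- cis (\<mu> j * t), 1:] * [:- cnj (cis (\<mu> j * t)), 1:])"
proof (induction q)
  case 0
  have "rdim 0 = Suc (Suc 0)" by (simp add: rdim_def)
  thus ?case by (simp add: flow_eigenvalue_def)
next
  case (Suc q)
  have "rdim (Suc q) = Suc (Suc (rdim q))" by (simp add: rdim_def)
  moreover have "flow_eigenvalue \<mu> t (rdim q) = cis (\<mu> (Suc q) * t)"
    "flow_eigenvalue \<mu> t (Suc (rdim q)) = cnj (cis (\<mu> (Suc q) * t))"
    by (simp_all add: flow_eigenvalue_def rdim_def)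
  ultimately have "(\<Prod>i<rdim (Suc q). [:- flow_eigenvalue \<mu> t i, 1:]) = (\<Prod>i<rdim q. [:- flow_eigenvalue \<mu> t i, 1:]) *
      ([:- cis (\<mu> (Suc q) * t), 1:] * [:- cnj (cis (\<mu> (Suc q) * t)), 1:])"
    by (simp only: prod.lessThan_Suc mult.assoc)
  also have "\<dots> = [:- of_real (exp t), 1:] * [:- of_real (exp (- t)), 1:] *
    ((\<Prod>j\<in>{1..q}. [:- cis (\<mu> j * t), 1:] * [:- cnj (cis (\<mu> j * t)), 1:]) *
     ([:- cis (\<mu> (Suc q) * t), 1:] * [:- cnj (cis (\<mu> (Suc q) * t)), 1:]))"
    unfolding Suc.IH by (simp only: mult.assoc)
  also have "(\<Prod>j\<in>{1..q}. [:- cis (\<mu> j * t), 1:] * [:- cnj (cis (\<mu> j * t)), 1:]) *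
     ([:- cis (\<mu> (Suc q) * t), 1:] * [:- cnj (cis (\<mu> (Suc q) * t)), 1:]) =
     (\<Prod>j\<in>{1..Suc q}. [:- cis (\<mu> j * t), 1:] * [:- cnj (cis (\<mu> j * t)), 1:])"
    by (simp only: prod.nat_ivl_Suc' le_SucI le_add1 plus_1_eq_Suc mult.commute One_nat_def Suc_le_mono le0)
  finally show ?case .
qed

lemma proots_prod_conj_pairs:
  fixes \<nu> :: "nat \<Rightarrow> complex"
  assumes "finite I"
  shows "proots (\<Prod>j\<in>I. [:- \<nu> j, 1:] * [:- cnj (\<nu> j), 1:]) =
    image_mset \<nu> (mset_set I) + image_mset (\<lambda>j. cnj (\<nu> j)) (mset_set I)"
  using assms
proof (induction I rule: finite_induct)
  case (insert j I)
  have "proots (\<Prod>j\<in>insert j I. [:- \<nu> j, 1:] * [:- cnj (\<nu> j), 1:])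
      = proots ([:- \<nu> j, 1:] * [:- cnj (\<nu> j), 1:]) + proots (\<Prod>j\<in>I. [:- \<nu> j, 1:] * [:- cnj (\<nu> j), 1:])"
    unfolding prod.insert[OF insert(1,2)] using insert(1) by (intro proots_mult) auto
  also have "proots ([:- \<nu> j, 1:] * [:- cnj (\<nu> j), 1:]) = {#\<nu> j#} + {#cnj (\<nu> j)#}"
    by (subst proots_mult) auto
  finally show ?case using insert by simp
qed simp

lemma lead_coeff_conj_pairs:
  fixes \<nu> :: "nat \<Rightarrow> complex"
  shows "lead_coeff ([:- a, 1:] * [:- b, 1:] * (\<Prod>j\<in>I. [:- \<nu> j, 1:] * [:- cnj (\<nu> j), 1:])) = 1"
  unfolding lead_coeff_mult lead_coeff_prod by simp

lemma monic_root_degree_pos: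
  assumes "lead_coeff f = 1" "poly (cpoly f) z = 0"
  shows "degree f > 0"
proof (rule ccontr)
  assume "\<not> degree f > 0"
  hence "f = [:1:]" using assms(1) by (auto elim!: degree_eq_zeroE)
  thus False using assms(2) by simp
qed

text \<open>A monic divisor of least degree with root \<open>z\<close> is irreducible: in a
  factorisation the leading coefficients are both 1 or both -1, so the factor vanishing at
  \<open>z\<close> is again a candidate after normalisation.\<close>

lemma monic_irreducible_factor:
  fixes P :: "int poly"
  assumes P: "lead_coeff P = 1" "poly (cpoly P) z = 0"
  shows "\<exists>f. irreducible f \<and> lead_coeff f = 1 \<and> f dvd P \<and> poly (cpoly f) z = 0"
proof -
  define X where "X g \<longleftrightarrow> lead_coeff g = 1 \<and> g dvd P \<and> poly (cpoly g) z = 0" for g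
  have "X P" using P by (simp add: X_def)
  then obtain f where f: "X f" "\<And>g. X g \<Longrightarrow> degree f \<le> degree g"
    using ex_has_least_nat[of X P degree] by blast
  have deg: "degree f > 0" using f(1) monic_root_degree_pos by (auto simp: X_def)
  have key: "is_unit b" if ab: "f = a * b" and z: "poly (cpoly a) z = 0" for a b
  proof -
    have "lead_coeff a * lead_coeff b = 1" using f(1) by (simp add: X_def ab lead_coeff_mult)
    hence l: "lead_coeff a = 1 \<and> lead_coeff b = 1 \<or> lead_coeff a = -1 \<and> lead_coeff b = -1"
      by (simp add: zmult_eq_1_iff)
    have "a dvd P" using f(1) unfolding X_def ab by (metis dvd_mult_left)
    have "X (Polynomial.smult (lead_coeff a) a)"
      using l z \<open>a dvd P\<close> by (auto simp: X_def of_int_hom.map_poly_hom_smult)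
    hence "degree f \<le> degree (Polynomial.smult (lead_coeff a) a)" by (rule f(2))
    also have "\<dots> \<le> degree a" by (rule degree_smult_le)
    finally have "degree a + degree b \<le> degree a"
      using l unfolding ab by (subst (asm) degree_mult_eq) auto
    then obtain c where "b = [:c:]" by (auto elim: degree_eq_zeroE)
    thus ?thesis using l by (auto simp: is_unit_const_poly_iff)
  qed
  have "irreducible f"
  proof (rule irreducibleI)
    show "f \<noteq> 0" using deg by auto
    show "\<not> is_unit f" using deg by (auto simp: is_unit_poly_iff)
    fix a b assume ab: "f = a * b"
    hence "poly (cpoly a) z * poly (cpoly b) z = 0" using f(1) by (simp add: X_def of_int_poly_hom.hom_mult)
    thus "is_unit a \<or> is_unit b" using key[OF ab] key[of b a] ab by (auto simp: mult.commute)
  qed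
  thus ?thesis using f(1) by (auto simp: X_def)
qed

lemma poly_dvd_root: "f dvd g \<Longrightarrow> poly (cpoly f) z = 0 \<Longrightarrow> poly (cpoly g) z = 0"
  by (auto elim!: dvdE simp: of_int_poly_hom.hom_mult)

text \<open>If $f$ vanishes at $e^{t}$, then $f(e^{tL})$ maps the lattice into the part where $e^{tL}$ has
  bounded forward orbits, which are finite by discreteness.\<close>

lemma eigenvalue_root_of_unity:
  assumes A: "A \<subseteq> osc_space q" "add_subgroup A" "separated q A" "relatively_dense q A"
    and inv: "\<And>a. a \<in> A \<Longrightarrow> flow \<mu> t a \<in> A" and t: "t > 0"
    and f: "poly (cpoly f) (of_real (exp t)) = 0" and j: "j \<in> {1..q}"
    and nr: "poly (cpoly f) (cis (\<mu> j * t)) \<noteq> 0"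
  shows "\<exists>N>0. cis (\<mu> j * t) ^ N = 1"
proof -
  have invn: "flow \<mu> (real n * t) a \<in> A" if a: "a \<in> A" for n a
  proof (induction n)
    case (Suc n)
    from inv[OF this] show ?case by (simp add: flow_flow algebra_simps)
  qed (use a in simp)
  obtain M where M: "\<And>a. a \<in> osc_space q \<Longrightarrow> \<exists>b\<in>A. anorm q (a - b) \<le> M"
    using A(4) by (auto simp: relatively_dense_def)
  \<comment> \<open>Longer than \<open>M\<close> in coordinate \<open>j\<close>, so that a vector of
    \<open>A\<close> near \<open>x\<close> cannot vanish there.\<close>
  define x where "x = unit_vector j (of_real (\<bar>M\<bar> + 1))"
  have "x \<in> osc_space q" using j by (auto simp: x_def osc_space_def unit_vector_apply)
  then obtain b where b: "b \<in> A" "anorm q (x - b) \<le> M" using M by blast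
  have bj: "b j \<noteq> 0"
  proof
    assume "b j = 0"
    have "cmod ((x - b) j) \<le> M" using cmod_le_anorm[of j q "x - b"] j b(2) by auto
    moreover have "(x - b) j = of_real (\<bar>M\<bar> + 1)" using \<open>b j = 0\<close> by (simp add: x_def unit_vector_apply)
    ultimately show False unfolding norm_of_real by simp
  qed
  \<comment> \<open>This is f(e^{tL}) applied to \<open>b\<close>: the expanding coordinate is
    annihilated, whereas coordinate \<open>j\<close> is multiplied by a nonzero number.\<close>
  define v where "v = (\<Sum>i\<le>degree f. rscale (of_int (coeff f i)) (flow \<mu> (real i * t) b))"
  have vA: "v \<in> A" unfolding v_def
    using A(2) invn[OF b(1)] by (intro add_subgroup_sum[OF A(2)] add_subgroup_rscale_int[OF A(2)]) auto
  have "poly (map_poly of_int f) (exp t) = 0" using f unfolding poly_of_int_of_real by simp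
  hence "(\<Sum>i\<le>degree f. of_int (coeff f i) * exp t ^ i) = 0" by (simp add: poly_altdef)
  moreover have "cpos v = (\<Sum>i\<le>degree f. of_int (coeff f i) * exp t ^ i) * cpos b"
    by (simp add: v_def cpos_sum sum_distrib_right exp_of_nat_mult mult.assoc)
  ultimately have cv: "cpos v = 0" by simp
  have "v j = poly (cpoly f) (cis (\<mu> j * t)) * b j"
  proof -
    have "cis (\<mu> j * (real i * t)) = cis (\<mu> j * t) ^ i" for i by (simp only: Complex.DeMoivre mult.left_commute)
    thus ?thesis using j by (simp add: v_def sum_fun_apply poly_altdef sum_distrib_right mult.assoc)
  qed
  hence vj: "v j \<noteq> 0" using nr bj by simp
  \<comment> \<open>With \<open>cpos v = 0\<close>, forward iterates contract coordinate 0 and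
    rotate the others.\<close>
  define R where "R = real (Suc q) * (\<bar>cneg v\<bar> + anorm q v)"
  have bound: "anorm q (flow \<mu> (real n * t) v) \<le> R" for n
    unfolding R_def
  proof (rule anorm_leI)
    fix i assume i: "i \<le> q"
    show "cmod (flow \<mu> (real n * t) v i) \<le> \<bar>cneg v\<bar> + anorm q v"
    proof (cases "i = 0")
      case True
      have "exp (- (real n * t)) \<le> 1" using t by simp
      hence e: "\<bar>exp (- (real n * t)) * cneg v\<bar> \<le> \<bar>cneg v\<bar>" unfolding abs_mult
        by (intro mult_left_le_one_le) auto
      have "cmod (flow \<mu> (real n * t) v 0) \<le> \<bar>Re (flow \<mu> (real n * t) v 0)\<bar> + \<bar>Im (flow \<mu> (real n * t) v 0)\<bar>"
        by (rule cmod_le)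
      also have "\<dots> = \<bar>exp (- (real n * t)) * cneg v\<bar>" by (simp add: flow_def cv)
      finally show ?thesis unfolding True using e anorm_ge0[of q v] by linarith
    next
      case False
      hence "cmod (flow \<mu> (real n * t) v i) = cmod (v i)" by (simp add: norm_mult)
      thus ?thesis using cmod_le_anorm[OF i, of v] by simp
    qed
  qed
  have "finite {a \<in> A. anorm q a \<le> R}" using A(1-3) by (rule finite_bounded_separated)
  moreover have "range (\<lambda>n. flow \<mu> (real n * t) v) \<subseteq> {a \<in> A. anorm q a \<le> R}" using bound invn[OF vA] by auto
  ultimately have "finite (range (\<lambda>n. flow \<mu> (real n * t) v))" by (rule finite_subset[rotated])
  hence "\<not> inj (\<lambda>n. flow \<mu> (real n * t) v)" using finite_imageD infinite_UNIV_nat by blast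
  then obtain n n' where n: "n < n'" "flow \<mu> (real n * t) v = flow \<mu> (real n' * t) v"
    unfolding inj_on_def by (metis linorder_neqE_nat)
  have "cis (\<mu> j * (real n * t)) * v j = cis (\<mu> j * (real n' * t)) * v j"
    using arg_cong[OF n(2), of "\<lambda>a. a j"] j by simp
  hence e: "cis (\<mu> j * (real n * t)) = cis (\<mu> j * (real n' * t))" using vj by simp
  have "cis (\<mu> j * t) ^ (n' - n) = cis (\<mu> j * (real n' * t)) / cis (\<mu> j * (real n * t))"
    using n(1) by (simp add: Complex.DeMoivre cis_divide of_nat_diff algebra_simps)
  also have "\<dots> = 1" unfolding e by simp
  finally show ?thesis using n(1) by (intro exI[of _ "n' - n"]) simp
qed

lemma poly_cpoly_pcompose_monom: "poly (cpoly (pcompose f (monom 1 m))) z = poly (cpoly f) (z ^ m)"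
  by (simp add: of_int_hom.map_poly_pcompose poly_pcompose of_int_hom.map_poly_hom_monom poly_monom)

text \<open>Write \<open>P = f * g\<close>. No root of \<open>f\<close> is a root of
  \<open>g\<close>, so \<open>g\<close> has 1 as its only possible root, and comparing the roots of
  \<open>P\<close> with those of both factors gives the multiset identity of
  \<open>in_M\<close>.\<close>

lemma in_M_if_int_eigenvalues:
  fixes q :: nat and \<mu> :: "nat \<Rightarrow> real" and t :: real
  defines "\<nu> \<equiv> \<lambda>j. cis (\<mu> j * t)"
  assumes \<mu>: "\<forall>j\<in>{1..q}. \<mu> j \<noteq> 0" and t: "t > 0"
    and P: "cpoly P = [:- of_real (exp t), 1:] * [:- of_real (exp (- t)), 1:] *
      (\<Prod>j\<in>{1..q}. [:- \<nu> j, 1:] * [:- cnj (\<nu> j), 1:])"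
    and f: "irreducible f" "lead_coeff f = 1" "f dvd P" "poly (cpoly f) (of_real (exp t)) = 0"
    and \<nu>f: "\<And>j. j \<in> {1..q} \<Longrightarrow> \<nu> j = 1 \<or> poly (cpoly f) (\<nu> j) = 0"
  shows "\<exists>qb\<le>q. f \<in> Fplus (2 * qb + 2) \<and> in_M f q qb \<mu>"
proof -
  define r where "r = exp t"
  have r: "r > 1" using t by (simp add: r_def)
  have ri: "exp (- t) = inverse r" by (simp add: r_def exp_minus)
  have ir: "inverse r < 1" "inverse r > 0" using r by (simp_all add: inverse_less_1_iff)
  have cmr: "cmod (of_real r) \<noteq> 1" "cmod (of_real (inverse r)) \<noteq> 1" unfolding norm_of_real using r ir by auto
  have rne: "complex_of_real r \<noteq> of_real (inverse r)" using r ir by (simp only: of_real_eq_iff)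
  have fr: "poly (cpoly f) (of_real r) = 0" using f(4) by (simp add: r_def)
  define E where "E = image_mset \<nu> (mset_set {1..q}) + image_mset (\<lambda>j. cnj (\<nu> j)) (mset_set {1..q})"
  have Ecm: "cmod z = 1" if "z \<in># E" for z using that by (auto simp: E_def \<nu>_def)
  have cP: "cpoly P = [:- of_real r, 1:] * [:- of_real (inverse r), 1:] * (\<Prod>j\<in>{1..q}. [:- \<nu> j, 1:] * [:- cnj (\<nu> j), 1:])"
    using P unfolding ri r_def[symmetric] .
  have lP: "lead_coeff (cpoly P) = 1" unfolding cP by (rule lead_coeff_conj_pairs)
  hence cP0: "cpoly P \<noteq> 0" by auto
  have pP: "proots (cpoly P) = {#of_real r, of_real (inverse r)#} + E"
  proof -
    have "proots (cpoly P) = proots ([:- of_real r, 1:] * [:- of_real (inverse r), 1:]) + E"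
    proof -
      have "proots (\<Prod>j\<in>{1..q}. [:- \<nu> j, 1:] * [:- cnj (\<nu> j), 1:]) = E"
        unfolding E_def by (rule proots_prod_conj_pairs) simp
      thus ?thesis using cP0 unfolding cP by (subst proots_mult) (simp_all only: mult_eq_0_iff de_Morgan_disj simp_thms)
    qed
    also have "proots ([:- complex_of_real r, 1:] * [:- of_real (inverse r), 1:]) = {#of_real r, of_real (inverse r)#}"
      by (subst proots_mult) auto
    finally show ?thesis .
  qed
  obtain g where g: "P = f * g" using f(3) by (elim dvdE)
  have deg: "degree f > 0" using f(2) fr by (rule monic_root_degree_pos)
  have cPfg: "cpoly P = cpoly f * cpoly g" unfolding g by (rule of_int_poly_hom.hom_mult)
  have nz: "cpoly f \<noteq> 0" "cpoly g \<noteq> 0" using cP0 unfolding cPfg by auto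
  have pfg: "proots (cpoly P) = proots (cpoly f) + proots (cpoly g)"
    unfolding cPfg using nz by (rule proots_mult)
  define S where "S = {z. poly (cpoly f) z = 0}"
  define U where "U = {z \<in> S. cmod z = 1}"
  have rsq: "rsquarefree (cpoly f)" using f(1) deg by (rule irreducible_rsquarefree)
  have finS: "finite S" unfolding S_def using nz(1) by (rule poly_roots_finite)
  hence finU: "finite U" by (simp add: U_def)
  have pF: "proots (cpoly f) = mset_set S" unfolding S_def using rsq nz(1) by (rule proots_eq_mset_set)
  have F: "cpoly f = (\<Prod>z\<in>S. [:-z, 1:])" unfolding S_def using rsq f(2) by (rule cpoly_eq_prod_roots)
  have "S \<subseteq> set_mset (proots (cpoly P))" unfolding pfg pF using finS by auto
  hence Ssub: "S \<subseteq> {of_real r, of_real (inverse r)} \<union> U"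
    using Ecm unfolding pP by (auto simp: U_def)
  have rS: "of_real r \<in> S" using fr by (simp add: S_def)
  have nU: "of_real r \<notin> U" "of_real (inverse r) \<notin> U" using cmr by (auto simp: U_def simp del: of_real_inverse)
  \<comment> \<open>Otherwise the roots of \<open>f\<close> are \<open>r\<close> and numbers of
    modulus 1, and \<open>f\<close> has a constant coefficient of modulus \<open>r > 1\<close>,
    although it divides the constant coefficient 1 of \<open>P\<close>.\<close>
  have irS: "of_real (inverse r) \<in> S"
  proof (rule ccontr)
    assume "of_real (inverse r) \<notin> S"
    hence S: "S = insert (of_real r) U" using Ssub rS by (auto simp: U_def)
    have "poly (cpoly f) 0 = (\<Prod>z\<in>S. - z)" unfolding F by (simp add: poly_prod)
    hence "cmod (poly (cpoly f) 0) = (\<Prod>z\<in>S. cmod z)" by (simp add: prod_norm[symmetric])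
    also have "\<dots> = cmod (of_real r) * (\<Prod>z\<in>U. cmod z)" unfolding S using nU finU by simp
    also have "(\<Prod>z\<in>U. cmod z) = 1" by (rule prod.neutral) (simp add: U_def)
    finally have 1: "cmod (poly (cpoly f) 0) = r" using r by simp
    have "poly (cpoly P) 0 = of_real r * of_real (inverse r) * (\<Prod>j\<in>{1..q}. \<nu> j * cnj (\<nu> j))"
      unfolding cP by (simp add: poly_prod mult.commute)
    also have "\<dots> = 1"
    proof -
      have "\<nu> j * cnj (\<nu> j) = 1" for j by (simp add: \<nu>_def cis_cnj cis_mult)
      thus ?thesis using r by simp
    qed
    finally have "poly (cpoly f) 0 * poly (cpoly g) 0 = 1" unfolding cPfg poly_mult .
    hence "of_int (poly f 0 * poly g 0) = (1 :: complex)" by (simp add: poly_0_coeff_0)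
    hence "poly f 0 * poly g 0 = 1" by (metis of_int_1 of_int_eq_iff)
    hence "\<bar>poly f 0\<bar> = 1" by (auto simp: zmult_eq_1_iff)
    moreover have "cmod (poly (cpoly f) 0) = of_int \<bar>poly f 0\<bar>" by (simp add: poly_0_coeff_0)
    ultimately show False using 1 r by simp
  qed
  have S_eq: "S = insert (of_real r) (insert (of_real (inverse r)) U)"
    using Ssub rS irS by (auto simp: U_def)
  have f1: "poly (cpoly f) 1 \<noteq> 0"
  proof
    assume "poly (cpoly f) 1 = 0"
    moreover have "poly (cpoly [:-1, 1:]) 1 = 0" by (simp add: of_int_hom.map_poly_pCons_hom)
    ultimately have "f dvd [:-1, 1:]" using irreducible_dvd_if_common_root[OF f(1) deg] by blast
    from poly_dvd_root[OF this fr] have "complex_of_real r = 1" by (simp add: of_int_hom.map_poly_pCons_hom)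
    thus False using r by simp
  qed
  \<comment> \<open>A common root would make \<open>f\<close> divide \<open>g\<close>, and
    \<open>r\<close> would be a double root of \<open>P\<close>.\<close>
  have ngf: "poly (cpoly g) z \<noteq> 0" if z: "z \<in> S" for z
  proof
    assume "poly (cpoly g) z = 0"
    hence "f dvd g" using z irreducible_dvd_if_common_root[OF f(1) deg] by (auto simp: S_def)
    hence "poly (cpoly g) (of_real r) = 0" using fr by (rule poly_dvd_root)
    hence "of_real r \<in># proots (cpoly g)" using nz(2) by simp
    hence "count (proots (cpoly g)) (of_real r) \<ge> 1" by (simp add: Suc_le_eq)
    moreover have "count (proots (cpoly f)) (of_real r) = 1" unfolding pF using rS finS by simp
    ultimately have "count (proots (cpoly P)) (of_real r) \<ge> 2" unfolding pfg by simp
    moreover have "of_real r \<notin># E" using Ecm cmr by blast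
    hence "count E (of_real r) = 0" by (simp add: not_in_iff)
    hence "count (proots (cpoly P)) (of_real r) = 1" unfolding pP using rne by (simp del: of_real_inverse)
    ultimately show False by simp
  qed
  \<comment> \<open>A root of \<open>g\<close> lies in \<open>E\<close>, and by
    \<open>\<nu>f\<close> and conjugation the members of \<open>E\<close> are 1 or roots of
    \<open>f\<close>.\<close>
  have g1: "z = 1" if z: "z \<in># proots (cpoly g)" for z
  proof -
    have gz: "poly (cpoly g) z = 0" using z nz(2) by simp
    hence zS: "z \<notin> S" using ngf by blast
    have "z \<in># {#of_real r, of_real (inverse r)#} + E" using z unfolding pP[symmetric] pfg by simp
    hence "z \<in># E" using zS rS irS by auto
    then obtain j where j: "j \<in> {1..q}" "z = \<nu> j \<or> z = cnj (\<nu> j)" by (auto simp: E_def)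
    have "poly (cpoly f) (cnj w) = cnj (poly (cpoly f) w)" for w by (simp add: poly_altdef)
    hence "poly (cpoly f) (cnj (\<nu> j)) = 0" if "poly (cpoly f) (\<nu> j) = 0" using that by simp
    thus ?thesis using \<nu>f[OF j(1)] j(2) zS by (auto simp: S_def)
  qed
  define k where "k = size (proots (cpoly g))"
  have pg: "proots (cpoly g) = replicate_mset k 1"
    unfolding k_def using g1 by (metis set_mset_subset_singletonD singletonI subsetI)
  have "mset_set S = {#of_real r, of_real (inverse r)#} + mset_set U"
    unfolding S_eq using nU rne finU by (simp del: of_real_inverse)
  hence EU: "E = mset_set U + replicate_mset k 1"
    using pP unfolding pfg pF pg by (simp add: add.assoc)
  have "1 \<notin> U" using f1 by (simp add: U_def S_def)
  \<comment> \<open>Since 1 is no root of \<open>f\<close>, the unit roots of \<open>f\<close> are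
    exactly the eigenvalues in \<open>E\<close> other than 1, two for each index in
    \<open>J\<close>.\<close>
  define J where "J = {j \<in> {1..q}. \<nu> j \<noteq> 1}"
  define qb where "qb = card J"
  have "J \<subseteq> {1..q}" by (auto simp: J_def)
  hence qbq: "qb \<le> q" unfolding qb_def using card_mono[of "{1..q}" J] by simp
  have cU: "card U = 2 * qb"
  proof -
    have "mset_set U = image_mset \<nu> (mset_set J) + image_mset (\<lambda>j. cnj (\<nu> j)) (mset_set J)"
      using arg_cong[OF EU, of "filter_mset (\<lambda>z. z \<noteq> 1)"]
      unfolding E_def J_def by (simp only: filter_conj_pairs filter_mset_set_replicate[OF finU \<open>1 \<notin> U\<close>] finite_atLeastAtMost)
    from arg_cong[OF this, of size]
    show ?thesis by (simp add: qb_def)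
  qed
  have "size E = 2 * q" by (simp add: E_def)
  hence kq: "k = 2 * (q - qb)" unfolding EU using cU qbq by simp
  have "degree (cpoly f) = card S" unfolding F by (subst degree_prod_eq_sum_degree) auto
  hence degf: "degree f = 2 * qb + 2"
    unfolding S_eq using nU rne finU cU by (simp del: of_real_inverse)
  have fU: "filter_mset (\<lambda>z. cmod z = 1) (proots (cpoly f)) = mset_set U"
    unfolding pF using finS by (simp add: filter_mset_mset_set U_def)
  have "f \<in> Fplus (2 * qb + 2)"
  proof (cases "qb = 0")
    case True
    hence "U = {}" using cU finU by simp
    hence "cpoly f = [:- of_real r, 1:] * [:- of_real (inverse r), 1:]"
      unfolding F S_eq using rne by (simp del: of_real_inverse)
    hence F2: "cpoly f = [:1, - of_real (r + inverse r), 1:]" using r by simp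
    have "of_int (coeff f 0) = (1 :: complex)" using arg_cong[OF F2, of "\<lambda>p. coeff p 0"] by simp
    hence c0: "coeff f 0 = 1" by (metis of_int_1 of_int_eq_iff)
    have "of_int (coeff f 1) = - complex_of_real (r + inverse r)" using arg_cong[OF F2, of "\<lambda>p. coeff p 1"] by simp
    hence c1: "of_int (coeff f 1) = - (r + inverse r)"
      by (metis of_real_eq_iff of_real_minus of_real_of_int_eq)
    \<comment> \<open>The integer \<open>- coeff f 1\<close> equals \<open>r + inverse r\<close>;
      exceeding 2, it is at least 3, as \<open>Fplus 2\<close> demands.\<close>
    have "r + inverse r > 2" using r by (rule add_inverse_gt_2)
    hence "of_int (- coeff f 1) > (2 :: real)" using c1 by simp
    hence "- coeff f 1 \<ge> 3" by linarith
    moreover have "f = [:1, - (- coeff f 1), 1:]"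
    proof (rule poly_eqI)
      fix i :: nat
      have "i = 0 \<or> i = 1 \<or> i = 2 \<or> i > 2" by linarith
      thus "coeff f i = coeff [:1, - (- coeff f 1), 1:] i"
        using c0 f(2) degf True by (auto simp: coeff_eq_0 numeral_2_eq_2 coeff_pCons split: nat.splits)
    qed
    ultimately have "\<exists>a. f = [:1, - a, 1:] \<and> a \<ge> 3" by (intro exI[of _ "- coeff f 1"] conjI)
    thus ?thesis unfolding Fplus_def True by simp
  next
    case False
    have "z \<in> \<real> \<and> Re z > 0" if "poly (cpoly f) z = 0" "cmod z \<noteq> 1" for z
    proof -
      have "z = of_real r \<or> z = of_real (inverse r)" using that S_eq by (auto simp: S_def U_def)
      thus ?thesis using r ir by auto
    qed
    thus ?thesis unfolding Fplus_def using False f(1,2) degf fU cU by auto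
  qed
  moreover have "in_M f q qb \<mu>"
    unfolding in_M_def unit_conj_pair_mset fU
  proof (intro conjI exI[of _ r])
    show "poly (map_poly of_int f) r = 0" using fr unfolding poly_of_int_of_real by simp
    show "image_mset (\<lambda>j. cis (\<mu> j * ln r)) (mset_set {1..q}) + image_mset (\<lambda>j. cnj (cis (\<mu> j * ln r))) (mset_set {1..q})
      = mset_set U + replicate_mset (2 * (q - qb)) 1"
      using EU unfolding E_def kq \<nu>_def r_def by simp
  qed (use \<mu> r in auto)
  ultimately show ?thesis using qbq by blast
qed

lemma in_M_if_admits_lattice:
  assumes \<mu>: "\<forall>j\<in>{1..q}. \<mu> j \<noteq> 0" and lat: "osc_admits_lattice q \<mu>"
  shows "\<exists>qb\<le>q. \<exists>f\<in>Fplus (2 * qb + 2). in_M f q qb \<mu>"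
proof -
  obtain \<Gamma> where "osc_lattice q \<mu> \<Gamma>" using lat by (auto simp: osc_admits_lattice_def)
  from lattice_imp_invariant_lattice[OF this \<mu>] obtain A t0 where t0: "t0 > 0"
    and A: "A \<subseteq> osc_space q" "add_subgroup A" "separated q A" "relatively_dense q A"
    and inv: "\<forall>a\<in>A. flow \<mu> t0 a \<in> A" by blast
  have invn: "flow \<mu> (real n * t0) a \<in> A" if a: "a \<in> A" for n a
  proof (induction n)
    case (Suc n)
    from bspec[OF inv this] show ?case by (simp add: flow_flow algebra_simps)
  qed (use a in simp)
  \<comment> \<open>Stated for all multiples of \<open>t0\<close>, because after enlarging the time
    the factor is chosen afresh.\<close>
  have ex: "\<exists>P f. cpoly P = [:- of_real (exp t), 1:] * [:- of_real (exp (- t)), 1:] *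
      (\<Prod>j\<in>{1..q}. [:- cis (\<mu> j * t), 1:] * [:- cnj (cis (\<mu> j * t)), 1:])
      \<and> irreducible f \<and> lead_coeff f = 1 \<and> f dvd P \<and> poly (cpoly f) (of_real (exp t)) = 0"
    if t: "t = real n * t0" for t n
  proof -
    obtain P where P: "cpoly P = [:- of_real (exp t), 1:] * [:- of_real (exp (- t)), 1:] *
      (\<Prod>j\<in>{1..q}. [:- cis (\<mu> j * t), 1:] * [:- cnj (cis (\<mu> j * t)), 1:])"
      using flow_char_poly_int[OF A, of \<mu> t] invn unfolding t prod_flow_eigenvalue by blast
    have "lead_coeff (cpoly P) = 1" unfolding P by (rule lead_coeff_conj_pairs)
    hence "lead_coeff P = 1" by simp
    moreover have "poly (cpoly P) (of_real (exp t)) = 0" unfolding P poly_mult by simp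
    ultimately show ?thesis using monic_irreducible_factor[of P] P by blast
  qed
  obtain P0 f0 where f0: "irreducible f0" "lead_coeff f0 = 1" "poly (cpoly f0) (of_real (exp t0)) = 0"
    using ex[of t0 1] by auto
  define K where "K = {j \<in> {1..q}. poly (cpoly f0) (cis (\<mu> j * t0)) \<noteq> 0}"
  have "\<forall>j\<in>K. \<exists>N>0. cis (\<mu> j * t0) ^ N = 1"
    using eigenvalue_root_of_unity[OF A _ t0 f0(3)] inv by (auto simp: K_def)
  then obtain N where N: "\<And>j. j \<in> K \<Longrightarrow> N j > 0 \<and> cis (\<mu> j * t0) ^ N j = 1" by metis
  \<comment> \<open>A common multiple of the orders of those rotations that are not roots of
    \<open>f0\<close>.\<close>
  define m where "m = (\<Prod>j\<in>K. N j)"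
  have finK: "finite K" by (simp add: K_def)
  have m: "m > 0" unfolding m_def using N by (intro prod_pos) auto
  have Km: "cis (\<mu> j * t0) ^ m = 1" if "j \<in> K" for j
  proof -
    have "N j dvd m" unfolding m_def using finK that by (intro dvd_prodI) auto
    thus ?thesis using N[OF that] by (auto elim!: dvdE simp: power_mult)
  qed
  define t where "t = real m * t0"
  have t: "t > 0" using m t0 by (simp add: t_def)
  have pw: "cis (\<mu> j * t) = cis (\<mu> j * t0) ^ m" for j
    by (simp only: Complex.DeMoivre t_def mult.left_commute)
  obtain P f where P: "cpoly P = [:- of_real (exp t), 1:] * [:- of_real (exp (- t)), 1:] *
      (\<Prod>j\<in>{1..q}. [:- cis (\<mu> j * t), 1:] * [:- cnj (cis (\<mu> j * t)), 1:])"
    and f: "irreducible f" "lead_coeff f = 1" "f dvd P" "poly (cpoly f) (of_real (exp t)) = 0"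
    using ex[OF t_def] by blast
  have "cis (\<mu> j * t) = 1 \<or> poly (cpoly f) (cis (\<mu> j * t)) = 0" if j: "j \<in> {1..q}" for j
  proof (cases "j \<in> K")
    case True
    thus ?thesis using Km pw by simp
  next
    case False
    hence fj: "poly (cpoly f0) (cis (\<mu> j * t0)) = 0" using j by (simp add: K_def)
    \<comment> \<open>The polynomial f(x^m) vanishes at \<open>exp t0\<close>, hence is divisible by
      \<open>f0\<close>, hence vanishes at every root of \<open>f0\<close>: the \<open>m\<close>-th
      powers of these are roots of \<open>f\<close>.\<close>
    have "complex_of_real (exp t0) ^ m = of_real (exp t)"
      by (simp add: t_def exp_of_nat_mult)
    hence "poly (cpoly (pcompose f (monom 1 m))) (of_real (exp t0)) = 0"
      unfolding poly_cpoly_pcompose_monom using f(4) by simp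
    moreover have "degree f0 > 0" using f0(2,3) by (rule monic_root_degree_pos)
    ultimately have "f0 dvd pcompose f (monom 1 m)"
      using irreducible_dvd_if_common_root[OF f0(1) _ f0(3)] by blast
    from poly_dvd_root[OF this fj] show ?thesis unfolding poly_cpoly_pcompose_monom pw by simp
  qed
  from in_M_if_int_eigenvalues[OF \<mu> t P f this] show ?thesis by blast
qed

theorem theorem1:
  shows "(\<forall>\<mu>. osc_admits_lattice 0 \<mu>) \<and>
    (\<forall>q>0. \<forall>\<mu>::nat \<Rightarrow> real. (\<forall>j\<in>{1..q}. \<mu> j \<noteq> 0) \<longrightarrow>
       (osc_admits_lattice q \<mu> \<longleftrightarrow>
          (\<exists>qb. qb \<le> q \<and> (\<exists>f\<in>Fplus (2 * qb + 2). in_M f q qb \<mu>))))"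
  using admits_lattice_0 in_M_if_admits_lattice admits_lattice_if_in_M by blast

end
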